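(* Let $G$ be a finite group with a homoclinic triple $(K,g,H)$ satisfying in addition $H<N_G(K)\cap N_G(K^{g^{-1}})$. Let $M$ be the complex regular representation of $G$ (of real dimension $2|G|$). Then there is a non-empty open set of $G$-equivariant vector fields on $M$ for which there is a relative homoclinic trajectory with isotropy $K$ and twist $g$.
   Context: Notation: $A<B$ means that $A$ is a subgroup of $B$ (not necessarily proper); $H^g=gHg^{-1}$, so $K^{g^{-1}}=g^{-1}Kg$; $N_G(K)=\{g\in G: gK=Kg\}$. A homoclinic triple for $G$ is a triple $(K,g,H)$, with $K,H$ subgroups of $G$ and $g\in G$, such that (HT1) $gH\cap N_G(K)=\emptyset$ and (HT2) $K<H\cap H^g$. For $G$ finite, a relative equilibrium of a $G$-equivariant vector field is a group orbit $X_0=G\cdot x_0$ of equilibrium points; it is normally hyperbolic when these are hyperbolic equilibria. A relative homoclinic trajectory (RHT) to $X_0$ is a trajectory $\gamma(t)$ with $\gamma(t)\notin X_0$ and $\gamma(t)\to X_0$ as $t\to\pm\infty$; only RHTs to normally hyperbolic relative equilibria are considered. All points $\gamma(t)$ have the same isotropy subgroup, called the isotropy of $\gamma$. The $\alpha$-limit of $\gamma$ is an equilibrium $x$ and the $\omega$-limit is $g\cdot x$ for some $g\in G$; any such $g$ is called a twist of $\gamma$ (it is determined modulo the isotropy subgroup of $x$). The set of $G$-equivariant vector fields is given a sufficiently fine $C^r$ topology. $M$ is regarded as a real vector space (vector fields need not be holomorphic). *)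

theory Defs
  imports "HOL-Analysis.Analysis" "HOL-Algebra.Group_Action" "HOL-Library.Extended_Nat"
begin

section \<open>Homoclinic triples\<close>

definition conj_subgroup :: "('g, 'm) monoid_scheme \<Rightarrow> 'g set \<Rightarrow> 'g \<Rightarrow> 'g set" where
  "conj_subgroup G H g = g <#\<^bsub>G\<^esub> H #>\<^bsub>G\<^esub> (inv\<^bsub>G\<^esub> g)"

definition homoclinic_triple ::
    "('g, 'm) monoid_scheme \<Rightarrow> 'g set \<Rightarrow> 'g \<Rightarrow> 'g set \<Rightarrow> bool" where
  "homoclinic_triple G K g H \<longleftrightarrow>
     subgroup K G \<and> subgroup H G \<and> g \<in> carrier G \<and>
     (g <#\<^bsub>G\<^esub> H) \<inter> normalizer G K = {} \<and>
     K \<subseteq> H \<inter> conj_subgroup G H g"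

text \<open>The library's normalizer is a stabilizer under conjugation; it is the set of
  all \<open>g\<close> with \<open>gK = Kg\<close>.\<close>

lemma (in group) normalizer_eq_cosets:
  assumes K: "K \<subseteq> carrier G"
  shows "normalizer G K = {g \<in> carrier G. g <# K = K #> g}"
proof -
  have "(g <# K #> inv g = K) \<longleftrightarrow> (g <# K = K #> g)" if g: "g \<in> carrier G" for g
  proof
    assume "g <# K #> inv g = K"
    then have "(g <# K #> inv g) #> g = K #> g" by simp
    moreover have "(g <# K #> inv g) #> g = g <# K"
      using g K by (simp add: coset_mult_assoc l_coset_subset_G)
    ultimately show "g <# K = K #> g" by simp
  next
    assume "g <# K = K #> g"
    then show "g <# K #> inv g = K"
      using g K by (simp add: coset_mult_assoc)
  qed
  then show ?thesis
    using K by (auto simp: normalizer_def stabilizer_def)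
qed

section \<open>The complex regular representation\<close>

text \<open>For a group whose carrier is the whole finite type \<open>'g\<close>, the regular representation
  is \<^typ>\<open>complex ^ 'g\<close>, a real Euclidean space of dimension twice the group order.
  An element is a function on the group and \<open>(h v)(x) = v (h\<^sup>-\<^sup>1 x)\<close>, so that \<open>h\<close> sends the
  basis vector at \<open>x\<close> to the one at \<open>h x\<close>.\<close>

definition regular_act ::
    "('g::finite, 'm) monoid_scheme \<Rightarrow> 'g \<Rightarrow> complex ^ 'g \<Rightarrow> complex ^ 'g" where
  "regular_act G h v = (\<chi> x. v $ (inv\<^bsub>G\<^esub> h \<otimes>\<^bsub>G\<^esub> x))"

lemma regular_act_one:
  assumes "group G" "carrier G = UNIV"
  shows "regular_act G \<one>\<^bsub>G\<^esub> v = v"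
proof -
  interpret group G by fact
  show ?thesis using assms(2) by (simp add: regular_act_def vec_eq_iff)
qed

lemma regular_act_mult:
  assumes "group G" "carrier G = UNIV"
  shows "regular_act G (a \<otimes>\<^bsub>G\<^esub> b) v = regular_act G a (regular_act G b v)"
proof -
  interpret group G by fact
  show ?thesis
    using assms(2) by (simp add: regular_act_def vec_eq_iff inv_mult_group m_assoc)
qed

lemma regular_act_axis:
  assumes "group G" "carrier G = UNIV"
  shows "regular_act G h (axis x 1) = axis (h \<otimes>\<^bsub>G\<^esub> x) 1"
proof -
  interpret group G by fact
  have "(inv\<^bsub>G\<^esub> h \<otimes>\<^bsub>G\<^esub> y = x) \<longleftrightarrow> (y = h \<otimes>\<^bsub>G\<^esub> x)" for y
    using assms(2) by (metis UNIV_I inv_solve_left')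
  then show ?thesis by (simp add: regular_act_def vec_eq_iff axis_def)
qed

section \<open>Vector fields and the Whitney topology\<close>

text \<open>\<open>iter_deriv X [v\<^sub>k, \<dots>, v\<^sub>1] x\<close> is the value of the \<open>k\<close>-th derivative of \<open>X\<close> at \<open>x\<close>
  on \<open>v\<^sub>1, \<dots>, v\<^sub>k\<close>.\<close>

fun iter_deriv ::
    "('a::real_normed_vector \<Rightarrow> 'b::real_normed_vector) \<Rightarrow> 'a list \<Rightarrow> 'a \<Rightarrow> 'b" where
  "iter_deriv X [] = X"
| "iter_deriv X (v # vs) = (\<lambda>x. frechet_derivative (iter_deriv X vs) (at x) v)"

definition Cr_fields :: "enat \<Rightarrow> ('a::euclidean_space \<Rightarrow> 'a) set" where
  "Cr_fields r = {X.
     (\<forall>vs x. enat (length vs) < r \<longrightarrow> iter_deriv X vs differentiable (at x)) \<and>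
     (\<forall>vs. enat (length vs) \<le> r \<longrightarrow> continuous_on UNIV (iter_deriv X vs))}"

text \<open>All derivatives up to order \<open>k\<close> are \<open>\<epsilon>\<close>-close in operator norm, where the gauge
  \<open>\<epsilon>\<close> depends on the point. By compactness of the unit ball the pointwise strict inequality
  is the strict inequality of operator norms.\<close>

definition Ck_near ::
    "nat \<Rightarrow> ('a::euclidean_space \<Rightarrow> real) \<Rightarrow> ('a \<Rightarrow> 'a) \<Rightarrow> ('a \<Rightarrow> 'a) set" where
  "Ck_near k \<epsilon> X = {Y. \<forall>vs x. length vs \<le> k \<longrightarrow> (\<forall>v\<in>set vs. norm v \<le> 1) \<longrightarrow>
     norm (iter_deriv Y vs x - iter_deriv X vs x) < \<epsilon> x}"

text \<open>For finite \<open>r\<close> this is the fine (Whitney, strong) \<open>C\<^sup>r\<close> topology on \<open>C\<^sup>r\<close> vector fields;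
  for \<open>r = \<infinity>\<close> it is the Whitney topology on smooth vector fields, generated by
  the \<open>C\<^sup>k\<close> topologies for all finite \<open>k\<close>.\<close>

definition whitney_open :: "enat \<Rightarrow> ('a::euclidean_space \<Rightarrow> 'a) set \<Rightarrow> bool" where
  "whitney_open r U \<longleftrightarrow> U \<subseteq> Cr_fields r \<and>
     (\<forall>X\<in>U. \<exists>k \<epsilon>. enat k \<le> r \<and> continuous_on UNIV \<epsilon> \<and> (\<forall>x. 0 < \<epsilon> x) \<and>
        Ck_near k \<epsilon> X \<inter> Cr_fields r \<subseteq> U)"

definition whitney_topology :: "enat \<Rightarrow> ('a::euclidean_space \<Rightarrow> 'a) topology" where
  "whitney_topology r = topology (whitney_open r)"

lemma istopology_whitney_open: "istopology (whitney_open r)"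
  unfolding istopology_def
proof (intro conjI allI impI)
  fix S T :: "('a \<Rightarrow> 'a) set"
  assume S: "whitney_open r S" and T: "whitney_open r T"
  show "whitney_open r (S \<inter> T)"
    unfolding whitney_open_def
  proof (intro conjI ballI)
    show "S \<inter> T \<subseteq> Cr_fields r" using S by (auto simp: whitney_open_def)
  next
    fix X assume X: "X \<in> S \<inter> T"
    obtain k \<epsilon> where 1: "enat k \<le> r" "continuous_on UNIV \<epsilon>" "\<And>x. 0 < \<epsilon> x"
        "Ck_near k \<epsilon> X \<inter> Cr_fields r \<subseteq> S"
      using S X unfolding whitney_open_def by blast
    obtain l \<delta> where 2: "enat l \<le> r" "continuous_on UNIV \<delta>" "\<And>x. 0 < \<delta> x"
        "Ck_near l \<delta> X \<inter> Cr_fields r \<subseteq> T"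
      using T X unfolding whitney_open_def by blast
    have "Ck_near (max k l) (\<lambda>x. min (\<epsilon> x) (\<delta> x)) X \<subseteq> Ck_near k \<epsilon> X \<inter> Ck_near l \<delta> X"
      unfolding Ck_near_def by auto
    then have "Ck_near (max k l) (\<lambda>x. min (\<epsilon> x) (\<delta> x)) X \<inter> Cr_fields r \<subseteq> S \<inter> T"
      using 1(4) 2(4) by blast
    moreover have "enat (max k l) \<le> r" using 1(1) 2(1) by (simp add: max_def)
    moreover have "continuous_on UNIV (\<lambda>x. min (\<epsilon> x) (\<delta> x))"
      using 1(2) 2(2) by (rule continuous_on_min)
    ultimately show "\<exists>k \<epsilon>. enat k \<le> r \<and> continuous_on UNIV \<epsilon> \<and> (\<forall>x. 0 < \<epsilon> x) \<and>
        Ck_near k \<epsilon> X \<inter> Cr_fields r \<subseteq> S \<inter> T"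
      using 1(3) 2(3)
      by (intro exI[of _ "max k l"] exI[of _ "\<lambda>x. min (\<epsilon> x) (\<delta> x)"]) simp
  qed
next
  fix \<K> :: "('a \<Rightarrow> 'a) set set"
  assume *: "\<forall>U\<in>\<K>. whitney_open r U"
  show "whitney_open r (\<Union>\<K>)"
    unfolding whitney_open_def
  proof (intro conjI ballI)
    show "\<Union>\<K> \<subseteq> Cr_fields r" using * by (auto simp: whitney_open_def)
  next
    fix X assume "X \<in> \<Union>\<K>"
    then obtain U where U: "U \<in> \<K>" "X \<in> U" by blast
    then obtain k \<epsilon> where "enat k \<le> r" "continuous_on UNIV \<epsilon>" "\<forall>x. 0 < \<epsilon> x"
        "Ck_near k \<epsilon> X \<inter> Cr_fields r \<subseteq> U"
      using * unfolding whitney_open_def by blast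
    with U(1) show "\<exists>k \<epsilon>. enat k \<le> r \<and> continuous_on UNIV \<epsilon> \<and> (\<forall>x. 0 < \<epsilon> x) \<and>
        Ck_near k \<epsilon> X \<inter> Cr_fields r \<subseteq> \<Union>\<K>"
      by blast
  qed
qed

lemma openin_whitney: "openin (whitney_topology r) = whitney_open r"
  by (simp add: whitney_topology_def istopology_whitney_open)

lemma topspace_whitney: "topspace (whitney_topology r) = Cr_fields r"
proof
  show "topspace (whitney_topology r) \<subseteq> Cr_fields r"
    using openin_topspace[of "whitney_topology r"] by (metis openin_whitney whitney_open_def)
  have "whitney_open r (Cr_fields r)"
    unfolding whitney_open_def
    by (intro conjI ballI subset_refl exI[of _ 0] exI[of _ "\<lambda>_. 1"])
       (auto simp: zero_enat_def[symmetric])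
  then show "Cr_fields r \<subseteq> topspace (whitney_topology r)"
    by (metis openin_subset openin_whitney)
qed

definition equivariant ::
    "('g::finite, 'm) monoid_scheme \<Rightarrow> (complex ^ 'g \<Rightarrow> complex ^ 'g) \<Rightarrow> bool" where
  "equivariant G X \<longleftrightarrow>
     (\<forall>h\<in>carrier G. \<forall>x. X (regular_act G h x) = regular_act G h (X x))"

definition equivariant_fields_topology ::
    "('g::finite, 'm) monoid_scheme \<Rightarrow> enat \<Rightarrow> (complex ^ 'g \<Rightarrow> complex ^ 'g) topology" where
  "equivariant_fields_topology G r = subtopology (whitney_topology r) {X. equivariant G X}"

section \<open>Relative equilibria and relative homoclinic trajectories\<close>

text \<open>Eigenvalues of the complexification of a real-linear map: \<open>u + iv\<close> is the
  eigenvector in the complexified space. On \<^typ>\<open>complex ^ 'g\<close> this ignores the complex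
  structure already present, since derivatives are only real-linear.\<close>

definition complexified_eigenvalue :: "('a::real_vector \<Rightarrow> 'a) \<Rightarrow> complex \<Rightarrow> bool" where
  "complexified_eigenvalue L z \<longleftrightarrow>
     (\<exists>u v. (u, v) \<noteq> (0, 0) \<and>
        L u = Re z *\<^sub>R u - Im z *\<^sub>R v \<and>
        L v = Im z *\<^sub>R u + Re z *\<^sub>R v)"

definition hyperbolic_equilibrium ::
    "('a::euclidean_space \<Rightarrow> 'a) \<Rightarrow> 'a \<Rightarrow> bool" where
  "hyperbolic_equilibrium X x \<longleftrightarrow>
     X x = 0 \<and> (\<forall>z. complexified_eigenvalue (frechet_derivative X (at x)) z \<longrightarrow> Re z \<noteq> 0)"

definition normally_hyperbolic_rel_equilibrium ::
    "('g::finite, 'm) monoid_scheme \<Rightarrow> (complex ^ 'g \<Rightarrow> complex ^ 'g) \<Rightarrow> (complex ^ 'g) set \<Rightarrow> bool"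
  where
  "normally_hyperbolic_rel_equilibrium G X X\<^sub>0 \<longleftrightarrow>
     (\<exists>x\<^sub>0. X\<^sub>0 = orbit G (regular_act G) x\<^sub>0) \<and> (\<forall>x\<in>X\<^sub>0. hyperbolic_equilibrium X x)"

definition trajectory :: "('a::euclidean_space \<Rightarrow> 'a) \<Rightarrow> (real \<Rightarrow> 'a) \<Rightarrow> bool" where
  "trajectory X \<gamma> \<longleftrightarrow> (\<forall>t. (\<gamma> has_vector_derivative X (\<gamma> t)) (at t))"

definition relative_homoclinic_trajectory ::
    "('a::euclidean_space \<Rightarrow> 'a) \<Rightarrow> 'a set \<Rightarrow> (real \<Rightarrow> 'a) \<Rightarrow> bool" where
  "relative_homoclinic_trajectory X X\<^sub>0 \<gamma> \<longleftrightarrow>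
     trajectory X \<gamma> \<and> (\<forall>t. \<gamma> t \<notin> X\<^sub>0) \<and>
     ((\<lambda>t. infdist (\<gamma> t) X\<^sub>0) \<longlongrightarrow> 0) at_bot \<and>
     ((\<lambda>t. infdist (\<gamma> t) X\<^sub>0) \<longlongrightarrow> 0) at_top"

definition has_isotropy ::
    "('g::finite, 'm) monoid_scheme \<Rightarrow> 'g set \<Rightarrow> (real \<Rightarrow> complex ^ 'g) \<Rightarrow> bool" where
  "has_isotropy G K \<gamma> \<longleftrightarrow> (\<forall>t. stabilizer G (regular_act G) (\<gamma> t) = K)"

definition has_twist ::
    "('g::finite, 'm) monoid_scheme \<Rightarrow> 'g \<Rightarrow> (real \<Rightarrow> complex ^ 'g) \<Rightarrow> bool" where
  "has_twist G g \<gamma> \<longleftrightarrow>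
     g \<in> carrier G \<and> (\<exists>x. (\<gamma> \<longlongrightarrow> x) at_bot \<and> (\<gamma> \<longlongrightarrow> regular_act G g x) at_top)"

end

theory Submission
  imports Defs "HOL-Real_Asymp.Real_Asymp"
begin

text \<open>Let \<open>K' = g\<inverse>Kg\<close> and let \<open>x\<^sub>0\<close> be the indicator function of \<open>H\<close>. We look for a
  saddle at \<open>x\<^sub>0\<close> whose linear part is \<open>1\<close> on the vectors fixed by \<open>K\<close> and orthogonal to those fixed
  by \<open>K'\<close>, and \<open>-1\<close> on the orthogonal complement. This is \<open>H\<close>-equivariant because \<open>H\<close> normalizes \<open>K\<close> and \<open>K'\<close>, it has unstable
  directions because \<open>g\<close> does not normalize \<open>K\<close>, and its translate \<open>g x\<^sub>0\<close> is a sink inside the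
  fixed space of \<open>K\<close>. So a connection from \<open>x\<^sub>0\<close> to \<open>g x\<^sub>0\<close> inside that flow-invariant space is
  of saddle--sink type and persists under equivariant perturbations that are small in \<open>C\<^sup>1\<close>.

  One such connection is built by hand with bump functions. For a perturbed field the equilibrium
  is found by Banach's theorem, its unstable orbit with prescribed unstable part by the
  Lyapunov--Perron method; Gronwall's inequality carries it close to \<open>g x\<^sub>0\<close>, where it is trapped.
  Uniqueness of solutions shows that the isotropy is exactly \<open>K\<close>.\<close>

section \<open>Smooth functions\<close>

text \<open>The complex representation consists of two real copies of the regular one, and each has
  its own task. The equilibria lie in the real copy; the direction \<open>W\<close> in which the
  connection departs lies in the imaginary one. A field prescribed along a curve must not contradict
  its own translates, yet real parts of translated curves may meet, and curves sharing an
  equilibrium come arbitrarily close there. In the interior the imaginary part of the curve is a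
  positive multiple of \<open>W\<close>, whose isotropy is exactly \<open>K\<close>, so translates
  by elements outside \<open>K\<close> point in directions at a definite angle to \<open>W\<close>.
  At the ends, where this separation degenerates, nothing has to be prescribed: the curve is
  parametrized so that it is already an orbit of the linear field there.

  Gronwall's inequality controls a perturbation only over a finite time. The two infinite ends of
  the connection are therefore treated separately, with estimates that need no more than a small
  perturbation with a small Lipschitz constant; the perturbed field is never linearized.\<close>

definition flat :: "nat \<Rightarrow> real \<Rightarrow> real" where
  "flat n t = (if t \<le> 0 then 0 else exp (- (1 / t)) / t ^ n)"

lemma flat_tendsto_0: "(flat n \<longlongrightarrow> 0) (at_right 0)"
proof -
  have "((\<lambda>t. (inverse t) ^ n / exp (inverse t)) \<longlongrightarrow> 0) (at_right (0::real))"
    using filterlim_compose[OF tendsto_power_div_exp_0 filterlim_inverse_at_top_right] .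
  moreover have "\<forall>\<^sub>F t in at_right (0::real). (inverse t) ^ n / exp (inverse t) = flat n t"
    unfolding eventually_at_right_field
    by (rule exI[of _ 1]) (auto simp: flat_def exp_minus field_simps)
  ultimately show ?thesis using tendsto_cong by fast
qed

text \<open>Differentiation stays inside the family, which is why the powers of \<open>1 / t\<close>
  are carried along. At 0 the right-hand difference quotient of \<open>flat n\<close> is
  \<open>flat (n + 1)\<close>, which tends to 0.\<close>

lemma has_real_derivative_flat:
  "(flat n has_real_derivative (flat (n + 2) t - real n * flat (n + 1) t)) (at t)"
proof -
  consider "t < 0" | "t > 0" | "t = 0" by linarith
  then show ?thesis
  proof cases
    case 1
    have "((\<lambda>_. 0) has_real_derivative 0) (at t)" by simp
    then have "(flat n has_real_derivative 0) (at t)"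
      by (rule has_field_derivative_transform_within_open[of _ _ _ "{..<0}"]) (use 1 in \<open>auto simp: flat_def\<close>)
    then show ?thesis using 1 by (simp add: flat_def)
  next
    case 2
    have "((\<lambda>t. exp (- (1 / t)) / t ^ n) has_real_derivative (flat (n + 2) t - real n * flat (n + 1) t)) (at t)"
      using 2 
      by (auto intro!: derivative_eq_intros simp: flat_def field_simps power2_eq_square)
         (cases n; simp add: field_simps)
    then show ?thesis
      by (rule has_field_derivative_transform_within_open[of _ _ _ "{0<..}"]) (use 2 in \<open>auto simp: flat_def\<close>)
  next
    case 3
    have r: "((\<lambda>h. flat n h / h) \<longlongrightarrow> 0) (at_right 0)"
    proof (rule Lim_transform_eventually[OF flat_tendsto_0[of "Suc n"]])
      show "\<forall>\<^sub>F t in at_right 0. flat (Suc n) t = flat n t / t"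
        unfolding eventually_at_right_field
        by (rule exI[of _ 1]) (auto simp: flat_def field_simps)
    qed
    have l: "((\<lambda>h. flat n h / h) \<longlongrightarrow> 0) (at_left 0)"
    proof (rule Lim_transform_eventually[OF tendsto_const])
      show "\<forall>\<^sub>F t in at_left 0. 0 = flat n t / t"
        unfolding eventually_at_left_field
        by (rule exI[of _ "-1"]) (auto simp: flat_def)
    qed
    have "((\<lambda>h. flat n h / h) \<longlongrightarrow> 0) (at 0)"
      using l r by (simp add: filterlim_split_at)
    then show ?thesis using 3 by (simp add: DERIV_def flat_def)
  qed
qed

text \<open>Not all smooth functions, but a class that contains what is needed below and is closed
  under directional derivatives.\<close>

inductive smooth :: "('a::euclidean_space \<Rightarrow> real) \<Rightarrow> bool" where
  smooth_const: "smooth (\<lambda>x. c)"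
| smooth_inner: "smooth (\<lambda>x. x \<bullet> b)"
| smooth_add: "smooth f \<Longrightarrow> smooth g \<Longrightarrow> smooth (\<lambda>x. f x + g x)"
| smooth_mult: "smooth f \<Longrightarrow> smooth g \<Longrightarrow> smooth (\<lambda>x. f x * g x)"
| smooth_flat: "smooth f \<Longrightarrow> smooth (\<lambda>x. flat n (f x))"

lemma smooth_derivative:
  assumes "smooth f"
  shows "\<exists>f'. (\<forall>x. (f has_derivative f' x) (at x)) \<and> (\<forall>v. smooth (\<lambda>x. f' x v))"
  using assms
proof induction
  case (smooth_const c)
  show ?case by (rule exI[of _ "\<lambda>_ _. 0"]) (auto intro: smooth.smooth_const)
next
  case (smooth_inner b)
  show ?case
    by (rule exI[of _ "\<lambda>_ v. v \<bullet> b"]) (auto intro!: derivative_eq_intros smooth.smooth_const)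
next
  case (smooth_add f g)
  then obtain f' g' where
    "\<And>x. (f has_derivative f' x) (at x)" "\<And>v. smooth (\<lambda>x. f' x v)"
    "\<And>x. (g has_derivative g' x) (at x)" "\<And>v. smooth (\<lambda>x. g' x v)" by blast
  then show ?case
    by (intro exI[of _ "\<lambda>x v. f' x v + g' x v"]) (auto intro!: derivative_intros smooth.smooth_add)
next
  case (smooth_mult f g)
  then obtain f' g' where
    "\<And>x. (f has_derivative f' x) (at x)" "\<And>v. smooth (\<lambda>x. f' x v)"
    "\<And>x. (g has_derivative g' x) (at x)" "\<And>v. smooth (\<lambda>x. g' x v)" by blast
  then show ?case using smooth_mult.hyps
    by (intro exI[of _ "\<lambda>x v. f x * g' x v + f' x v * g x"])
       (auto intro!: has_derivative_mult smooth.intros)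
next
  case (smooth_flat f n)
  then obtain f' where
    f': "\<And>x. (f has_derivative f' x) (at x)" "\<And>v. smooth (\<lambda>x. f' x v)" by blast
  let ?d = "\<lambda>x. flat (n + 2) (f x) + (- real n) * flat (n + 1) (f x)"
  have "((\<lambda>x. flat n (f x)) has_derivative (\<lambda>v. ?d x * f' x v)) (at x)" for x
    using has_derivative_compose[OF f'(1) has_field_derivative_imp_has_derivative[OF has_real_derivative_flat]]
    by simp
  moreover have "smooth (\<lambda>x. ?d x * f' x v)" for v
    by (intro smooth.intros f' smooth_flat.hyps)
  ultimately show ?case by (intro exI[of _ "\<lambda>x v. ?d x * f' x v"]) auto
qed

lemma smooth_cmult: "smooth f \<Longrightarrow> smooth (\<lambda>x. c * f x)"
  by (intro smooth_mult smooth_const)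

lemma smooth_diff: "smooth f \<Longrightarrow> smooth g \<Longrightarrow> smooth (\<lambda>x. f x - g x)"
  using smooth_add[OF _ smooth_cmult[of g "-1"], of f] by simp

lemma smooth_divide: "smooth f \<Longrightarrow> smooth (\<lambda>x. f x / c)"
  using smooth_cmult[of f "inverse c"] by (simp add: field_simps)

lemma smooth_sum: "(\<And>i. i \<in> I \<Longrightarrow> smooth (f i)) \<Longrightarrow> smooth (\<lambda>x. \<Sum>i\<in>I. f i x)"
  by (induction I rule: infinite_finite_induct) (auto intro: smooth_const smooth_add)

lemma smooth_id: "smooth (\<lambda>x::real. x)"
  using smooth_inner[of "1::real"] by simp

lemma smooth_compose_real: "smooth f \<Longrightarrow> smooth g \<Longrightarrow> smooth (\<lambda>x. f (g x :: real))"
proof (induction rule: smooth.induct)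
  case (smooth_inner b)
  then show ?case using smooth_cmult[of g b] by (simp add: mult.commute)
qed (auto intro: smooth.intros)

lemma smooth_compose_linear: "smooth f \<Longrightarrow> linear L \<Longrightarrow> smooth (\<lambda>x. f (L x))"
proof (induction rule: smooth.induct)
  case (smooth_inner b)
  then show ?case using smooth.smooth_inner[of "adjoint L b"] by (simp add: adjoint_works)
qed (auto intro: smooth.intros)

lemma smooth_continuous_on:
  assumes "smooth f" shows "continuous_on S f"
proof -
  obtain f' where f': "\<And>x. (f has_derivative f' x) (at x)" using smooth_derivative[OF assms] by blast
  show ?thesis by (intro continuous_at_imp_continuous_on ballI has_derivative_continuous[OF f'])
qed

text \<open>Testing against every vector \<open>w\<close>, not only against a basis, reduces
  composition with a linear map to passing to its adjoint.\<close>

definition vsmooth :: "('a::euclidean_space \<Rightarrow> 'b::euclidean_space) \<Rightarrow> bool" where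
  "vsmooth f \<longleftrightarrow> (\<forall>w. smooth (\<lambda>x. f x \<bullet> w))"

lemma smooth_inner_vsmooth:
  assumes "vsmooth f" "vsmooth g"
  shows "smooth (\<lambda>x. f x \<bullet> g x)"
proof -
  have "smooth (\<lambda>x. \<Sum>b\<in>Basis. (f x \<bullet> b) * (g x \<bullet> b))"
    using assms by (intro smooth_sum smooth_mult) (auto simp: vsmooth_def)
  then show ?thesis by (simp add: euclidean_inner[symmetric])
qed

lemma vsmooth_const: "vsmooth (\<lambda>x. c)"
  by (simp add: vsmooth_def smooth_const)

lemma vsmooth_add: "vsmooth f \<Longrightarrow> vsmooth g \<Longrightarrow> vsmooth (\<lambda>x. f x + g x)"
  by (simp add: vsmooth_def inner_add_left smooth_add)

lemma vsmooth_diff: "vsmooth f \<Longrightarrow> vsmooth g \<Longrightarrow> vsmooth (\<lambda>x. f x - g x)"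
  by (simp add: vsmooth_def inner_diff_left smooth_diff)

lemma vsmooth_scaleR: "smooth f \<Longrightarrow> vsmooth g \<Longrightarrow> vsmooth (\<lambda>x. f x *\<^sub>R g x)"
  by (simp add: vsmooth_def smooth_mult)

lemma vsmooth_sum: "(\<And>i. i \<in> I \<Longrightarrow> vsmooth (f i)) \<Longrightarrow> vsmooth (\<lambda>x. \<Sum>i\<in>I. f i x)"
  by (simp add: vsmooth_def inner_sum_left smooth_sum)

lemma vsmooth_linear: "linear L \<Longrightarrow> vsmooth f \<Longrightarrow> vsmooth (\<lambda>x. L (f x))"
  by (simp add: vsmooth_def adjoint_works[symmetric])

lemma vsmooth_id: "vsmooth (\<lambda>x. x)"
  by (simp add: vsmooth_def smooth_inner)

lemma vsmooth_compose_linear: "vsmooth f \<Longrightarrow> linear L \<Longrightarrow> vsmooth (\<lambda>x. f (L x))"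
  using smooth_compose_linear unfolding vsmooth_def by fastforce

lemma vsmooth_derivative:
  assumes "vsmooth f"
  shows "\<exists>f'. (\<forall>x. (f has_derivative f' x) (at x)) \<and> (\<forall>v. vsmooth (\<lambda>x. f' x v))"
proof -
  have "\<forall>b. \<exists>f'. (\<forall>x. ((\<lambda>x. f x \<bullet> b) has_derivative f' x) (at x)) \<and> (\<forall>v. smooth (\<lambda>x. f' x v))"
    using assms smooth_derivative unfolding vsmooth_def by blast
  then obtain f' where f': "\<And>b x. ((\<lambda>x. f x \<bullet> b) has_derivative f' b x) (at x)"
      "\<And>b v. smooth (\<lambda>x. f' b x v)" by metis
  show ?thesis
  proof (intro exI[of _ "\<lambda>x v. \<Sum>b\<in>Basis. f' b x v *\<^sub>R b"] conjI allI)
    fix x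
    show "(f has_derivative (\<lambda>v. \<Sum>b\<in>Basis. f' b x v *\<^sub>R b)) (at x)"
      using f'(1) by (subst has_derivative_componentwise_within) simp
  next
    fix v
    show "vsmooth (\<lambda>x. \<Sum>b\<in>Basis. f' b x v *\<^sub>R b)"
      by (intro vsmooth_sum vsmooth_scaleR f' vsmooth_const)
  qed
qed

lemma vsmooth_continuous_on:
  assumes "vsmooth f" shows "continuous_on S f"
proof -
  obtain f' where f': "\<And>x. (f has_derivative f' x) (at x)" using vsmooth_derivative[OF assms] by blast
  show ?thesis by (intro continuous_at_imp_continuous_on ballI has_derivative_continuous[OF f'])
qed

lemma vsmooth_iter_deriv: "vsmooth f \<Longrightarrow> vsmooth (iter_deriv f vs)"
proof (induction vs)
  case (Cons v vs)
  obtain f' where f': "\<And>x. (iter_deriv f vs has_derivative f' x) (at x)" "\<And>v. vsmooth (\<lambda>x. f' x v)"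
    using vsmooth_derivative[OF Cons.IH[OF Cons.prems]] by blast
  have "frechet_derivative (iter_deriv f vs) (at x) = f' x" for x
    using frechet_derivative_at[OF f'(1)] by simp
  then show ?case using f'(2) by simp
qed simp

lemma vsmooth_in_Cr_fields: "vsmooth X \<Longrightarrow> X \<in> Cr_fields r"
  unfolding Cr_fields_def
proof (intro CollectI conjI allI impI)
  fix vs x assume X: "vsmooth X"
  then show "iter_deriv X vs differentiable at x"
    using vsmooth_derivative[OF vsmooth_iter_deriv[OF X]] differentiable_def by blast
next
  fix vs assume X: "vsmooth X"
  then show "continuous_on UNIV (iter_deriv X vs)"
    by (intro vsmooth_continuous_on vsmooth_iter_deriv)
qed

text \<open>Continuity is known for one directional derivative at a time, so the derivative is
  bounded basis vector by basis vector: by compactness on the ball, and by 0 outside. The sum bounds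
  the operator norm, and the mean value inequality applies.\<close>

lemma vsmooth_compact_support_Lipschitz:
  fixes f :: "'a::euclidean_space \<Rightarrow> 'b::euclidean_space"
  assumes f: "vsmooth f" and supp: "\<And>x. R \<le> norm x \<Longrightarrow> f x = 0"
  shows "\<exists>L\<ge>0. \<forall>x y. norm (f x - f y) \<le> L * norm (x - y)"
proof -
  obtain f' where f': "\<And>x. (f has_derivative f' x) (at x)" "\<And>v. vsmooth (\<lambda>x. f' x v)"
    using vsmooth_derivative[OF f] by blast
  have c: "continuous_on S (\<lambda>x. f' x v)" for S v
    by (rule vsmooth_continuous_on[OF f'(2)])
  have "\<exists>B\<ge>0. \<forall>x\<in>cball 0 R. norm (f' x b) \<le> B" for b
  proof -
    have "bounded ((\<lambda>x. f' x b) ` cball 0 R)"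
      by (intro compact_imp_bounded compact_continuous_image c) simp
    then show ?thesis unfolding bounded_iff by (metis image_eqI norm_ge_zero order_trans linear)
  qed
  then obtain B where B: "\<And>b. 0 \<le> B b" "\<And>b x. x \<in> cball 0 R \<Longrightarrow> norm (f' x b) \<le> B b" by metis
  have out: "f' x = (\<lambda>_. 0)" if "x \<notin> cball 0 R" for x
  proof -
    have "((\<lambda>_. 0) has_derivative f' x) (at x)"
      by (rule has_derivative_transform_within_open[OF f'(1), where s = "- cball 0 R"])
         (use that supp in \<open>auto simp: open_Compl\<close>)
    then show ?thesis using has_derivative_unique has_derivative_const by blast
  qed
  have B2: "norm (f' x b) \<le> B b" for x b
    using B out by (cases "x \<in> cball 0 R") auto
  define L where "L = (\<Sum>b\<in>Basis. B b)"
  have L: "norm (f' x v) \<le> norm v * L" for x v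
  proof -
    have lin: "linear (f' x)" using f'(1) has_derivative_linear by blast
    have "f' x v = (\<Sum>b\<in>Basis. (v \<bullet> b) *\<^sub>R f' x b)"
      by (subst euclidean_representation[of v, symmetric])
         (simp add: linear_sum[OF lin] linear_scale[OF lin])
    also have "norm \<dots> \<le> (\<Sum>b\<in>Basis. norm v * B b)"
      by (rule sum_norm_le) (auto intro!: mult_mono B2 simp: Basis_le_norm)
    finally show ?thesis by (simp add: L_def sum_distrib_left)
  qed
  have "norm (f x - f y) \<le> L * norm (x - y)" for x y
  proof (rule differentiable_bound[of UNIV f f'])
    show "onorm (f' x) \<le> L" for x by (rule onorm_le) (use L in \<open>simp add: mult.commute\<close>)
  qed (use f' in auto)
  then show ?thesis using B(1) by (auto simp: L_def intro!: exI[of _ L] sum_nonneg)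
qed

text \<open>The class \<open>smooth\<close> has no quotients of functions, so the cut-off iterates
  \<open>flat\<close> instead. The inner \<open>1 - exp 1 * flat 0 t\<close> is exactly 1 for
  \<open>t \<le> 0\<close> and nonpositive for \<open>t \<ge> 1\<close>; the outer layer turns these
  into exact values 0 and 1, since \<open>exp 1 * flat 0 1 = 1\<close>.\<close>

definition smooth_step :: "real \<Rightarrow> real" where
  "smooth_step t = 1 - exp 1 * flat 0 (1 - exp 1 * flat 0 t)"

lemma smooth_step_le_0: "t \<le> 0 \<Longrightarrow> smooth_step t = 0"
  by (simp add: smooth_step_def flat_def flip: exp_add)

lemma smooth_step_ge_1:
  assumes "1 \<le> t" shows "smooth_step t = 1"
proof -
  have "1 \<le> exp (1 - 1 / t)" using assms by simp
  then have "1 \<le> exp 1 * flat 0 t" using assms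
    by (simp add: flat_def flip: exp_add)
  then show ?thesis by (simp add: smooth_step_def flat_def)
qed

lemma smooth_step_bounds: "0 \<le> smooth_step t" "smooth_step t \<le> 1"
proof -
  have f0: "0 \<le> flat 0 s" for s by (simp add: flat_def)
  have "flat 0 (1 - exp 1 * flat 0 t) \<le> exp (-1)"
  proof (cases "1 - exp 1 * flat 0 t \<le> 0")
    case False
    have "1 \<le> 1 / (1 - exp 1 * flat 0 t)" using False f0[of t] by (simp add: field_simps)
    then show ?thesis using False by (simp add: flat_def)
  qed (simp add: flat_def)
  then have "exp 1 * flat 0 (1 - exp 1 * flat 0 t) \<le> exp 1 * exp (-1)"
    by (intro mult_left_mono) auto
  then show "0 \<le> smooth_step t" by (simp add: smooth_step_def flip: exp_add)
  show "smooth_step t \<le> 1" using f0 by (simp add: smooth_step_def)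
qed

lemma smooth_smooth_step: "smooth f \<Longrightarrow> smooth (\<lambda>x. smooth_step (f x))"
  unfolding smooth_step_def by (intro smooth_diff smooth_const smooth_cmult smooth_flat)

section \<open>Ordinary differential equations\<close>

lemma bcontfun_iff:
  fixes f :: "real \<Rightarrow> 'a::real_normed_vector"
  shows "f \<in> bcontfun \<longleftrightarrow> continuous_on UNIV f \<and> (\<exists>B. \<forall>t. norm (f t) \<le> B)"
  by (auto simp: bcontfun_def bounded_iff)

text \<open>The contraction property is asked for with an arbitrary pointwise bound
  \<open>B\<close>, so that estimates for a concrete \<open>T\<close> can stay pointwise.\<close>

lemma bcontfun_fixed_point:
  fixes T :: "(real \<Rightarrow> 'a::euclidean_space) \<Rightarrow> real \<Rightarrow> 'a"
  assumes T: "\<And>b. b \<in> bcontfun \<Longrightarrow> T b \<in> bcontfun"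
    and contr: "\<And>b c B t. b \<in> bcontfun \<Longrightarrow> c \<in> bcontfun \<Longrightarrow>
      (\<And>t. norm (b t - c t) \<le> B) \<Longrightarrow> norm (T b t - T c t) \<le> B / 2"
  obtains b where "b \<in> bcontfun" "T b = b"
proof -
  have mem: "apply_bcontfun b \<in> bcontfun" for b :: "real \<Rightarrow>\<^sub>C 'a"
    by (rule apply_bcontfun)
  define T' where "T' b = Bcontfun (T (apply_bcontfun b))" for b
  have T': "apply_bcontfun (T' b) = T (apply_bcontfun b)" for b
    unfolding T'_def by (rule Bcontfun_inverse[OF T[OF mem]])
  have "\<exists>!b. T' b = b"
  proof (rule banach_fix_type[of "1/2"]; (intro allI)?)
    fix b c
    show "dist (T' b) (T' c) \<le> 1 / 2 * dist b c"
    proof (rule dist_bound)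
      fix t
      have "norm (T b t - T c t) \<le> dist b c / 2"
        using contr[OF mem mem] dist_bounded[of b _ c] by (simp add: dist_norm)
      then show "dist (T' b t) (T' c t) \<le> 1 / 2 * dist b c"
        by (simp add: T' dist_norm)
    qed
  qed auto
  then obtain b where "T' b = b" by blast
  then show thesis using that[OF mem[of b]] T'[of b] by simp
qed

text \<open>The bounded solutions on the whole line of \<open>u' = k u - f\<close> and \<open>u' = f - k u\<close>.\<close>

definition fut :: "real \<Rightarrow> (real \<Rightarrow> 'a::euclidean_space) \<Rightarrow> real \<Rightarrow> 'a" where
  "fut k f t = exp (k * t) *\<^sub>R integral {t..} (\<lambda>s. exp (- k * s) *\<^sub>R f s)"

definition past :: "real \<Rightarrow> (real \<Rightarrow> 'a::euclidean_space) \<Rightarrow> real \<Rightarrow> 'a" where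
  "past k f t = fut k (\<lambda>s. f (- s)) (- t)"

lemma exp_weighted_integrable:
  assumes "f \<in> bcontfun" "0 < k"
  shows "(\<lambda>s. exp (- k * s) *\<^sub>R (f s :: 'a::euclidean_space)) integrable_on {t..}"
proof -
  obtain B where B: "\<And>s. norm (f s) \<le> B" using assms(1) by (auto simp: bcontfun_iff)
  have f: "continuous_on S f" for S
    using assms(1) continuous_on_subset unfolding bcontfun_iff by blast
  show ?thesis
  proof (rule measurable_bounded_by_integrable_imp_integrable)
    show "(\<lambda>s. exp (- k * s) *\<^sub>R f s) \<in> borel_measurable (lebesgue_on {t..})"
      by (intro continuous_imp_measurable_on_sets_lebesgue continuous_intros f) auto
    show "(\<lambda>s. exp (- k * s) * B) integrable_on {t..}"
      using integrable_on_exp_minus_to_infinity[OF assms(2)] integrable_on_mult_left by blast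
  qed (auto simp: B mult_left_mono)
qed

lemma norm_fut_le:
  assumes f: "f \<in> bcontfun" and k: "0 < k" and B: "\<And>s. norm (f s) \<le> B"
  shows "norm (fut k f t) \<le> B / k"
proof -
  have i: "((\<lambda>s. exp (- k * s) * B) has_integral exp (- k * t) / k * B) {t..}"
    by (intro has_integral_mult_left has_integral_exp_minus_to_infinity k)
  have "norm (integral {t..} (\<lambda>s. exp (- k * s) *\<^sub>R f s)) \<le> integral {t..} (\<lambda>s. exp (- k * s) * B)"
    by (intro integral_norm_bound_integral exp_weighted_integrable f k)
       (use i B in \<open>auto simp: mult_left_mono\<close>)
  also have "\<dots> = exp (- k * t) / k * B" using i by (rule integral_unique)
  finally have "norm (fut k f t) \<le> exp (k * t) * (exp (- k * t) / k * B)"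
    unfolding fut_def norm_scaleR by (simp only: abs_exp_cancel mult_left_mono exp_ge_zero)
  also have "\<dots> = (exp (k * t) * exp (- k * t)) * (B / k)" by simp
  finally show ?thesis by (simp flip: exp_add)
qed

lemma fut_diff:
  assumes "f \<in> bcontfun" "h \<in> bcontfun" "0 < k"
  shows "fut k f t - fut k h t = fut k (\<lambda>s. f s - h s) t"
  using integral_diff[OF exp_weighted_integrable[OF assms(1,3), of t]
      exp_weighted_integrable[OF assms(2,3), of t]]
  by (simp add: fut_def scaleR_diff_right)

lemma fut_linear:
  assumes "f \<in> bcontfun" "0 < k" "bounded_linear Q"
  shows "Q (fut k f t) = fut k (\<lambda>s. Q (f s)) t"
proof -
  interpret Q: bounded_linear Q by fact
  show ?thesis
    using integral_linear[OF exp_weighted_integrable[OF assms(1,2)] assms(3), of t]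
    by (simp add: fut_def o_def Q.scaleR)
qed

lemma fut_zero: "fut k (\<lambda>_. 0) t = 0"
  by (simp add: fut_def)

lemma fut_has_vector_derivative:
  assumes f: "f \<in> bcontfun" and k: "0 < k"
  shows "(fut k f has_vector_derivative k *\<^sub>R fut k f t - f t) (at t)"
proof -
  let ?G = "\<lambda>s. exp (- k * s) *\<^sub>R f s"
  have int: "?G integrable_on {a..}" for a by (rule exp_weighted_integrable[OF f k])
  have cont: "continuous_on S ?G" for S
    using f continuous_on_subset unfolding bcontfun_iff by (intro continuous_intros) blast
  \<comment> \<open>The fundamental theorem applies to integrals over compact intervals; cutting the
    half-line at \<open>t - 1\<close> leaves a constant minus such an integral for all points near
    \<open>t\<close>.\<close>
  have split: "integral {x..} ?G = integral {t - 1..} ?G - integral {t - 1..x} ?G"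
    if "x \<in> {t - 1<..<t + 1}" for x
  proof -
    have "integral {t - 1..x} ?G + integral {x..} ?G = integral ({t - 1..x} \<union> {x..}) ?G"
    proof (rule integral_Un[symmetric])
      have "{t - 1..x} \<inter> {x..} \<subseteq> {x}" by auto
      then show "negligible ({t - 1..x} \<inter> {x..})" using negligible_subset negligible_sing by blast
    qed (intro int integrable_continuous_interval cont)+
    also have "{t - 1..x} \<union> {x..} = {t - 1..}" using that by auto
    finally show ?thesis by (simp add: algebra_simps)
  qed
  have "((\<lambda>x. integral {t - 1..x} ?G) has_vector_derivative ?G t) (at t within {t - 1..t + 1})"
    by (rule integral_has_vector_derivative[OF cont]) simp
  then have "((\<lambda>x. integral {t - 1..x} ?G) has_vector_derivative ?G t) (at t)"
    using at_within_Icc_at[of "t - 1" t "t + 1"] by simp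
  then have "((\<lambda>x. integral {t - 1..} ?G - integral {t - 1..x} ?G) has_vector_derivative 0 - ?G t) (at t)"
    by (intro has_vector_derivative_diff has_vector_derivative_const)
  then have "((\<lambda>x. integral {x..} ?G) has_vector_derivative 0 - ?G t) (at t)"
    by (rule has_vector_derivative_transform_within_open[of _ _ _ "{t - 1<..<t + 1}"])
       (simp_all only: split open_greaterThanLessThan greaterThanLessThan_iff, auto)
  then have "((\<lambda>x. exp (k * x) *\<^sub>R integral {x..} ?G) has_vector_derivative
      exp (k * t) *\<^sub>R (0 - ?G t) + (exp (k * t) * k) *\<^sub>R integral {t..} ?G) (at t)"
    by (intro has_vector_derivative_scaleR) (auto intro!: derivative_eq_intros)
  moreover have "exp (k * t) *\<^sub>R (0 - ?G t) + (exp (k * t) * k) *\<^sub>R integral {t..} ?G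
      = k *\<^sub>R fut k f t - f t"
    by (simp add: fut_def mult.commute flip: exp_add)
  ultimately show ?thesis unfolding fut_def by simp
qed

text \<open>Since \<open>past\<close> is \<open>fut\<close> with time reversed, this lets each
  property of \<open>fut\<close> carry over.\<close>

lemma bcontfun_reflect:
  fixes f :: "real \<Rightarrow> 'a::euclidean_space"
  shows "f \<in> bcontfun \<Longrightarrow> (\<lambda>s. f (- s)) \<in> bcontfun"
  unfolding bcontfun_iff
  by (auto intro!: continuous_on_compose2[of UNIV f UNIV uminus] continuous_intros)

lemma norm_past_le:
  assumes "f \<in> bcontfun" "0 < k" "\<And>s. norm (f s) \<le> B"
  shows "norm (past k f t) \<le> B / k"
  unfolding past_def by (intro norm_fut_le bcontfun_reflect assms)

lemma past_diff:
  assumes "f \<in> bcontfun" "h \<in> bcontfun" "0 < k"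
  shows "past k f t - past k h t = past k (\<lambda>s. f s - h s) t"
  unfolding past_def by (intro fut_diff bcontfun_reflect assms)

lemma past_linear:
  assumes "f \<in> bcontfun" "0 < k" "bounded_linear Q"
  shows "Q (past k f t) = past k (\<lambda>s. Q (f s)) t"
  unfolding past_def by (intro fut_linear bcontfun_reflect assms)

lemma past_zero: "past k (\<lambda>_. 0) t = 0"
  by (simp add: past_def fut_zero)

lemma past_has_vector_derivative:
  assumes "f \<in> bcontfun" "0 < k"
  shows "(past k f has_vector_derivative f t - k *\<^sub>R past k f t) (at t)"
proof -
  have "((fut k (\<lambda>s. f (- s)) \<circ> uminus) has_vector_derivative
      (-1) *\<^sub>R (k *\<^sub>R fut k (\<lambda>s. f (- s)) (- t) - f (- (- t)))) (at t)"
    by (intro vector_diff_chain_at fut_has_vector_derivative bcontfun_reflect assms)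
       (auto intro!: derivative_eq_intros)
  then show ?thesis by (simp add: past_def[abs_def] o_def)
qed

lemma bcontfun_diff:
  fixes f h :: "real \<Rightarrow> 'a::euclidean_space"
  assumes "f \<in> bcontfun" "h \<in> bcontfun"
  shows "(\<lambda>s. f s - h s) \<in> bcontfun"
  using assms by (rule minus_cont)

lemma bcontfun_bounded_linear:
  fixes f :: "real \<Rightarrow> 'a::euclidean_space"
  assumes "f \<in> bcontfun" "bounded_linear Q"
  shows "(\<lambda>s. Q (f s)) \<in> bcontfun"
proof -
  interpret Q: bounded_linear Q by fact
  obtain B where "\<And>t. norm (f t) \<le> B" using assms(1) by (auto simp: bcontfun_iff)
  moreover obtain K where "\<And>x. norm (Q x) \<le> norm x * K" "0 \<le> K" using Q.nonneg_bounded by blast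
  ultimately have "norm (Q (f t)) \<le> B * K" for t by (meson mult_right_mono order_trans)
  then show ?thesis using assms(1) by (auto simp: bcontfun_iff intro!: Q.continuous_on)
qed

lemma fut_bcontfun:
  assumes "f \<in> bcontfun" "0 < k"
  shows "fut k f \<in> bcontfun"
  using norm_fut_le[OF assms] fut_has_vector_derivative[OF assms] assms(1)
  unfolding bcontfun_iff
  by (meson continuous_at_imp_continuous_on has_vector_derivative_continuous)

lemma past_bcontfun:
  assumes "f \<in> bcontfun" "0 < k"
  shows "past k f \<in> bcontfun"
  using norm_past_le[OF assms] past_has_vector_derivative[OF assms] assms(1)
  unfolding bcontfun_iff
  by (meson continuous_at_imp_continuous_on has_vector_derivative_continuous)

section \<open>Weighted integral equations and global solutions\<close>

lemma Lipschitz_continuous_on: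
  fixes F :: "'a::real_normed_vector \<Rightarrow> 'b::real_normed_vector"
  assumes "\<And>x y. norm (F x - F y) \<le> L * norm (x - y)"
  shows "continuous_on S F"
proof -
  have "(max L 0)-lipschitz_on S F"
    unfolding lipschitz_on_def dist_norm
    by (auto intro!: order_trans[OF assms mult_right_mono])
  then show ?thesis by (rule lipschitz_on_continuous_on)
qed

text \<open>The weights inside and outside \<open>F\<close> cancel, so the Lipschitz constant
  survives any weight. A contraction in an exponentially weighted norm can thus be carried out in
  the plain supremum norm.\<close>

lemma weighted_nonlinearity_Lipschitz:
  fixes F :: "'a::euclidean_space \<Rightarrow> 'a" and b c :: "'a" and w :: real
  assumes F: "\<And>x y. norm (F x - F y) \<le> L * norm (x - y)"
  shows "norm (exp (- w) *\<^sub>R F (exp w *\<^sub>R b) - exp (- w) *\<^sub>R F (exp w *\<^sub>R c)) \<le> L * norm (b - c)"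
proof -
  have "norm (exp (- w) *\<^sub>R F (exp w *\<^sub>R b) - exp (- w) *\<^sub>R F (exp w *\<^sub>R c))
      = exp (- w) * norm (F (exp w *\<^sub>R b) - F (exp w *\<^sub>R c))"
    by (simp flip: scaleR_diff_right)
  also have "\<dots> \<le> exp (- w) * (L * norm (exp w *\<^sub>R b - exp w *\<^sub>R c))"
    by (intro mult_left_mono F) simp
  also have "\<dots> = (exp (- w) * exp w) * (L * norm (b - c))"
    by (simp flip: scaleR_diff_right)
  finally show ?thesis by (simp flip: exp_add)
qed

lemma weighted_nonlinearity_bcontfun:
  fixes F :: "'a::euclidean_space \<Rightarrow> 'a" and b :: "real \<Rightarrow> 'a" and w :: "real \<Rightarrow> real"
  assumes F: "\<And>x y. norm (F x - F y) \<le> L * norm (x - y)" and L: "0 \<le> L"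
    and b: "b \<in> bcontfun" and w: "continuous_on UNIV w" "\<And>t. norm (exp (- w t) *\<^sub>R F 0) \<le> C"
  shows "(\<lambda>t. exp (- w t) *\<^sub>R F (exp (w t) *\<^sub>R b t)) \<in> bcontfun"
  unfolding bcontfun_iff
proof
  have "continuous_on UNIV b" using b unfolding bcontfun_iff by blast
  then show "continuous_on UNIV (\<lambda>t. exp (- w t) *\<^sub>R F (exp (w t) *\<^sub>R b t))"
    using w(1)
    by (intro continuous_intros continuous_on_compose2[OF Lipschitz_continuous_on[of F L UNIV]] F) auto
  obtain B where B: "\<And>t. norm (b t) \<le> B" using b by (auto simp: bcontfun_iff)
  have "norm (exp (- w t) *\<^sub>R F (exp (w t) *\<^sub>R b t)) \<le> C + L * B" for t
  proof -
    have "norm (exp (- w t) *\<^sub>R F (exp (w t) *\<^sub>R b t))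
      \<le> norm (exp (- w t) *\<^sub>R F 0) +
        norm (exp (- w t) *\<^sub>R F (exp (w t) *\<^sub>R b t) - exp (- w t) *\<^sub>R F (exp (w t) *\<^sub>R 0))"
      unfolding scaleR_zero_right by (rule norm_triangle_sub)
    also have "\<dots> \<le> C + L * norm (b t - 0)"
      by (intro add_mono w weighted_nonlinearity_Lipschitz F)
    also have "\<dots> \<le> C + L * B" using B L by (simp add: mult_left_mono)
    finally show ?thesis .
  qed
  then show "\<exists>B. \<forall>t. norm (exp (- w t) *\<^sub>R F (exp (w t) *\<^sub>R b t)) \<le> B" by blast
qed

text \<open>Picard's integral operator becomes a contraction on the whole half-line at once under
  the weight \<open>exp (M * t)\<close>, so no local solutions have to be continued.\<close>

lemma forward_solution:
  fixes Y :: "'a::euclidean_space \<Rightarrow> 'a"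
  assumes Y: "\<And>x y. norm (Y x - Y y) \<le> L * norm (x - y)" and L: "0 \<le> L"
  obtains \<gamma> where "\<gamma> 0 = p" "\<And>t. 0 \<le> t \<Longrightarrow> (\<gamma> has_vector_derivative Y (\<gamma> t)) (at t)"
proof -
  \<comment> \<open>Each of the two \<open>past\<close> terms in \<open>T\<close> below has
    Lipschitz constant at most \<open>L / M\<close>; the factor 4 makes their sum at most 1/2, and
    the summand 1 keeps \<open>M\<close> positive.\<close>
  define M where "M = 4 * L + 1"
  have M: "0 < M" using L by (simp add: M_def)
  define w where "w t = M * max t 0" for t :: real
  define \<Phi> where "\<Phi> b = (\<lambda>t. exp (- w t) *\<^sub>R Y (exp (w t) *\<^sub>R b t))" for b :: "real \<Rightarrow> 'a"
  have \<Phi>: "\<Phi> b \<in> bcontfun" if "b \<in> bcontfun" for b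
    unfolding \<Phi>_def
  proof (rule weighted_nonlinearity_bcontfun[OF Y L that, where C = "norm (Y 0)"])
    show "continuous_on UNIV w" unfolding w_def by (intro continuous_intros)
    show "norm (exp (- w t) *\<^sub>R Y 0) \<le> norm (Y 0)" for t
      using M by (simp add: w_def mult_left_le_one_le)
  qed
  \<comment> \<open>Multiplied by \<open>exp (w t)\<close> this is, for \<open>t \<ge> 0\<close>,
    the initial value \<open>p\<close> plus the integral of
    \<open>Y (exp (w s) *\<^sub>R b s)\<close> from 0 to \<open>t\<close>: \<open>past\<close>
    integrates from minus infinity, hence the subtracted value at 0. For negative times everything
    is frozen at \<open>p\<close>.\<close>
  define T where "T b t = exp (- w t) *\<^sub>R (p - past M (\<Phi> b) 0) + past M (\<Phi> b) (max t 0)" for b t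
  obtain b where b: "b \<in> bcontfun" "T b = b"
  proof (rule bcontfun_fixed_point[of T])
    fix b :: "real \<Rightarrow> 'a" assume b: "b \<in> bcontfun"
    have p: "past M (\<Phi> b) \<in> bcontfun" by (intro past_bcontfun \<Phi> b M)
    then obtain C where C: "\<And>t. norm (past M (\<Phi> b) t) \<le> C" by (auto simp: bcontfun_iff)
    have "norm (T b t) \<le> norm (p - past M (\<Phi> b) 0) + C" for t
      unfolding T_def
      by (rule norm_triangle_mono) (use C M in \<open>auto simp: w_def mult_left_le_one_le\<close>)
    moreover have "continuous_on UNIV (\<lambda>t. past M (\<Phi> b) (max t 0))"
      by (rule continuous_on_compose2[of UNIV "past M (\<Phi> b)"])
         (use p in \<open>auto simp: bcontfun_iff intro!: continuous_intros\<close>)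
    then have "continuous_on UNIV (T b)"
      unfolding T_def w_def by (intro continuous_intros)
    ultimately show "T b \<in> bcontfun" by (auto simp: bcontfun_iff)
  next
    fix b c :: "real \<Rightarrow> 'a" and B t
    assume b: "b \<in> bcontfun" and c: "c \<in> bcontfun" and B: "\<And>t. norm (b t - c t) \<le> B"
    have "norm (\<Phi> b t - \<Phi> c t) \<le> L * B" for t
      unfolding \<Phi>_def
      using order_trans[OF weighted_nonlinearity_Lipschitz[of Y L, OF Y] mult_left_mono[OF B L]] .
    then have d: "norm (past M (\<Phi> b) t - past M (\<Phi> c) t) \<le> L * B / M" for t
      using b c M \<Phi> past_diff bcontfun_diff by (subst past_diff) (auto intro!: norm_past_le bcontfun_diff)
    have "T b t - T c t = exp (- w t) *\<^sub>R (past M (\<Phi> c) 0 - past M (\<Phi> b) 0)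
        + (past M (\<Phi> b) (max t 0) - past M (\<Phi> c) (max t 0))"
      by (simp add: T_def algebra_simps)
    also have "norm \<dots> \<le> 1 * norm (past M (\<Phi> c) 0 - past M (\<Phi> b) 0) + L * B / M"
      by (rule norm_triangle_mono)
         (use d M in \<open>auto simp: w_def intro!: mult_left_le_one_le\<close>)
    also have "\<dots> \<le> L * B / M + L * B / M"
      using d[of 0] by (simp only: norm_minus_commute mult_1 add_right_mono)
    also have "\<dots> \<le> B / 2"
    proof -
      have "0 \<le> B" using B[of 0] norm_ge_zero order_trans by blast
      then have "L * B \<le> B / 4 * M" by (simp add: M_def algebra_simps)
      then have le: "L * B / M \<le> B / 4" using M by (simp only: pos_divide_le_eq)
      show ?thesis by (rule order_trans[OF add_mono[OF le le]]) simp
    qed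
    finally show "norm (T b t - T c t) \<le> B / 2" .
  qed
  define \<gamma> where "\<gamma> t = (p - past M (\<Phi> b) 0) + exp (M * t) *\<^sub>R past M (\<Phi> b) t" for t
  have \<gamma>b: "\<gamma> t = exp (w t) *\<^sub>R b t" if "0 \<le> t" for t
  proof -
    have "exp (w t) *\<^sub>R b t = exp (w t) *\<^sub>R T b t" using b(2) by simp
    also have "\<dots> = (exp (w t) * exp (- w t)) *\<^sub>R (p - past M (\<Phi> b) 0)
        + exp (w t) *\<^sub>R past M (\<Phi> b) (max t 0)"
      unfolding T_def by (simp only: scaleR_add_right scaleR_scaleR)
    finally show ?thesis using that by (simp add: \<gamma>_def w_def flip: exp_add)
  qed
  show thesis
  proof (rule that)
    show "\<gamma> 0 = p" by (simp add: \<gamma>_def)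
    fix t :: real assume t: "0 \<le> t"
    have "(\<gamma> has_vector_derivative 0 + (exp (M * t) *\<^sub>R (\<Phi> b t - M *\<^sub>R past M (\<Phi> b) t)
        + (exp (M * t) * M) *\<^sub>R past M (\<Phi> b) t)) (at t)"
      unfolding \<gamma>_def
      by (intro has_vector_derivative_add has_vector_derivative_const has_vector_derivative_scaleR
            past_has_vector_derivative \<Phi> b M) (auto intro!: derivative_eq_intros)
    also have "0 + (exp (M * t) *\<^sub>R (\<Phi> b t - M *\<^sub>R past M (\<Phi> b) t)
        + (exp (M * t) * M) *\<^sub>R past M (\<Phi> b) t) = exp (w t) *\<^sub>R \<Phi> b t"
      using t by (simp add: w_def algebra_simps)
    also have "\<dots> = Y (\<gamma> t)"
      using t by (simp add: \<Phi>_def \<gamma>b flip: exp_add)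
    finally show "(\<gamma> has_vector_derivative Y (\<gamma> t)) (at t)" .
  qed
qed

text \<open>The unstable orbit of the saddle \<open>D' = (2P - 1) D + F D\<close> with prescribed unstable part
  \<open>\<eta>\<close> at time \<open>0\<close>, by the Lyapunov--Perron method; the weight \<open>exp (t / 2)\<close> makes
  the fixed point of the integral operator decay backwards in time.\<close>

lemma unstable_orbit:
  fixes P F Q :: "'a::euclidean_space \<Rightarrow> 'a"
  assumes P: "bounded_linear P" "\<And>x. P (P x) = P x"
    and P_le: "\<And>x. norm (P x) \<le> norm x" "\<And>x. norm (x - P x) \<le> norm x"
    and F: "\<And>x y. norm (F x - F y) \<le> \<epsilon> * norm (x - y)" "F 0 = 0"
    and \<epsilon>: "0 \<le> \<epsilon>" "\<epsilon> \<le> 1 / 12" and \<eta>: "P \<eta> = \<eta>"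
    and Q: "bounded_linear Q" "\<And>x. Q (P x) = P (Q x)" "\<And>x. Q (F x) = 0" "Q \<eta> = 0"
  obtains D where
    "\<And>t. t \<le> 0 \<Longrightarrow> (D has_vector_derivative 2 *\<^sub>R P (D t) - D t + F (D t)) (at t)"
    "\<And>t. t \<le> 0 \<Longrightarrow> norm (D t) \<le> 2 * norm \<eta> * exp (t / 2)"
    "norm (D 0 - \<eta>) \<le> 2 * \<epsilon> * norm \<eta>" "\<And>t. t \<le> 0 \<Longrightarrow> Q (D t) = 0"
proof -
  interpret P: bounded_linear P by fact
  interpret Q: bounded_linear Q by fact
  define R where "R x = x - P x" for x
  have R: "bounded_linear R"
    unfolding R_def[abs_def] by (intro bounded_linear_sub bounded_linear_ident P)
  interpret R: bounded_linear R by fact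
  have R_le: "norm (R x) \<le> norm x" for x unfolding R_def by (rule P_le)
  define w where "w t = min t 0 / 2" for t :: real
  define \<Phi> where "\<Phi> b = (\<lambda>t. exp (- w t) *\<^sub>R F (exp (w t) *\<^sub>R b t))" for b :: "real \<Rightarrow> 'a"
  have \<Phi>: "\<Phi> b \<in> bcontfun" if "b \<in> bcontfun" for b
    unfolding \<Phi>_def
    by (rule weighted_nonlinearity_bcontfun[OF F(1) \<epsilon>(1) that, where C = 0])
       (auto simp: w_def F intro!: continuous_intros)
  have \<Phi>_diff: "norm (\<Phi> b t - \<Phi> c t) \<le> \<epsilon> * norm (b t - c t)" for b c t
    unfolding \<Phi>_def by (rule weighted_nonlinearity_Lipschitz[OF F(1)])
  \<comment> \<open>With \<open>D t = exp (t / 2) *\<^sub>R b t\<close> the rates 1 and -1 of the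
    saddle become 1/2 and -3/2. Boundedness forces the unstable part to be integrated from the
    future and the stable part from the past.\<close>
  define U where "U b = fut (1 / 2) (\<lambda>s. P (\<Phi> b s))" for b
  define V where "V b = past (3 / 2) (\<lambda>s. R (\<Phi> b s))" for b
  have P\<Phi>: "(\<lambda>s. P (\<Phi> b s)) \<in> bcontfun" and R\<Phi>: "(\<lambda>s. R (\<Phi> b s)) \<in> bcontfun"
    if "b \<in> bcontfun" for b
    using bcontfun_bounded_linear[OF \<Phi>[OF that] P(1)] bcontfun_bounded_linear[OF \<Phi>[OF that] R] .
  have U_diff: "norm (U b t - U c t) \<le> 2 * \<epsilon> * B"
    and V_diff: "norm (V b t - V c t) \<le> 2 / 3 * \<epsilon> * B"
    if b: "b \<in> bcontfun" and c: "c \<in> bcontfun" and B: "\<And>t. norm (b t - c t) \<le> B" for b c B t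
  proof -
    have d: "norm (\<Phi> b t - \<Phi> c t) \<le> \<epsilon> * B" for t
      using order_trans[OF \<Phi>_diff mult_left_mono[OF B \<epsilon>(1)]] .
    have "norm (U b t - U c t) \<le> \<epsilon> * B / (1 / 2)"
      unfolding U_def
      by (subst fut_diff; (intro norm_fut_le bcontfun_diff P\<Phi> b c)?)
         (auto simp flip: P.diff intro: order_trans[OF P_le(1) d])
    then show "norm (U b t - U c t) \<le> 2 * \<epsilon> * B" by simp
    have "norm (V b t - V c t) \<le> \<epsilon> * B / (3 / 2)"
      unfolding V_def
      by (subst past_diff; (intro norm_past_le bcontfun_diff R\<Phi> b c)?)
         (auto simp flip: R.diff intro: order_trans[OF R_le d])
    then show "norm (V b t - V c t) \<le> 2 / 3 * \<epsilon> * B" by simp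
  qed
  \<comment> \<open>\<open>U\<close> is subtracted because \<open>fut\<close> solves
    \<open>u' = k u - f\<close>. The first summand is the homogeneous solution that normalizes the
    unstable part to \<open>\<eta>\<close> at time 0. Freezing at 0 for positive times gives a
    bounded function on the whole line.\<close>
  define T where
    "T b t = exp (w t) *\<^sub>R (\<eta> + U b 0) - U b (min t 0) + V b (min t 0)" for b t
  have zero: "(\<lambda>_ :: real. 0 :: 'a) \<in> bcontfun" by (auto simp: bcontfun_iff)
  have U0: "U (\<lambda>_. 0) t = 0" and V0: "V (\<lambda>_. 0) t = 0" for t
    by (simp_all add: U_def V_def \<Phi>_def F fut_zero past_zero)
  have w_le: "exp (w t) \<le> 1" for t by (simp add: w_def)
  \<comment> \<open>Two terms in \<open>U\<close> and one in \<open>V\<close> add up to the factor 2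
    + 2 + 2/3, rounded up to 5; with \<open>\<epsilon> \<le> 1 / 12\<close> the operator contracts
    by less than 1/2.\<close>
  have T_diff: "norm (T b t - T c t) \<le> 5 * \<epsilon> * B"
    if b: "b \<in> bcontfun" and c: "c \<in> bcontfun" and B: "\<And>t. norm (b t - c t) \<le> B" for b c B t
  proof -
    have "0 \<le> B" using B[of 0] norm_ge_zero order_trans by blast
    have "T b t - T c t = exp (w t) *\<^sub>R (U b 0 - U c 0)
        - (U b (min t 0) - U c (min t 0)) + (V b (min t 0) - V c (min t 0))"
      by (simp add: T_def algebra_simps)
    also have "norm \<dots> \<le> (1 * norm (U b 0 - U c 0) + norm (U b (min t 0) - U c (min t 0)))
        + norm (V b (min t 0) - V c (min t 0))"
      by (rule norm_triangle_mono, rule order_trans[OF norm_triangle_ineq4], rule add_mono)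
         (auto intro!: mult_left_le_one_le w_le)
    also have "\<dots> \<le> (2 * \<epsilon> * B + 2 * \<epsilon> * B) + 2 / 3 * \<epsilon> * B"
      unfolding mult_1 by (intro add_mono U_diff V_diff b c B)
    also have "\<dots> \<le> 5 * \<epsilon> * B"
      using mult_nonneg_nonneg[OF \<epsilon>(1) \<open>0 \<le> B\<close>] by (simp add: mult.commute)
    finally show ?thesis .
  qed
  obtain b where b: "b \<in> bcontfun" "T b = b"
  proof (rule bcontfun_fixed_point[of T])
    fix b :: "real \<Rightarrow> 'a" assume b: "b \<in> bcontfun"
    have UV: "U b \<in> bcontfun" "V b \<in> bcontfun"
      unfolding U_def V_def by (intro fut_bcontfun past_bcontfun P\<Phi> R\<Phi> b; simp)+
    obtain B C where BC: "\<And>t. norm (U b t) \<le> B" "\<And>t. norm (V b t) \<le> C"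
      using UV by (auto simp: bcontfun_iff)
    have "norm (T b t) \<le> 1 * norm (\<eta> + U b 0) + B + C" for t
      unfolding T_def
      by (rule norm_triangle_mono, rule order_trans[OF norm_triangle_ineq4], rule add_mono)
         (auto intro!: mult_left_le_one_le w_le BC)
    moreover have "continuous_on UNIV (\<lambda>t. f (min t 0))" if "f \<in> bcontfun" for f :: "real \<Rightarrow> 'a"
      by (rule continuous_on_compose2[of UNIV f])
         (use that in \<open>auto simp: bcontfun_iff intro!: continuous_intros\<close>)
    then have "continuous_on UNIV (T b)"
      unfolding T_def w_def using UV by (intro continuous_intros) auto
    ultimately show "T b \<in> bcontfun" unfolding bcontfun_iff by blast
  next
    fix b c :: "real \<Rightarrow> 'a" and B t
    assume "b \<in> bcontfun" "c \<in> bcontfun" and B: "\<And>t. norm (b t - c t) \<le> B"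
    then have "norm (T b t - T c t) \<le> 5 * \<epsilon> * B" by (intro T_diff)
    also have "\<dots> \<le> 1 / 2 * B"
      using \<epsilon> B[of 0] norm_ge_zero order_trans by (intro mult_right_mono) (simp, blast)
    finally show "norm (T b t - T c t) \<le> B / 2" by simp
  qed
  have b_le: "norm (b t) \<le> 2 * norm \<eta>" for t
  proof -
    \<comment> \<open>Comparison with \<open>T\<close> at the zero function, whose norm is at most
      \<open>norm \<eta>\<close>, gives \<open>B \<le> norm \<eta> + B / 2\<close> for the supremum
      \<open>B\<close>.\<close>
    define B where "B = (SUP t. norm (b t))"
    have bdd: "bdd_above (range (\<lambda>t. norm (b t)))"
      using b(1) by (auto simp: bcontfun_iff bdd_above_def)
    then have B: "norm (b t) \<le> B" for t unfolding B_def by (intro cSUP_upper) auto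
    then have "0 \<le> B" using norm_ge_zero order_trans by blast
    have "norm (b t) \<le> norm \<eta> + B / 2" for t
    proof -
      have "norm (b t) \<le> norm (T (\<lambda>_. 0) t) + norm (T b t - T (\<lambda>_. 0) t)"
        using norm_triangle_sub b(2) by metis
      also have "\<dots> \<le> norm \<eta> + 5 * \<epsilon> * B"
        using T_diff[OF b(1) zero, of B] B w_le
        by (intro add_mono) (auto simp: T_def U0 V0 intro!: mult_left_le_one_le)
      also have "\<dots> \<le> norm \<eta> + 1 / 2 * B"
        using \<epsilon> \<open>0 \<le> B\<close> by (intro add_mono mult_right_mono) auto
      finally show ?thesis by simp
    qed
    then have "B \<le> norm \<eta> + B / 2" unfolding B_def by (intro cSUP_least) auto
    then show ?thesis using B[of t] by linarith
  qed
  define u where "u t = exp (t / 2) *\<^sub>R (\<eta> + U b 0) - U b t" for t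
  have bt: "b t = u t + V b t" if "t \<le> 0" for t
    using that fun_cong[OF b(2), of t] by (simp add: T_def u_def w_def)
  have PR: "P (R x) = 0" for x by (simp add: R_def P.diff P(2))
  have PU: "P (U b t) = U b t" and PV: "P (V b t) = 0" for t
    unfolding U_def V_def
    by (simp_all add: fut_linear[OF P\<Phi>[OF b(1)] _ P(1)] past_linear[OF R\<Phi>[OF b(1)] _ P(1)]
        P(2) PR past_zero)
  have Pu: "P (u t) = u t" for t by (simp add: u_def P.diff P.scaleR P.add PU \<eta>)
  \<comment> \<open>\<open>Q\<close> commutes with the projections and the integrals and kills their
    input, so the orbit stays in the kernel of \<open>Q\<close>. With \<open>Q\<close> complementary
    to averaging over \<open>K\<close>, this will confine it to the fixed space of
    \<open>K\<close>.\<close>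
  have Q\<Phi>: "Q (\<Phi> b t) = 0" for t by (simp add: \<Phi>_def Q.scaleR Q)
  have QR: "Q (R x) = R (Q x)" for x by (simp add: R_def Q.diff Q(2))
  have QU: "Q (U b t) = 0" and QV: "Q (V b t) = 0" for t
    unfolding U_def V_def
    by (simp_all add: fut_linear[OF P\<Phi>[OF b(1)] _ Q(1)] past_linear[OF R\<Phi>[OF b(1)] _ Q(1)]
        Q(2) QR Q\<Phi> P.zero R.zero fut_zero past_zero)
  define D where "D t = exp (t / 2) *\<^sub>R (u t + V b t)" for t
  have Db: "D t = exp (t / 2) *\<^sub>R b t" if "t \<le> 0" for t using bt[OF that] by (simp add: D_def)
  show thesis
  proof (rule that)
    fix t :: real assume t: "t \<le> 0"
    have u': "(u has_vector_derivative (1 / 2) *\<^sub>R u t + P (\<Phi> b t)) (at t)"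
    proof -
      have "(u has_vector_derivative (exp (t / 2) *\<^sub>R 0 + (exp (t / 2) * (1 / 2)) *\<^sub>R (\<eta> + U b 0))
          - ((1 / 2) *\<^sub>R U b t - P (\<Phi> b t))) (at t)"
        unfolding u_def U_def
        by (intro has_vector_derivative_diff has_vector_derivative_scaleR has_vector_derivative_const
              fut_has_vector_derivative P\<Phi> b(1)) (auto intro!: derivative_eq_intros)
      then show ?thesis by (simp add: u_def algebra_simps)
    qed
    have V': "(V b has_vector_derivative R (\<Phi> b t) - (3 / 2) *\<^sub>R V b t) (at t)"
      unfolding V_def by (intro past_has_vector_derivative R\<Phi> b(1)) simp
    have "(D has_vector_derivative
        exp (t / 2) *\<^sub>R (((1 / 2) *\<^sub>R u t + P (\<Phi> b t)) + (R (\<Phi> b t) - (3 / 2) *\<^sub>R V b t))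
        + (exp (t / 2) * (1 / 2)) *\<^sub>R (u t + V b t)) (at t)" (is "(D has_vector_derivative ?D') _")
      unfolding D_def
      by (intro has_vector_derivative_scaleR has_vector_derivative_add u' V')
         (auto intro!: derivative_eq_intros)
    also have "?D' = exp (t / 2) *\<^sub>R (u t - V b t) + exp (t / 2) *\<^sub>R \<Phi> b t"
      by (rule euclidean_eqI) (simp add: R_def inner_add_left inner_diff_left field_simps)
    also have "exp (t / 2) *\<^sub>R \<Phi> b t = F (D t)"
      using t by (simp add: \<Phi>_def w_def Db flip: exp_add)
    also have "exp (t / 2) *\<^sub>R (u t - V b t) = 2 *\<^sub>R P (D t) - D t"
      by (rule euclidean_eqI)
         (simp add: D_def P.add P.scaleR Pu PV inner_add_left inner_diff_left algebra_simps)
    finally show "(D has_vector_derivative 2 *\<^sub>R P (D t) - D t + F (D t)) (at t)" .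
    show "norm (D t) \<le> 2 * norm \<eta> * exp (t / 2)"
      using mult_left_mono[OF b_le[of t], of "exp (t / 2)"] by (simp add: Db t mult.commute)
    show "Q (D t) = 0"
      by (simp add: D_def u_def Q.add Q.diff Q.scaleR QU QV Q)
  next
    have "norm (V b 0) \<le> 2 / 3 * \<epsilon> * (2 * norm \<eta>)"
      using V_diff[OF b(1) zero, of "2 * norm \<eta>" 0] b_le by (simp add: V0)
    also have "\<dots> \<le> 2 * \<epsilon> * norm \<eta>" using mult_nonneg_nonneg[OF \<epsilon>(1) norm_ge_zero[of \<eta>]] by simp
    finally show "norm (D 0 - \<eta>) \<le> 2 * \<epsilon> * norm \<eta>" by (simp add: D_def u_def)
  qed
qed

section \<open>Comparison, uniqueness, trapping and one-dimensional flows\<close>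

lemma gronwall:
  fixes u v :: "real \<Rightarrow> 'a::euclidean_space"
  assumes S: "0 \<le> S" and L: "0 \<le> L"
    and u: "\<And>t. 0 \<le> t \<Longrightarrow> t \<le> S \<Longrightarrow> (u has_vector_derivative u' t) (at t)"
    and v: "\<And>t. 0 \<le> t \<Longrightarrow> t \<le> S \<Longrightarrow> (v has_vector_derivative v' t) (at t)"
    and le: "\<And>t. 0 \<le> t \<Longrightarrow> t \<le> S \<Longrightarrow> norm (u' t - v' t) \<le> L * norm (u t - v t) + \<epsilon>"
  shows "(norm (u S - v S))\<^sup>2 \<le> ((norm (u 0 - v 0))\<^sup>2 + \<epsilon>\<^sup>2) * exp ((2 * L + 1) * S)"
proof -
  define f where "f t = (u t - v t) \<bullet> (u t - v t)" for t
  \<comment> \<open>The squared norm is differentiable even where \<open>u\<close> and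
    \<open>v\<close> meet. The inequality between \<open>2 * \<epsilon> * norm (u t - v t)\<close>
    and the sum of the squares absorbs the inhomogeneity, at the price of the 1 in the rate
    \<open>2 * L + 1\<close>.\<close>
  define h where "h t = (f t + \<epsilon>\<^sup>2) * exp (- (2 * L + 1) * t)" for t
  have "h S \<le> h 0"
  proof (rule DERIV_nonpos_imp_nonincreasing[OF S])
    fix t assume t: "0 \<le> t" "t \<le> S"
    let ?d = "u t - v t" and ?d' = "u' t - v' t"
    have d: "((\<lambda>t. u t - v t) has_derivative (\<lambda>s. s *\<^sub>R ?d')) (at t)"
      using has_vector_derivative_diff[OF u[OF t] v[OF t]] by (simp add: has_vector_derivative_def)
    have "(f has_real_derivative 2 * (?d \<bullet> ?d')) (at t)"
      unfolding f_def has_field_derivative_def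
      by (rule has_derivative_eq_rhs[OF has_derivative_inner[OF d d]])
         (auto simp: inner_commute algebra_simps)
    then have h': "(h has_real_derivative
        (2 * (?d \<bullet> ?d') - (2 * L + 1) * (f t + \<epsilon>\<^sup>2)) * exp (- (2 * L + 1) * t)) (at t)"
      unfolding h_def by (auto intro!: derivative_eq_intros simp: algebra_simps)
    have "?d \<bullet> ?d' \<le> norm ?d * norm ?d'" by (rule norm_cauchy_schwarz)
    also have "\<dots> \<le> norm ?d * (L * norm ?d + \<epsilon>)" by (intro mult_left_mono le t) simp
    also have "2 * \<dots> \<le> 2 * L * (norm ?d)\<^sup>2 + (norm ?d)\<^sup>2 + \<epsilon>\<^sup>2"
      using sum_squares_bound[of "norm ?d" \<epsilon>] by (simp add: algebra_simps power2_eq_square)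
    finally have "2 * (?d \<bullet> ?d') \<le> 2 * L * f t + f t + \<epsilon>\<^sup>2" by (simp add: f_def power2_norm_eq_inner)
    also have "\<dots> \<le> (2 * L + 1) * (f t + \<epsilon>\<^sup>2)" using L by (simp add: algebra_simps)
    finally show "\<exists>y. (h has_real_derivative y) (at t) \<and> y \<le> 0"
      using h' by (intro exI conjI) (auto simp: mult_nonpos_nonneg)
  qed
  then have "h S * exp ((2 * L + 1) * S) \<le> h 0 * exp ((2 * L + 1) * S)" by (simp add: mult_right_mono)
  moreover have "h S * exp ((2 * L + 1) * S) = f S + \<epsilon>\<^sup>2"
    by (simp add: h_def mult.assoc algebra_simps flip: exp_add)
  moreover have "h 0 = f 0 + \<epsilon>\<^sup>2" by (simp add: h_def)
  ultimately have "f S + \<epsilon>\<^sup>2 \<le> (f 0 + \<epsilon>\<^sup>2) * exp ((2 * L + 1) * S)" by simp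
  then have "f S \<le> (f 0 + \<epsilon>\<^sup>2) * exp ((2 * L + 1) * S)" using zero_le_power2[of \<epsilon>] by linarith
  then show ?thesis by (simp add: f_def power2_norm_eq_inner)
qed

lemma trajectory_unique:
  assumes Y: "\<And>x y. norm (Y x - Y y) \<le> L * norm (x - y)" and L: "0 \<le> L"
    and u: "trajectory Y u" and v: "trajectory Y v" and eq: "u t\<^sub>0 = v t\<^sub>0"
  shows "u t = v t"
proof -
  \<comment> \<open>The sign reverses time if \<open>t\<close> precedes \<open>t\<^sub>0\<close>, so
    that the forward estimate covers both directions.\<close>
  define \<sigma> :: real where "\<sigma> = (if t\<^sub>0 \<le> t then 1 else - 1)"
  define s where "s = \<bar>t - t\<^sub>0\<bar>"
  have ts: "t = t\<^sub>0 + \<sigma> * s" by (auto simp: \<sigma>_def s_def)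
  have d: "((\<lambda>r. w (t\<^sub>0 + \<sigma> * r)) has_vector_derivative \<sigma> *\<^sub>R Y (w (t\<^sub>0 + \<sigma> * r))) (at r)"
    if "trajectory Y w" for w r
  proof -
    have "(w \<circ> (\<lambda>r. t\<^sub>0 + \<sigma> * r) has_vector_derivative \<sigma> *\<^sub>R Y (w (t\<^sub>0 + \<sigma> * r))) (at r)"
      using that by (intro vector_diff_chain_at) (auto simp: trajectory_def intro!: derivative_eq_intros)
    then show ?thesis by (simp add: o_def)
  qed
  have "(norm (u (t\<^sub>0 + \<sigma> * s) - v (t\<^sub>0 + \<sigma> * s)))\<^sup>2
    \<le> ((norm (u (t\<^sub>0 + \<sigma> * 0) - v (t\<^sub>0 + \<sigma> * 0)))\<^sup>2 + 0\<^sup>2) * exp ((2 * L + 1) * s)"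
  proof (rule gronwall[OF _ L d[OF u] d[OF v]])
    fix r
    have "norm (\<sigma> *\<^sub>R Y (u (t\<^sub>0 + \<sigma> * r)) - \<sigma> *\<^sub>R Y (v (t\<^sub>0 + \<sigma> * r)))
        = norm (Y (u (t\<^sub>0 + \<sigma> * r)) - Y (v (t\<^sub>0 + \<sigma> * r)))"
      by (simp add: \<sigma>_def norm_minus_commute flip: scaleR_diff_right)
    then show "norm (\<sigma> *\<^sub>R Y (u (t\<^sub>0 + \<sigma> * r)) - \<sigma> *\<^sub>R Y (v (t\<^sub>0 + \<sigma> * r)))
        \<le> L * norm (u (t\<^sub>0 + \<sigma> * r) - v (t\<^sub>0 + \<sigma> * r)) + 0"
      using Y by simp
  qed (simp add: s_def)
  then show ?thesis by (simp add: eq ts)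
qed

text \<open>The differential inequality is available only below the level \<open>R\<close>. If the
  estimate failed, consider the last time at which \<open>f s * exp (c * s)\<close> is at most
  \<open>f 0\<close>: there \<open>f\<close> is still below \<open>R\<close>, so by continuity the
  inequality holds a little longer, and that time was not the last.\<close>

lemma exponential_trap:
  fixes f :: "real \<Rightarrow> real"
  assumes f: "\<And>t. 0 \<le> t \<Longrightarrow> (f has_real_derivative f' t) (at t)"
    and f': "\<And>t. 0 \<le> t \<Longrightarrow> f t < R \<Longrightarrow> f' t \<le> - c * f t"
    and 0: "f 0 < R" "0 \<le> f 0" and c: "0 \<le> c" and t: "0 \<le> t"
  shows "f t \<le> f 0 * exp (- c * t)"
proof (rule ccontr)
  assume neg: "\<not> f t \<le> f 0 * exp (- c * t)"
  define h where "h t = f t * exp (c * t)" for t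
  have h': "(h has_real_derivative (f' t + c * f t) * exp (c * t)) (at t)" if "0 \<le> t" for t
    unfolding h_def using f[OF that] by (auto intro!: derivative_eq_intros simp: algebra_simps)
  have cont: "continuous_on {0..t} h"
    by (intro continuous_at_imp_continuous_on ballI DERIV_isCont[OF h']) simp
  have fh: "f s = h s * exp (- c * s)" for s by (simp add: h_def mult.assoc flip: exp_add)
  have ht: "h 0 < h t"
  proof (rule ccontr)
    assume "\<not> h 0 < h t"
    then have "h t * exp (- c * t) \<le> h 0 * exp (- c * t)" by (simp add: mult_right_mono)
    then show False using neg by (simp add: fh[of t]) (simp add: h_def)
  qed
  define A where "A = {s \<in> {0..t}. h s \<le> h 0}"
  have "closed A" unfolding A_def
    by (intro continuous_on_closed_Collect_le cont continuous_on_const) auto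
  have "0 \<in> A" using t by (simp add: A_def)
  have bdd: "bdd_above A" by (auto simp: A_def intro: bdd_aboveI[of _ t])
  define s where "s = Sup A"
  have "s \<in> A" unfolding s_def using closed_contains_Sup \<open>closed A\<close> bdd \<open>0 \<in> A\<close> by blast
  then have s: "0 \<le> s" "s < t" "h s \<le> h 0" using ht by (auto simp: A_def less_le)
  have "f s \<le> h 0 * exp (- c * s)" using s by (simp add: fh[of s] mult_right_mono)
  also have "\<dots> \<le> f 0" using 0 c s by (simp add: h_def mult_left_le)
  finally have "f s < R" using 0 by simp
  have "isCont f s" using f[OF s(1)] DERIV_isCont by blast
  then have "\<forall>\<^sub>F x in nhds s. f x < R"
    using \<open>f s < R\<close> order_tendstoD(2)[of f "f s" "nhds s" R] by (simp add: isCont_def tendsto_nhds_iff)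
  then obtain d where d: "0 < d" "\<And>x. dist x s < d \<Longrightarrow> f x < R"
    unfolding eventually_nhds_metric by blast
  define q where "q = min t (s + d / 2)"
  have q: "s < q" "q \<le> t" using s d by (auto simp: q_def)
  have "h q \<le> h s"
  proof (rule DERIV_nonpos_imp_nonincreasing[of s q h])
    fix x assume x: "s \<le> x" "x \<le> q"
    then have "0 \<le> x" "f x < R" using s d by (auto simp: q_def dist_real_def)
    then show "\<exists>y. (h has_real_derivative y) (at x) \<and> y \<le> 0"
      using h'[of x] f'[of x] by (intro exI conjI) (auto simp: mult_nonpos_nonneg)
  qed (use q in simp)
  then have "q \<in> A" using q s by (auto simp: A_def)
  then have "q \<le> s" unfolding s_def using bdd by (rule cSup_upper)
  then show False using q by simp
qed

text \<open>Separation of variables: elapsed time is the integral of \<open>1 / f\<close>, and the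
  solution is its inverse. The margins \<open>a\<^sub>0\<close> and \<open>b\<^sub>0\<close> allow
  two-sided derivatives at the ends.\<close>

lemma autonomous_connection:
  fixes f :: "real \<Rightarrow> real"
  assumes ab: "a\<^sub>0 < a" "a \<le> b" "b < b\<^sub>0" and cont: "continuous_on {a\<^sub>0..b\<^sub>0} f"
    and pos: "\<And>x. a\<^sub>0 \<le> x \<Longrightarrow> x \<le> b\<^sub>0 \<Longrightarrow> 0 < f x"
  obtains S s where "0 \<le> S" "s 0 = a" "s S = b"
    "\<And>t. 0 \<le> t \<Longrightarrow> t \<le> S \<Longrightarrow> a \<le> s t \<and> s t \<le> b \<and> (s has_real_derivative f (s t)) (at t)"
proof -
  define T where "T x = integral {a\<^sub>0..x} (\<lambda>x. 1 / f x) - integral {a\<^sub>0..a} (\<lambda>x. 1 / f x)" for x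
  have c: "continuous_on {a\<^sub>0..b\<^sub>0} (\<lambda>x. 1 / f x)"
    using pos by (intro continuous_intros cont) (auto simp: less_le)
  have T': "(T has_real_derivative 1 / f x) (at x)" if "x \<in> {a\<^sub>0<..<b\<^sub>0}" for x
  proof -
    have "((\<lambda>u. integral {a\<^sub>0..u} (\<lambda>x. 1 / f x)) has_real_derivative 1 / f x) (at x within {a\<^sub>0..b\<^sub>0})"
      using integral_has_real_derivative[OF c] that by auto
    then have "((\<lambda>u. integral {a\<^sub>0..u} (\<lambda>x. 1 / f x)) has_real_derivative 1 / f x) (at x)"
      using that at_within_Icc_at[of a\<^sub>0 x b\<^sub>0] by simp
    then show ?thesis unfolding T_def by (auto intro!: derivative_eq_intros)
  qed
  have mono: "T x < T y" if "a\<^sub>0 < x" "x < y" "y < b\<^sub>0" for x y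
  proof (rule DERIV_pos_imp_increasing[OF that(2)])
    fix z assume "x \<le> z" "z \<le> y"
    then show "\<exists>d. DERIV T z :> d \<and> 0 < d"
      using that pos[of z] by (intro exI[of _ "1 / f z"] conjI T') auto
  qed
  have inj: "inj_on T {a\<^sub>0<..<b\<^sub>0}"
    by (rule linorder_inj_onI) (use mono in \<open>force+\<close>)
  define s where "s = the_inv_into {a\<^sub>0<..<b\<^sub>0} T"
  have sT: "s (T x) = x" if "x \<in> {a\<^sub>0<..<b\<^sub>0}" for x
    unfolding s_def by (rule the_inv_into_f_f[OF inj that])
  have IVT: "\<exists>x\<ge>p. x \<le> q \<and> T x = y" if "a\<^sub>0 < p" "p \<le> q" "q < b\<^sub>0" "T p \<le> y" "y \<le> T q" for p q y
  proof (rule IVT')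
    show "continuous_on {p..q} T"
      by (intro continuous_at_imp_continuous_on ballI DERIV_isCont[OF T']) (use that in auto)
  qed (use that in auto)
  define p where "p = (a\<^sub>0 + a) / 2"
  define q where "q = (b\<^sub>0 + b) / 2"
  have pq: "a\<^sub>0 < p" "p < a" "b < q" "q < b\<^sub>0" using ab by (auto simp: p_def q_def)
  have T_a: "T a = 0" by (simp add: T_def)
  show thesis
  proof (rule that[of "T b" s])
    show "0 \<le> T b" using mono[of a b] ab T_a by (cases "a = b") auto
    show "s 0 = a" using sT[of a] ab T_a by auto
    show "s (T b) = b" using sT[of b] ab by auto
    fix t assume t: "0 \<le> t" "t \<le> T b"
    obtain x where x: "a \<le> x" "x \<le> b" "T x = t" using IVT[of a b t] t ab T_a by auto
    then have sx: "s t = x" using sT[of x] ab by auto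
    have inside: "x \<in> {a\<^sub>0<..<b\<^sub>0}" using x ab by auto
    have "(s has_real_derivative inverse (1 / f x)) (at t)"
    proof (rule DERIV_inverse_function)
      show "(T has_real_derivative 1 / f x) (at (s t))" using T'[OF inside] sx by simp
      show "1 / f x \<noteq> 0" using pos[of x] inside by auto
      show "T p < t" "t < T q" using mono[of p x] mono[of x q] x pq inside by auto
      show "T (s y) = y" if "T p < y" "y < T q" for y
        using IVT[of p q y] that pq ab sT by force
      have "isCont s (T x)"
      proof (rule isCont_inverse_function2[of p x q])
        show "s (T z) = z" "isCont T z" if "p \<le> z" "z \<le> q" for z
          using that pq by (auto intro!: sT DERIV_isCont[OF T'])
      qed (use x pq in auto)
      then show "isCont s t" using x by simp
    qed
    then show "a \<le> s t \<and> s t \<le> b \<and> (s has_real_derivative f (s t)) (at t)"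
      using x sx by simp
  qed
qed

lemma trajectory_glue:
  assumes u: "\<And>t. t \<le> 0 \<Longrightarrow> (u has_vector_derivative Y (u t)) (at t)"
    and v: "\<And>t. 0 \<le> t \<Longrightarrow> (v has_vector_derivative Y (v t)) (at t)" and eq: "u 0 = v 0"
  shows "trajectory Y (\<lambda>t. if t \<le> 0 then u t else v t)"
  unfolding trajectory_def
proof
  fix t :: real
  have "((\<lambda>t. if t \<in> {..0} then u t else v t) has_vector_derivative
      (if t \<in> {..0} then Y (u t) else Y (v t))) (at t within UNIV)"
  proof (rule has_vector_derivative_If_within_closures[where T = "{0<..}"])
    assume "t \<in> {..0} \<union> (closure {..0} \<inter> closure {0<..})"
    then have "t \<le> 0" by auto
    then show "(u has_vector_derivative Y (u t))
        (at t within {..0} \<union> (closure {..0} \<inter> closure {0<..}))"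
      by (rule has_vector_derivative_at_within[OF u])
  next
    assume "t \<in> {0<..} \<union> (closure {..0} \<inter> closure {0<..})"
    then have "0 \<le> t" by auto
    then show "(v has_vector_derivative Y (v t))
        (at t within {0<..} \<union> (closure {..0} \<inter> closure {0<..}))"
      by (rule has_vector_derivative_at_within[OF v])
  next
    assume "t \<in> closure {..0}" "t \<in> closure {0<..}"
    then have "t = 0" by simp
    then show "u t = v t" "Y (u t) = Y (v t)" using eq by simp_all
  qed auto
  then show "((\<lambda>t. if t \<le> 0 then u t else v t) has_vector_derivative
      Y (if t \<le> 0 then u t else v t)) (at t)"
    by (simp add: if_distrib[of Y])
qed

section \<open>The regular representation\<close>

text \<open>For a subgroup \<open>N\<close> this is the orthogonal projection onto the vectors fixed
  by \<open>N\<close>.\<close>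

definition avg :: "('g::finite, 'm) monoid_scheme \<Rightarrow> 'g set \<Rightarrow> complex ^ 'g \<Rightarrow> complex ^ 'g" where
  "avg G N v = (1 / real (card N)) *\<^sub>R (\<Sum>n\<in>N. regular_act G n v)"

locale regular_rep = group G for G :: "('g::finite) monoid" +
  assumes carrier_UNIV: "carrier G = UNIV"
begin

abbreviation act :: "'g \<Rightarrow> complex ^ 'g \<Rightarrow> complex ^ 'g" where
  "act \<equiv> regular_act G"

abbreviation fix_space :: "'g set \<Rightarrow> (complex ^ 'g) set" where
  "fix_space N \<equiv> {v. \<forall>n\<in>N. act n v = v}"

lemma in_carrier [simp]: "x \<in> carrier G"
  by (simp add: carrier_UNIV)

lemma linear_act: "linear (act h)"
  by (rule linearI) (simp_all add: regular_act_def vec_eq_iff)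

lemmas act_add = linear_add[OF linear_act]
  and act_diff = linear_diff[OF linear_act]
  and act_scaleR = linear_scale[OF linear_act]
  and act_sum = linear_sum[OF linear_act]
  and act_0 = linear_0[OF linear_act]

lemma bounded_linear_act: "bounded_linear (act h)"
  using linear_act linear_conv_bounded_linear by blast

lemma act_one [simp]: "act \<one>\<^bsub>G\<^esub> v = v"
  by (rule regular_act_one) (use carrier_UNIV is_group in auto)

lemma act_mult: "act (a \<otimes>\<^bsub>G\<^esub> b) v = act a (act b v)"
  by (rule regular_act_mult) (use carrier_UNIV is_group in auto)

lemma act_inv [simp]: "act (inv\<^bsub>G\<^esub> h) (act h v) = v" "act h (act (inv\<^bsub>G\<^esub> h) v) = v"
  by (simp_all flip: act_mult)

lemma bij_translation: "bij (\<lambda>x. h \<otimes>\<^bsub>G\<^esub> x)"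
  by (rule bij_betw_byWitness[where f' = "\<lambda>x. inv\<^bsub>G\<^esub> h \<otimes>\<^bsub>G\<^esub> x"]) (auto simp flip: m_assoc)

lemma inner_act [simp]: "act h u \<bullet> act h v = u \<bullet> v"
  using sum.reindex_bij_betw[OF bij_translation[of "inv\<^bsub>G\<^esub> h"], of "\<lambda>x. u $ x \<bullet> v $ x"]
  by (simp add: inner_vec_def regular_act_def)

lemma norm_act [simp]: "norm (act h v) = norm v"
  by (simp add: norm_eq_sqrt_inner)

lemma inner_act_left: "act h u \<bullet> v = u \<bullet> act (inv\<^bsub>G\<^esub> h) v"
  using inner_act[of "inv\<^bsub>G\<^esub> h" "act h u" v] by simp

lemma linear_avg: "linear (avg G N)"
  by (rule linearI)
     (simp_all add: avg_def act_add act_scaleR sum.distrib scaleR_right_distrib scaleR_right.sum mult.commute)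

lemma avg_fixed:
  assumes "subgroup N G" "v \<in> fix_space N"
  shows "avg G N v = v"
proof -
  have "card N \<noteq> 0" using subgroup.one_closed[OF assms(1)] by auto
  then show ?thesis using assms(2) by (simp add: avg_def sum_constant_scaleR del: sum_constant)
qed

lemma act_avg:
  assumes "h \<in> normalizer G N"
  shows "act h (avg G N v) = avg G N (act h v)"
proof -
  have "(\<lambda>n. h \<otimes>\<^bsub>G\<^esub> n) ` N = (\<lambda>n. n \<otimes>\<^bsub>G\<^esub> h) ` N"
    using assms by (auto simp: normalizer_eq_cosets l_coset_def r_coset_def carrier_UNIV)
  then have "(\<Sum>n\<in>(\<lambda>n. h \<otimes>\<^bsub>G\<^esub> n) ` N. act n v) = (\<Sum>n\<in>(\<lambda>n. n \<otimes>\<^bsub>G\<^esub> h) ` N. act n v)" by simp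
  then have "(\<Sum>n\<in>N. act (h \<otimes>\<^bsub>G\<^esub> n) v) = (\<Sum>n\<in>N. act (n \<otimes>\<^bsub>G\<^esub> h) v)"
    by (simp add: sum.reindex inj_on_def)
  then show ?thesis by (simp add: avg_def act_scaleR act_sum flip: act_mult)
qed

lemma avg_in_fix_space:
  assumes N: "subgroup N G"
  shows "avg G N v \<in> fix_space N"
proof safe
  fix h assume h: "h \<in> N"
  have "(\<Sum>n\<in>N. act (h \<otimes>\<^bsub>G\<^esub> n) v) = (\<Sum>n\<in>(\<lambda>n. h \<otimes>\<^bsub>G\<^esub> n) ` N. act n v)"
    by (simp add: sum.reindex inj_on_def)
  also have "(\<lambda>n. h \<otimes>\<^bsub>G\<^esub> n) ` N = N"
    using coset_join3[OF _ N h] by (auto simp: l_coset_def)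
  finally show "act h (avg G N v) = avg G N v"
    by (simp add: avg_def act_scaleR act_sum flip: act_mult)
qed

lemma avg_avg: "subgroup N G \<Longrightarrow> avg G N (avg G N v) = avg G N v"
  by (intro avg_fixed avg_in_fix_space)

lemma avg_commute:
  assumes "N' \<subseteq> normalizer G N"
  shows "avg G N (avg G N' v) = avg G N' (avg G N v)"
proof -
  have "avg G N (avg G N' v) = (1 / real (card N')) *\<^sub>R (\<Sum>n\<in>N'. avg G N (act n v))"
    by (simp add: avg_def[of G N'] linear_scale[OF linear_avg] linear_sum[OF linear_avg])
  also have "\<dots> = avg G N' (avg G N v)"
    unfolding avg_def[of G N'] using assms by (auto intro!: sum.cong simp: act_avg)
  finally show ?thesis .
qed

lemma inner_avg:
  assumes N: "subgroup N G"
  shows "avg G N u \<bullet> v = u \<bullet> avg G N v"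
proof -
  have "(\<Sum>n\<in>N. act (inv\<^bsub>G\<^esub> n) v) = (\<Sum>n\<in>N. act n v)"
    by (rule sum.reindex_bij_witness[of _ "m_inv G" "m_inv G"]) (use N in \<open>auto intro: subgroup.m_inv_closed\<close>)
  then show ?thesis
    by (simp add: avg_def inner_sum_left inner_act_left flip: inner_sum_right)
qed

text \<open>The projection onto the imaginary one of the two real copies of the regular
  representation. It is equivariant and self-adjoint, so real vectors are orthogonal to purely
  imaginary ones.\<close>

definition imag :: "complex ^ 'g \<Rightarrow> complex ^ 'g" where
  "imag v = (\<chi> x. Complex 0 (Im (v $ x)))"

lemma linear_imag: "linear imag"
  by (rule linearI) (simp_all add: imag_def vec_eq_iff complex_eq_iff)

lemma imag_act: "imag (act h v) = act h (imag v)"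
  by (simp add: imag_def regular_act_def vec_eq_iff)

lemma imag_avg: "imag (avg G N v) = avg G N (imag v)"
  by (simp add: avg_def linear_scale[OF linear_imag] linear_sum[OF linear_imag] imag_act)

lemma inner_imag: "imag u \<bullet> v = u \<bullet> imag v"
  by (simp add: imag_def inner_vec_def inner_complex_def)

end

section \<open>The conjugate subgroup and the linear part of the saddle\<close>

locale homoclinic = regular_rep G for G :: "('g::finite) monoid" +
  fixes K H :: "'g set" and g :: 'g
  assumes triple: "homoclinic_triple G K g H"
    and normal: "H \<subseteq> normalizer G K \<inter> normalizer G (conj_subgroup G K (inv\<^bsub>G\<^esub> g))"
begin

abbreviation K' :: "'g set" where
  "K' \<equiv> conj_subgroup G K (inv\<^bsub>G\<^esub> g)"

lemma subgroup_K: "subgroup K G" and subgroup_H: "subgroup H G" and K_subset_H: "K \<subseteq> H"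
  using triple by (auto simp: homoclinic_triple_def)

lemma K'_eq: "K' = (\<lambda>k. inv\<^bsub>G\<^esub> g \<otimes>\<^bsub>G\<^esub> k \<otimes>\<^bsub>G\<^esub> g) ` K"
  by (auto simp: conj_subgroup_def l_coset_def r_coset_def)

lemma K'_iff: "x \<in> K' \<longleftrightarrow> g \<otimes>\<^bsub>G\<^esub> x \<otimes>\<^bsub>G\<^esub> inv\<^bsub>G\<^esub> g \<in> K"
proof
  assume "g \<otimes>\<^bsub>G\<^esub> x \<otimes>\<^bsub>G\<^esub> inv\<^bsub>G\<^esub> g \<in> K"
  moreover have "x = inv\<^bsub>G\<^esub> g \<otimes>\<^bsub>G\<^esub> (g \<otimes>\<^bsub>G\<^esub> x \<otimes>\<^bsub>G\<^esub> inv\<^bsub>G\<^esub> g) \<otimes>\<^bsub>G\<^esub> g"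
    by (simp add: m_assoc) (simp flip: m_assoc)
  ultimately show "x \<in> K'" unfolding K'_eq by blast
next
  assume "x \<in> K'"
  then obtain k where "k \<in> K" "x = inv\<^bsub>G\<^esub> g \<otimes>\<^bsub>G\<^esub> k \<otimes>\<^bsub>G\<^esub> g" by (auto simp: K'_eq)
  moreover from this have "g \<otimes>\<^bsub>G\<^esub> x \<otimes>\<^bsub>G\<^esub> inv\<^bsub>G\<^esub> g = k"
    by (simp add: m_assoc) (simp flip: m_assoc)
  ultimately show "g \<otimes>\<^bsub>G\<^esub> x \<otimes>\<^bsub>G\<^esub> inv\<^bsub>G\<^esub> g \<in> K" by simp
qed

lemma subgroup_K': "subgroup K' G"
proof
  fix x y assume "x \<in> K'" "y \<in> K'"
  then have "g \<otimes>\<^bsub>G\<^esub> x \<otimes>\<^bsub>G\<^esub> inv\<^bsub>G\<^esub> g \<otimes>\<^bsub>G\<^esub> (g \<otimes>\<^bsub>G\<^esub> y \<otimes>\<^bsub>G\<^esub> inv\<^bsub>G\<^esub> g) \<in> K"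
    using subgroup.m_closed[OF subgroup_K] by (simp add: K'_iff)
  moreover have "g \<otimes>\<^bsub>G\<^esub> x \<otimes>\<^bsub>G\<^esub> inv\<^bsub>G\<^esub> g \<otimes>\<^bsub>G\<^esub> (g \<otimes>\<^bsub>G\<^esub> y \<otimes>\<^bsub>G\<^esub> inv\<^bsub>G\<^esub> g)
      = g \<otimes>\<^bsub>G\<^esub> (x \<otimes>\<^bsub>G\<^esub> (inv\<^bsub>G\<^esub> g \<otimes>\<^bsub>G\<^esub> g) \<otimes>\<^bsub>G\<^esub> y) \<otimes>\<^bsub>G\<^esub> inv\<^bsub>G\<^esub> g"
    by (simp only: m_assoc in_carrier m_closed inv_closed)
  ultimately show "x \<otimes>\<^bsub>G\<^esub> y \<in> K'" by (simp add: K'_iff)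
next
  fix x assume "x \<in> K'"
  then have "inv\<^bsub>G\<^esub> (g \<otimes>\<^bsub>G\<^esub> x \<otimes>\<^bsub>G\<^esub> inv\<^bsub>G\<^esub> g) \<in> K"
    using subgroup.m_inv_closed[OF subgroup_K] by (simp add: K'_iff)
  then show "inv\<^bsub>G\<^esub> x \<in> K'" by (simp add: K'_iff inv_mult_group m_assoc)
qed (use subgroup.one_closed[OF subgroup_K] in \<open>auto simp: K'_iff\<close>)

lemma K'_subset_H: "K' \<subseteq> H"
proof
  fix x assume "x \<in> K'"
  then have "g \<otimes>\<^bsub>G\<^esub> x \<otimes>\<^bsub>G\<^esub> inv\<^bsub>G\<^esub> g \<in> conj_subgroup G H g"
    using triple by (auto simp: homoclinic_triple_def K'_iff)
  then obtain h where "h \<in> H" "g \<otimes>\<^bsub>G\<^esub> x \<otimes>\<^bsub>G\<^esub> inv\<^bsub>G\<^esub> g = g \<otimes>\<^bsub>G\<^esub> h \<otimes>\<^bsub>G\<^esub> inv\<^bsub>G\<^esub> g"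
    by (auto simp: conj_subgroup_def l_coset_def r_coset_def)
  then show "x \<in> H" by simp
qed

lemma g_notin_normalizer: "g \<notin> normalizer G K"
  using triple subgroup.one_closed[OF subgroup_H]
  by (force simp: homoclinic_triple_def l_coset_def)

lemma g_notin_H: "g \<notin> H"
  using g_notin_normalizer normal by auto

text \<open>Conjugate finite subgroups have equal order, so inclusion would mean equality, and
  \<open>g\<close> would normalize \<open>K\<close>. This is the source of a nonzero unstable
  space.\<close>

lemma not_K'_subset_K: "\<not> K' \<subseteq> K"
proof
  assume "K' \<subseteq> K"
  moreover have "card K' = card K" unfolding K'_eq by (rule card_image) (simp add: inj_on_def)
  ultimately have "K' = K" by (simp add: card_subset_eq)
  then have "g <#\<^bsub>G\<^esub> K = g <#\<^bsub>G\<^esub> K'" by simp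
  also have "\<dots> = K #>\<^bsub>G\<^esub> g"
    unfolding K'_eq l_coset_def r_coset_def by (force simp flip: m_assoc)
  finally show False using g_notin_normalizer by (simp add: normalizer_eq_cosets carrier_UNIV)
qed

lemma avg_K_K': "avg G K (avg G K' v) = avg G K' (avg G K v)"
  by (rule avg_commute[symmetric]) (use normal K_subset_H in auto)

text \<open>The orthogonal projection onto the directions at an \<open>H\<close>-fixed point which
  are to be unstable: those fixed by \<open>K\<close> and orthogonal to the fixed space of \<open>K'\<close>.
  In the directions fixed by \<open>K'\<close>, that is, in the directions fixed by \<open>K\<close> at the translate
  by \<open>g\<close>, the equilibrium is a sink.\<close>

definition P :: "complex ^ 'g \<Rightarrow> complex ^ 'g" where
  "P v = avg G K v - avg G K (avg G K' v)"

lemma linear_P: "linear P"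
  by (rule linearI)
     (simp_all add: P_def linear_add[OF linear_avg] linear_scale[OF linear_avg] algebra_simps)

lemma P_P: "P (P v) = P v"
  by (simp add: P_def linear_diff[OF linear_avg] linear_0[OF linear_avg] avg_avg[OF subgroup_K] avg_avg[OF subgroup_K']
      flip: avg_K_K')

lemma inner_P: "P u \<bullet> v = u \<bullet> P v"
  by (simp add: P_def inner_diff_left inner_diff_right inner_avg subgroup_K subgroup_K' flip: avg_K_K')

lemma act_P: "h \<in> H \<Longrightarrow> act h (P v) = P (act h v)"
  using normal by (simp add: P_def act_diff act_avg subset_iff)

lemma avg_P: "avg G K (P v) = P v" "P (avg G K v) = P v"
  by (simp_all add: P_def linear_diff[OF linear_avg] linear_0[OF linear_avg] avg_avg[OF subgroup_K] flip: avg_K_K')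

lemma P_zero: "v \<in> fix_space K' \<Longrightarrow> P v = 0"
  by (simp add: P_def avg_fixed[OF subgroup_K'])

text \<open>As \<open>P\<close> is an orthogonal projection, this is a reflection: symmetric,
  isometric and its own inverse. The last property lets the equation of a perturbed equilibrium be
  solved for the unknown explicitly.\<close>

definition A :: "complex ^ 'g \<Rightarrow> complex ^ 'g" where
  "A v = 2 *\<^sub>R P v - v"

lemma linear_A: "linear A"
  by (rule linearI) (simp_all add: A_def linear_add[OF linear_P] linear_scale[OF linear_P] algebra_simps)

lemma inner_A: "A u \<bullet> v = u \<bullet> A v"
  by (simp add: A_def inner_diff_left inner_diff_right inner_P)

lemma A_A: "A (A v) = v"
proof -
  have "P (A v) = P v"
    by (simp only: A_def linear_diff[OF linear_P] linear_scale[OF linear_P] P_P)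
       (simp only: scaleR_2 add_diff_cancel_right')
  then show ?thesis by (simp add: A_def)
qed

lemma norm_A: "norm (A v) = norm v"
  by (simp add: norm_eq_sqrt_inner inner_A A_A)

lemma act_A: "h \<in> H \<Longrightarrow> act h (A v) = A (act h v)"
  by (simp add: A_def act_diff act_scaleR act_P)

lemma A_sink: "v \<in> fix_space K' \<Longrightarrow> A v = - v"
  by (simp add: A_def P_zero)

lemma norm_P_le: "norm (P v) \<le> norm v" "norm (v - P v) \<le> norm v"
proof -
  have "P v \<bullet> (v - P v) = 0" by (simp add: inner_diff_right inner_P P_P)
  then have "(norm v)\<^sup>2 = (norm (P v))\<^sup>2 + (norm (v - P v))\<^sup>2"
    using norm_add_Pythagorean[of "P v" "v - P v"] by (simp add: orthogonal_def)
  then show "norm (P v) \<le> norm v" "norm (v - P v) \<le> norm v"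
    by (auto intro: power2_le_imp_le)
qed

lemma fix_K_translate: "v \<in> fix_space K' \<longleftrightarrow> act g v \<in> fix_space K"
proof -
  have "act (inv\<^bsub>G\<^esub> g \<otimes>\<^bsub>G\<^esub> k \<otimes>\<^bsub>G\<^esub> g) v = v \<longleftrightarrow> act k (act g v) = act g v" for k
    by (metis act_inv act_mult)
  then show ?thesis by (auto simp: K'_eq)
qed

end

section \<open>A field with a connection\<close>

context regular_rep
begin

text \<open>The divisor is the order of \<open>N\<close>, not of the group: where the result
  matters, the conjugates of \<open>Z\<close> by \<open>N\<close> agree and all others vanish, so
  that the sum returns \<open>Z\<close> itself.\<close>

definition symmetrize :: "'g set \<Rightarrow> (complex ^ 'g \<Rightarrow> complex ^ 'g) \<Rightarrow> complex ^ 'g \<Rightarrow> complex ^ 'g" where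
  "symmetrize N Z v = (1 / real (card N)) *\<^sub>R (\<Sum>h\<in>UNIV. act h (Z (act (inv\<^bsub>G\<^esub> h) v)))"

lemma act_symmetrize: "act k (symmetrize N Z v) = symmetrize N Z (act k v)"
proof -
  have "act k (symmetrize N Z v)
      = (1 / real (card N)) *\<^sub>R (\<Sum>h\<in>UNIV. act (k \<otimes>\<^bsub>G\<^esub> h) (Z (act (inv\<^bsub>G\<^esub> (k \<otimes>\<^bsub>G\<^esub> h)) (act k v))))"
    by (simp add: symmetrize_def act_scaleR act_sum act_mult inv_mult_group)
  also have "\<dots> = symmetrize N Z (act k v)"
    unfolding symmetrize_def
    using sum.reindex_bij_betw[OF bij_translation[of k], of "\<lambda>h. act h (Z (act (inv\<^bsub>G\<^esub> h) (act k v)))"]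
    by simp
  finally show ?thesis .
qed

lemma symmetrize_eq:
  assumes "N \<noteq> {}" and "\<And>h. h \<in> N \<Longrightarrow> act h (Z (act (inv\<^bsub>G\<^esub> h) v)) = z"
    and "\<And>h. h \<notin> N \<Longrightarrow> Z (act (inv\<^bsub>G\<^esub> h) v) = 0"
  shows "symmetrize N Z v = z"
proof -
  have "(\<Sum>h\<in>UNIV. act h (Z (act (inv\<^bsub>G\<^esub> h) v))) = (\<Sum>h\<in>N. act h (Z (act (inv\<^bsub>G\<^esub> h) v)))"
    by (rule sum.mono_neutral_right) (use assms in \<open>auto simp: act_0\<close>)
  also have "\<dots> = real (card N) *\<^sub>R z" using assms(2) by (simp add: sum_constant_scaleR del: sum_constant)
  finally show ?thesis using assms(1) by (simp add: symmetrize_def)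
qed

lemma vsmooth_symmetrize:
  assumes "vsmooth Z" shows "vsmooth (symmetrize N Z)"
proof -
  have "vsmooth (\<lambda>v. act h (Z (act (inv\<^bsub>G\<^esub> h) v)))" for h
    by (rule vsmooth_linear[OF linear_act vsmooth_compose_linear[OF assms linear_act]])
  then show ?thesis
    unfolding symmetrize_def[abs_def] by (intro vsmooth_scaleR vsmooth_sum smooth_const)
qed

end

section \<open>The equilibrium and its unstable direction\<close>

context homoclinic
begin

definition x\<^sub>0 :: "complex ^ 'g" where
  "x\<^sub>0 = (\<chi> x. if x \<in> H then 1 else 0)"

text \<open>The imaginary unit as coefficient makes \<open>W\<close> orthogonal to all translates of
  \<open>x\<^sub>0\<close>; the basis vector at the identity makes its coordinates
  computable.\<close>

definition W :: "complex ^ 'g" where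
  "W = P (axis \<one>\<^bsub>G\<^esub> \<i>)"

definition d :: "complex ^ 'g" where
  "d = act g x\<^sub>0 - x\<^sub>0"

lemma act_x0_component: "act h x\<^sub>0 $ x = (if inv\<^bsub>G\<^esub> h \<otimes>\<^bsub>G\<^esub> x \<in> H then 1 else 0)"
  by (simp add: x\<^sub>0_def regular_act_def)

lemma act_x0:
  assumes h: "h \<in> H" shows "act h x\<^sub>0 = x\<^sub>0"
proof -
  have "inv\<^bsub>G\<^esub> h \<otimes>\<^bsub>G\<^esub> x \<in> H \<longleftrightarrow> x \<in> H" for x
    using subgroup.m_closed[OF subgroup_H h, of "inv\<^bsub>G\<^esub> h \<otimes>\<^bsub>G\<^esub> x"]
      subgroup.m_closed[OF subgroup_H subgroup.m_inv_closed[OF subgroup_H h], of x]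
    by (auto simp flip: m_assoc)
  then show ?thesis by (simp add: vec_eq_iff act_x0_component) (simp add: x\<^sub>0_def)
qed

text \<open>At the identity coordinate \<open>x\<^sub>0\<close> is 1 and the translate is 0.\<close>

lemma x0_separated:
  assumes "h \<notin> H" shows "1 \<le> norm (act h x\<^sub>0 - x\<^sub>0)"
proof -
  have "inv\<^bsub>G\<^esub> h \<notin> H" using assms subgroup.m_inv_closed[OF subgroup_H] by force
  then have "norm ((act h x\<^sub>0 - x\<^sub>0) $ \<one>\<^bsub>G\<^esub>) = 1"
    using subgroup.one_closed[OF subgroup_H] by (simp add: act_x0_component) (simp add: x\<^sub>0_def)
  then show ?thesis using Finite_Cartesian_Product.norm_nth_le[of "act h x\<^sub>0 - x\<^sub>0" "\<one>\<^bsub>G\<^esub>"] by simp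
qed

lemma imag_x0: "imag x\<^sub>0 = 0"
  by (simp add: imag_def x\<^sub>0_def vec_eq_iff complex_eq_iff)

lemma imag_act_x0: "imag (act h x\<^sub>0) = 0"
  by (simp add: imag_act imag_x0 act_0)

lemma imag_W: "imag W = W"
proof -
  have "imag (axis \<one>\<^bsub>G\<^esub> \<i>) = axis \<one>\<^bsub>G\<^esub> \<i>"
    by (simp add: imag_def axis_def vec_eq_iff complex_eq_iff)
  then show ?thesis by (simp add: W_def P_def linear_diff[OF linear_imag] imag_avg)
qed

lemma inner_act_x0_W: "act h x\<^sub>0 \<bullet> W = 0"
  using inner_imag[of "act h x\<^sub>0" W] by (simp add: imag_W imag_act_x0)

lemma inner_x0_W: "x\<^sub>0 \<bullet> W = 0"
  using inner_act_x0_W[of "\<one>\<^bsub>G\<^esub>"] by simp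

lemma inner_d_W: "d \<bullet> W = 0"
  by (simp add: d_def inner_diff_left inner_act_x0_W inner_x0_W)

lemma imag_d: "imag d = 0"
  by (simp add: d_def linear_diff[OF linear_imag] imag_act_x0 imag_x0)

lemma x0_fix: "x\<^sub>0 \<in> fix_space K"
  using act_x0 K_subset_H by auto

lemma gx0_fix: "act g x\<^sub>0 \<in> fix_space K"
  using act_x0 K'_subset_H by (subst fix_K_translate[symmetric]) auto

lemma d_fix: "d \<in> fix_space K"
  using x0_fix gx0_fix by (simp add: d_def act_diff)

lemma P_W: "P W = W"
  by (simp add: W_def P_P)

lemma W_fix: "W \<in> fix_space K"
  using avg_in_fix_space[OF subgroup_K, of W] avg_P(1)[of W] by (simp add: P_W)

lemma d_nonzero: "d \<noteq> 0"
  using x0_separated[OF g_notin_H] by (auto simp: d_def)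

text \<open>Averaging the basis vector over \<open>K\<close> gives a multiple of the indicator of
  \<open>K\<close>, and averaging it over both groups gives something nonnegative that is
  subtracted. So outside \<open>K\<close> no positive value remains, while at the identity the
  subtracted average is strictly smaller because \<open>K\<close> is not contained in
  \<open>K'\<close>. The signs then determine the isotropy of \<open>W\<close>.\<close>

lemma W_component:
  "0 < Im (W $ \<one>\<^bsub>G\<^esub>)" "x \<notin> K \<Longrightarrow> Im (W $ x) \<le> 0"
proof -
  let ?e = "axis \<one>\<^bsub>G\<^esub> \<i> :: complex ^ 'g"
  have avg_nth: "Im (avg G N v $ x) = (\<Sum>n\<in>N. Im (v $ (inv\<^bsub>G\<^esub> n \<otimes>\<^bsub>G\<^esub> x))) / real (card N)" for N v x
    by (simp add: avg_def regular_act_def)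
  have e: "Im (avg G N ?e $ x) = (if x \<in> N then 1 else 0) / real (card N)" for N x
  proof -
    have "inv\<^bsub>G\<^esub> n \<otimes>\<^bsub>G\<^esub> x = \<one>\<^bsub>G\<^esub> \<longleftrightarrow> n = x" for n
      using inv_solve_left'[of "\<one>\<^bsub>G\<^esub>" n x] by auto
    then have "(\<Sum>n\<in>N. Im (?e $ (inv\<^bsub>G\<^esub> n \<otimes>\<^bsub>G\<^esub> x))) = (\<Sum>n\<in>N. if n = x then 1 else 0)"
      by (intro sum.cong) (auto simp: axis_def)
    then show ?thesis by (simp add: avg_nth)
  qed
  have W: "Im (W $ x) = (if x \<in> K then 1 else 0) / real (card K)
      - (\<Sum>n\<in>K. (if inv\<^bsub>G\<^esub> n \<otimes>\<^bsub>G\<^esub> x \<in> K' then 1 else 0) / real (card K')) / real (card K)" for x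
    by (simp add: W_def P_def e avg_nth[of K "avg G K' _"])
  show "Im (W $ x) \<le> 0" if "x \<notin> K"
    using that by (simp add: W sum_nonneg)
  have K: "0 < card K" "0 < card K'"
    using subgroup.one_closed[OF subgroup_K] subgroup.one_closed[OF subgroup_K'] by (auto simp: card_gt_0_iff)
  have card: "card K' = card K" unfolding K'_eq by (rule card_image) (simp add: inj_on_def)
  obtain k where k: "k \<in> K" "inv\<^bsub>G\<^esub> k \<notin> K'"
  proof -
    have "\<not> K \<subseteq> K'"
      using card_subset_eq[of K' K] card not_K'_subset_K by auto
    then show thesis using that subgroup.m_inv_closed[OF subgroup_K'] by (metis in_carrier inv_inv subsetI)
  qed
  have "(\<Sum>n\<in>K. (if inv\<^bsub>G\<^esub> n \<otimes>\<^bsub>G\<^esub> \<one>\<^bsub>G\<^esub> \<in> K' then 1 else 0) / real (card K')) < (\<Sum>n\<in>K. 1 / real (card K'))"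
    by (rule sum_strict_mono_ex1) (use k K in \<open>auto simp: divide_right_mono\<close>)
  also have "\<dots> = 1" using K card by (auto simp: card_gt_0_iff)
  finally show "0 < Im (W $ \<one>\<^bsub>G\<^esub>)"
    using K subgroup.one_closed[OF subgroup_K] by (simp add: W divide_strict_right_mono)
qed

lemma W_nonzero: "W \<noteq> 0"
  using W_component(1) by auto

lemma W_isotropy:
  assumes "act h W = W" shows "h \<in> K"
proof -
  have "W $ h = act h W $ h" by (simp add: assms)
  also have "\<dots> = W $ \<one>\<^bsub>G\<^esub>" by (simp add: regular_act_def)
  finally show ?thesis using W_component(1) W_component(2)[of h] by fastforce
qed

text \<open>Since \<open>act h\<close> preserves norms, \<open>act h W \<noteq> W\<close> makes the
  Cauchy-Schwarz bound strict; finiteness of the group makes the gap uniform.\<close>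

lemma W_separated:
  obtains \<theta> where "0 < \<theta>" "\<And>h. h \<notin> K \<Longrightarrow> act h W \<bullet> W \<le> (1 - \<theta>) * (W \<bullet> W)"
proof -
  have less: "act h W \<bullet> W < W \<bullet> W" if "h \<notin> K" for h
  proof -
    have "0 < (act h W - W) \<bullet> (act h W - W)" using that W_isotropy by auto
    then show ?thesis by (simp add: inner_diff_left inner_diff_right inner_commute)
  qed
  define q where "q h = 1 - (act h W \<bullet> W) / (W \<bullet> W)" for h
  have q: "0 < q h" if "h \<notin> K" for h using less[OF that] W_nonzero by (simp add: q_def)
  define \<theta> where "\<theta> = Min (insert 1 (q ` (- K)))"
  have "0 < \<theta>" using q by (auto simp: \<theta>_def)
  moreover have "act h W \<bullet> W \<le> (1 - \<theta>) * (W \<bullet> W)" if "h \<notin> K" for h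
  proof -
    have "\<theta> \<le> q h" unfolding \<theta>_def using that by (intro Min_le) auto
    then have "(act h W \<bullet> W) / (W \<bullet> W) \<le> 1 - \<theta>" by (simp add: q_def)
    then show ?thesis using W_nonzero by (simp add: pos_divide_le_eq)
  qed
  ultimately show thesis using that by blast
qed

text \<open>The cut-off is 1 up to distance 1/4 and 0 once the squared distance reaches 1/8. A point
  within 1/4 of \<open>x\<^sub>0\<close> is at least 3/4 away from every other translate, so those
  contribute nothing there.\<close>

definition Z\<^sub>1 :: "complex ^ 'g \<Rightarrow> complex ^ 'g" where
  "Z\<^sub>1 v = smooth_step (2 - 16 * ((v - x\<^sub>0) \<bullet> (v - x\<^sub>0))) *\<^sub>R A (v - x\<^sub>0)"

definition X\<^sub>1 :: "complex ^ 'g \<Rightarrow> complex ^ 'g" where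
  "X\<^sub>1 = symmetrize H Z\<^sub>1"

lemma vsmooth_X1: "vsmooth X\<^sub>1"
proof -
  have "vsmooth (\<lambda>v. A (v - x\<^sub>0))"
    by (rule vsmooth_linear[OF linear_A]) (intro vsmooth_diff vsmooth_id vsmooth_const)
  moreover have "smooth (\<lambda>v. smooth_step (2 - 16 * ((v - x\<^sub>0) \<bullet> (v - x\<^sub>0))))"
    by (intro smooth_smooth_step smooth_diff smooth_const smooth_cmult smooth_inner_vsmooth
        vsmooth_diff vsmooth_id vsmooth_const)
  ultimately have "vsmooth Z\<^sub>1" unfolding Z\<^sub>1_def[abs_def] by (rule vsmooth_scaleR[rotated])
  then show ?thesis unfolding X\<^sub>1_def by (rule vsmooth_symmetrize)
qed

lemma act_X1: "act h (X\<^sub>1 v) = X\<^sub>1 (act h v)"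
  by (simp add: X\<^sub>1_def act_symmetrize)

lemma X1_near_x0:
  assumes v: "norm (v - x\<^sub>0) \<le> 1 / 4"
  shows "X\<^sub>1 v = A (v - x\<^sub>0)"
  unfolding X\<^sub>1_def
proof (rule symmetrize_eq)
  show "H \<noteq> {}" using subgroup.one_closed[OF subgroup_H] by auto
next
  fix h assume h: "h \<in> H"
  have e: "act (inv\<^bsub>G\<^esub> h) v - x\<^sub>0 = act (inv\<^bsub>G\<^esub> h) (v - x\<^sub>0)"
    using act_x0[OF subgroup.m_inv_closed[OF subgroup_H h]] by (simp add: act_diff)
  have "(norm (v - x\<^sub>0))\<^sup>2 \<le> (1 / 4)\<^sup>2" using v by (intro power_mono) auto
  then have "smooth_step (2 - 16 * ((v - x\<^sub>0) \<bullet> (v - x\<^sub>0))) = 1"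
    by (intro smooth_step_ge_1) (simp add: power_divide flip: power2_norm_eq_inner)
  then show "act h (Z\<^sub>1 (act (inv\<^bsub>G\<^esub> h) v)) = A (v - x\<^sub>0)"
    using h by (simp add: Z\<^sub>1_def e act_A)
next
  fix h assume "h \<notin> H"
  then have "1 \<le> norm (act h x\<^sub>0 - x\<^sub>0)" by (rule x0_separated)
  also have "\<dots> \<le> norm (v - x\<^sub>0) + norm (v - act h x\<^sub>0)"
    using norm_triangle_ineq4[of "v - x\<^sub>0" "v - act h x\<^sub>0"] by simp
  also have "norm (v - act h x\<^sub>0) = norm (act (inv\<^bsub>G\<^esub> h) v - x\<^sub>0)"
    using norm_act[of "inv\<^bsub>G\<^esub> h" "v - act h x\<^sub>0"] by (simp add: act_diff del: norm_act)
  finally have "(3 / 4)\<^sup>2 \<le> (norm (act (inv\<^bsub>G\<^esub> h) v - x\<^sub>0))\<^sup>2" using v by (intro power_mono) auto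
  then have "smooth_step (2 - 16 * ((act (inv\<^bsub>G\<^esub> h) v - x\<^sub>0) \<bullet> (act (inv\<^bsub>G\<^esub> h) v - x\<^sub>0))) = 0"
    by (intro smooth_step_le_0) (simp add: power_divide flip: power2_norm_eq_inner)
  then show "Z\<^sub>1 (act (inv\<^bsub>G\<^esub> h) v) = 0" by (simp add: Z\<^sub>1_def)
qed

lemma translate_linear_part:
  assumes X: "\<And>h v. act h (X v) = X (act h v)" and near: "\<And>v. norm (v - x\<^sub>0) \<le> r \<Longrightarrow> X v = A (v - x\<^sub>0)"
    and v: "norm (v - act h x\<^sub>0) \<le> r"
  shows "X v = act h (A (act (inv\<^bsub>G\<^esub> h) (v - act h x\<^sub>0)))"
proof -
  have "norm (act (inv\<^bsub>G\<^esub> h) v - x\<^sub>0) = norm (v - act h x\<^sub>0)"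
    using norm_act[of "inv\<^bsub>G\<^esub> h" "v - act h x\<^sub>0"] by (simp add: act_diff del: norm_act)
  then have "X (act (inv\<^bsub>G\<^esub> h) v) = A (act (inv\<^bsub>G\<^esub> h) v - x\<^sub>0)" using v near by simp
  then show ?thesis using X[of h "act (inv\<^bsub>G\<^esub> h) v"] by (simp add: act_diff)
qed

text \<open>At \<open>act g x\<^sub>0\<close> the linear part is the conjugate of \<open>A\<close>
  by \<open>g\<close>. Pulling a \<open>K\<close>-fixed vector back by \<open>g\<close> gives a
  \<open>K'\<close>-fixed one, on which \<open>A\<close> is \<open>-1\<close>.\<close>

lemma sink_near_gx0:
  assumes "\<And>h v. act h (X v) = X (act h v)" "\<And>v. norm (v - x\<^sub>0) \<le> r \<Longrightarrow> X v = A (v - x\<^sub>0)"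
    and v: "norm (v - act g x\<^sub>0) \<le> r" "v \<in> fix_space K"
  shows "X v = act g x\<^sub>0 - v"
proof -
  have "act (inv\<^bsub>G\<^esub> g) (v - act g x\<^sub>0) \<in> fix_space K'"
    using v(2) gx0_fix by (subst fix_K_translate) (simp add: act_diff)
  then have "X v = act g (- act (inv\<^bsub>G\<^esub> g) (v - act g x\<^sub>0))"
    using translate_linear_part[OF assms(1,2) v(1)] by (simp add: A_sink)
  then show ?thesis by (simp add: linear_neg[OF linear_act])
qed

end

text \<open>Used both as the transverse profile of the curve and as the speed
  \<open>s' = crossing s\<close> along it. On the outer thirds the curve then runs as
  \<open>x\<^sub>0 + s W\<close> with \<open>s' = s\<close>, and as
  \<open>g x\<^sub>0 + (1 - s) (W - 2 d)\<close> with \<open>(1 - s)' = - (1 - s)\<close>: orbits of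
  the linear fields at the two ends.\<close>

definition crossing :: "real \<Rightarrow> real" where
  "crossing s = (1 - smooth_step (3 * s - 1)) * s + smooth_step (3 * s - 1) * (1 - s)"

lemma smooth_crossing: "smooth crossing"
  unfolding crossing_def[abs_def]
  by (intro smooth_add smooth_mult smooth_diff smooth_const smooth_smooth_step smooth_cmult smooth_id)

lemma crossing_ge:
  assumes "m \<le> s" "m \<le> 1 - s" shows "m \<le> crossing s"
proof -
  have "(1 - smooth_step (3 * s - 1)) * m + smooth_step (3 * s - 1) * m \<le> crossing s"
    unfolding crossing_def using assms smooth_step_bounds[of "3 * s - 1"]
    by (intro add_mono mult_left_mono) auto
  then show ?thesis by (simp add: algebra_simps)
qed

lemma crossing_start: "s \<le> 1 / 3 \<Longrightarrow> crossing s = s"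
  by (simp add: crossing_def smooth_step_le_0)

lemma crossing_end: "2 / 3 \<le> s \<Longrightarrow> crossing s = 1 - s"
  by (simp add: crossing_def smooth_step_ge_1)

lemma smooth_has_real_derivative:
  fixes f :: "real \<Rightarrow> real"
  assumes "smooth f"
  obtains f' where "\<And>x. (f has_real_derivative f' x) (at x)" "smooth f'"
proof -
  obtain D where D: "\<And>x. (f has_derivative D x) (at x)" "\<And>v. smooth (\<lambda>x. D x v)"
    using smooth_derivative[OF assms] by blast
  have "D x = (*) (D x 1)" for x
  proof
    fix h
    show "D x h = D x 1 * h"
      using linear_scale[OF has_derivative_linear[OF D(1)], of x h 1] by simp
  qed
  then have "(f has_real_derivative D x 1) (at x)" for x
    using D(1)[of x] unfolding has_field_derivative_def by metis
  then show thesis using that[of "\<lambda>x. D x 1"] D(2)[of 1] by blast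
qed

context homoclinic
begin

text \<open>The connection of the unperturbed field runs along \<open>s \<mapsto> x\<^sub>0 + s d + crossing s (W - d)\<close>.
  It leaves \<open>x\<^sub>0\<close> in the unstable direction \<open>W\<close> and arrives straight at \<open>g x\<^sub>0\<close>. The linear
  functional \<open>\<tau>\<close> recovers the parameter \<open>s\<close>, and since the imaginary part of the curve is a multiple of
  \<open>W\<close>, the cut-off \<open>\<Theta>\<close>, which depends on imaginary parts only, separates the curve from its
  translates by elements outside \<open>K\<close>. Near both ends the field prescribed along the curve agrees
  with the linear one, so that it does not matter where \<open>\<Theta>\<close> drops to zero.\<close>

lemma base_field:
  obtains X L \<rho> a S \<kappa> where
    "\<And>h v. act h (X v) = X (act h v)" "vsmooth X" "0 \<le> L" "\<And>u v. norm (X u - X v) \<le> L * norm (u - v)"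
    "0 < \<rho>" "\<And>v. norm (v - x\<^sub>0) \<le> \<rho> \<Longrightarrow> X v = A (v - x\<^sub>0)"
    "0 < a" "a * norm W \<le> \<rho> / 4" "0 \<le> S" "\<kappa> 0 = x\<^sub>0 + a *\<^sub>R W" "norm (\<kappa> S - act g x\<^sub>0) \<le> \<rho> / 4"
    "\<And>t. 0 \<le> t \<Longrightarrow> t \<le> S \<Longrightarrow> (\<kappa> has_vector_derivative X (\<kappa> t)) (at t)"
proof -
  have WW: "0 < W \<bullet> W" and dd: "0 < d \<bullet> d" using W_nonzero d_nonzero by auto
  \<comment> \<open>\<open>2 * l \<le> 1 / 3\<close> confines the points with
    \<open>crossing s < 2 * l\<close> to the outer thirds; the second bound puts the corresponding
    curve points into the balls of radius 1/4 where \<open>X\<^sub>1\<close> is linear.\<close>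
  define l where "l = min (1 / 6) (1 / (8 * (norm W + norm (W - 2 *\<^sub>R d) + 1)))"
  have N: "0 < norm W + norm (W - 2 *\<^sub>R d) + 1" by (simp add: add_nonneg_pos)
  have l: "0 < l" "2 * l \<le> 1 / 3" using N by (auto simp: l_def)
  have lN: "2 * l * norm W \<le> 1 / 4" "2 * l * norm (W - 2 *\<^sub>R d) \<le> 1 / 4"
  proof -
    have "l \<le> 1 / (8 * (norm W + norm (W - 2 *\<^sub>R d) + 1))" by (simp add: l_def)
    then have "2 * l * (norm W + norm (W - 2 *\<^sub>R d) + 1) \<le> 1 / 4"
      using N by (simp add: field_simps)
    moreover have "2 * l * norm W \<le> 2 * l * (norm W + norm (W - 2 *\<^sub>R d) + 1)"
      "2 * l * norm (W - 2 *\<^sub>R d) \<le> 2 * l * (norm W + norm (W - 2 *\<^sub>R d) + 1)"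
      using l by (auto intro!: mult_left_mono)
    ultimately show "2 * l * norm W \<le> 1 / 4" "2 * l * norm (W - 2 *\<^sub>R d) \<le> 1 / 4" by linarith+
  qed
  obtain \<theta> where \<theta>: "0 < \<theta>" "\<And>h. h \<notin> K \<Longrightarrow> act h W \<bullet> W \<le> (1 - \<theta>) * (W \<bullet> W)"
    using W_separated by blast
  \<comment> \<open>Chosen so that \<open>x \<le> C * \<theta> * x * x + l\<close> for every
    \<open>x\<close>, which is \<open>(x - 2 * l)\<^sup>2 \<ge> 0\<close>.\<close>
  define C where "C = 1 / (4 * \<theta> * l)"
  have C: "0 < C" using \<theta> l by (simp add: C_def)
  obtain cr' where cr': "\<And>s. (crossing has_real_derivative cr' s) (at s)" "smooth cr'"
    using smooth_has_real_derivative[OF smooth_crossing] by blast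

  define lam where "lam v = (v \<bullet> W) / (W \<bullet> W)" for v :: "complex ^ 'g"
  \<comment> \<open>The bracket is the squared length, relative to \<open>W\<close>, of the part of
    \<open>imag v\<close> orthogonal to \<open>W\<close>. The penalty vanishes on the curve and
    pushes its translates below the threshold \<open>l\<close> at which \<open>\<Theta>\<close>
    becomes 0.\<close>
  define \<zeta> where "\<zeta> v = lam v - C * ((imag v \<bullet> imag v) / (W \<bullet> W) - lam v * lam v)" for v
  define \<Theta> where "\<Theta> v = smooth_step (\<zeta> v / l - 1)" for v
  \<comment> \<open>As \<open>d\<close> and \<open>W\<close> are orthogonal, the first summand
    yields \<open>s - crossing s\<close> on the curve, and \<open>lam\<close> yields
    \<open>crossing s\<close>.\<close>
  define \<tau> where "\<tau> v = ((v - x\<^sub>0) \<bullet> d) / (d \<bullet> d) + lam v" for v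
  define c where "c s = x\<^sub>0 + s *\<^sub>R d + crossing s *\<^sub>R (W - d)" for s
  define c' where "c' s = d + cr' s *\<^sub>R (W - d)" for s
  define Z where "Z v = crossing (\<tau> v) *\<^sub>R c' (\<tau> v)" for v
  define Z\<^sub>2 where "Z\<^sub>2 v = \<Theta> v *\<^sub>R (Z v - X\<^sub>1 v)" for v
  define X\<^sub>2 where "X\<^sub>2 v = X\<^sub>1 v + symmetrize K Z\<^sub>2 v" for v
  define R where "R = norm x\<^sub>0 + norm d + norm (W - d) + 1"
  have R: "0 < R" by (simp add: R_def add_nonneg_pos)
  \<comment> \<open>The outer cut-off gives compact support, hence a global Lipschitz constant;
    \<open>R\<close> is large enough for the curve and the ball around \<open>x\<^sub>0\<close> to
    be unaffected.\<close>
  define X where "X v = smooth_step (2 - (v \<bullet> v) / (R * R)) *\<^sub>R X\<^sub>2 v" for v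

  have act_X2: "act h (X\<^sub>2 v) = X\<^sub>2 (act h v)" for h v
    by (simp add: X\<^sub>2_def act_add act_X1 act_symmetrize)
  have act_X: "act h (X v) = X (act h v)" for h v
    by (simp add: X_def act_scaleR act_X2)
  have smooth_lam: "smooth lam"
    unfolding lam_def[abs_def] by (intro smooth_divide smooth_inner)
  have "vsmooth imag" by (rule vsmooth_linear[OF linear_imag vsmooth_id])
  then have "smooth \<zeta>"
    unfolding \<zeta>_def[abs_def] using smooth_lam
    by (intro smooth_diff smooth_cmult smooth_divide smooth_mult smooth_inner_vsmooth)
  then have smooth_\<Theta>: "smooth \<Theta>"
    unfolding \<Theta>_def[abs_def] by (intro smooth_smooth_step smooth_diff smooth_divide smooth_const)
  have smooth_\<tau>: "smooth \<tau>"
    unfolding \<tau>_def[abs_def] inner_diff_left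
    by (intro smooth_add smooth_lam smooth_divide smooth_diff smooth_inner smooth_const)
  have "vsmooth Z"
    unfolding Z_def[abs_def] c'_def
    by (intro vsmooth_scaleR vsmooth_add vsmooth_const smooth_compose_real[OF smooth_crossing smooth_\<tau>]
        smooth_compose_real[OF cr'(2) smooth_\<tau>])
  then have "vsmooth Z\<^sub>2"
    unfolding Z\<^sub>2_def[abs_def] by (intro vsmooth_scaleR vsmooth_diff smooth_\<Theta> vsmooth_X1)
  then have "vsmooth X\<^sub>2"
    unfolding X\<^sub>2_def[abs_def] by (intro vsmooth_add vsmooth_X1 vsmooth_symmetrize)
  moreover have "smooth (\<lambda>v :: complex ^ 'g. smooth_step (2 - (v \<bullet> v) / (R * R)))"
    by (intro smooth_smooth_step smooth_diff smooth_const smooth_divide smooth_inner_vsmooth vsmooth_id)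
  ultimately have vsmooth_X: "vsmooth X"
    unfolding X_def[abs_def] by (intro vsmooth_scaleR)
  have X_supp: "X v = 0" if "2 * R \<le> norm v" for v
  proof -
    have "(2 * R)\<^sup>2 \<le> (norm v)\<^sup>2" using that R by (intro power_mono) auto
    then have "4 * (R * R) \<le> v \<bullet> v" by (simp add: power2_norm_eq_inner) (simp add: power2_eq_square)
    moreover have RR: "0 < R * R" using R by simp
    ultimately have "2 * (R * R) \<le> v \<bullet> v" by linarith
    then have "2 \<le> (v \<bullet> v) / (R * R)" using RR by (simp only: pos_le_divide_eq)
    then show ?thesis by (simp add: X_def smooth_step_le_0)
  qed
  have X_in: "X v = X\<^sub>2 v" if "norm v \<le> R" for v
  proof -
    have "(norm v)\<^sup>2 \<le> R\<^sup>2" using that by (intro power_mono) auto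
    then have "v \<bullet> v \<le> R * R" by (simp add: power2_norm_eq_inner) (simp add: power2_eq_square)
    then have "(v \<bullet> v) / (R * R) \<le> 1" using R by (simp add: pos_divide_le_eq)
    then show ?thesis by (simp add: X_def smooth_step_ge_1)
  qed
  obtain L where L: "0 \<le> L" "\<And>u v. norm (X u - X v) \<le> L * norm (u - v)"
    using vsmooth_compact_support_Lipschitz[OF vsmooth_X X_supp] by blast

  have imag_ge: "lam v * lam v \<le> (imag v \<bullet> imag v) / (W \<bullet> W)" for v
  proof -
    have "v \<bullet> W = imag v \<bullet> W" using inner_imag[of v W] by (simp add: imag_W)
    then have "(v \<bullet> W)\<^sup>2 \<le> (imag v \<bullet> imag v) * (W \<bullet> W)" by (simp add: Cauchy_Schwarz_ineq)
    then show ?thesis using WW by (simp add: lam_def field_simps power2_eq_square)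
  qed
  \<comment> \<open>Within \<open>l * norm W\<close> of \<open>x\<^sub>0\<close> every translate
    \<open>act h v\<close> has \<open>lam\<close> at most \<open>l\<close>, so the correction
    \<open>Z\<^sub>2\<close> is absent.\<close>
  define \<rho> where "\<rho> = min (1 / 4) (l * norm W)"
  have \<rho>: "0 < \<rho>" using l W_nonzero by (simp add: \<rho>_def)
  have near: "X v = A (v - x\<^sub>0)" if v: "norm (v - x\<^sub>0) \<le> \<rho>" for v
  proof -
    have "Z\<^sub>2 (act h v) = 0" for h
    proof -
      have "act h v \<bullet> W = act h (v - x\<^sub>0) \<bullet> W"
        by (simp add: act_diff inner_diff_left inner_act_x0_W)
      also have "\<dots> \<le> norm (v - x\<^sub>0) * norm W" using norm_cauchy_schwarz[of "act h (v - x\<^sub>0)" W] by simp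
      also have "\<dots> \<le> (l * norm W) * norm W" using v by (intro mult_right_mono) (auto simp: \<rho>_def)
      also have "\<dots> = l * (W \<bullet> W)" by (simp add: power2_eq_square flip: power2_norm_eq_inner)
      finally have "lam (act h v) \<le> l" using WW by (simp add: lam_def pos_divide_le_eq)
      moreover have "\<zeta> (act h v) \<le> lam (act h v)" using imag_ge[of "act h v"] C by (simp add: \<zeta>_def)
      ultimately have "\<zeta> (act h v) / l - 1 \<le> 0" using l by (simp add: pos_divide_le_eq)
      then show ?thesis by (simp add: Z\<^sub>2_def \<Theta>_def smooth_step_le_0)
    qed
    then have "X\<^sub>2 v = X\<^sub>1 v" by (simp add: X\<^sub>2_def symmetrize_def act_0)
    moreover have "norm v \<le> R"
      using v norm_triangle_sub[of v x\<^sub>0] norm_ge_zero[of d] norm_ge_zero[of "W - d"]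
      unfolding R_def \<rho>_def by linarith
    moreover have "X\<^sub>1 v = A (v - x\<^sub>0)" using v by (intro X1_near_x0) (simp add: \<rho>_def)
    ultimately show ?thesis by (simp add: X_in)
  qed

  have lam_c: "lam (act h (c s)) = crossing s * ((act h W \<bullet> W) / (W \<bullet> W))" for h s
  proof -
    have "act h d \<bullet> W = 0" by (simp add: d_def act_diff inner_diff_left inner_act_x0_W flip: act_mult)
    then show ?thesis
      by (simp add: lam_def c_def act_add act_scaleR act_diff inner_add_left inner_diff_left inner_act_x0_W)
  qed
  have \<zeta>_c: "\<zeta> (act h (c s)) = lam (act h (c s)) - C * (crossing s * crossing s - lam (act h (c s)) * lam (act h (c s)))"
    for h s
  proof -
    have "imag (c s) = crossing s *\<^sub>R W"
      by (simp add: c_def linear_add[OF linear_imag] linear_diff[OF linear_imag]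
          linear_scale[OF linear_imag] imag_x0 imag_d imag_W)
    then show ?thesis using WW by (simp add: \<zeta>_def imag_act)
  qed
  have \<tau>_c: "\<tau> (c s) = s" for s
    using lam_c[of "\<one>\<^bsub>G\<^esub>" s] WW dd inner_d_W
    by (simp add: \<tau>_def c_def inner_add_left inner_diff_left inner_commute[of W d] left_diff_distrib)
       (simp add: add_divide_distrib diff_divide_distrib)
  have c_fix: "c s \<in> fix_space K" for s
    using x0_fix d_fix W_fix by (simp add: c_def act_add act_scaleR act_diff)

  have X_c: "X (c s) = crossing s *\<^sub>R c' s" if s: "0 < s" "s < 1" for s
  proof -
    have cr: "0 < crossing s" using crossing_ge[of "min s (1 - s)" s] s by auto
    have cr1: "crossing s \<le> 1"
      using convex_bound_le[of s 1 "1 - s" "1 - smooth_step (3 * s - 1)" "smooth_step (3 * s - 1)"]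
        smooth_step_bounds[of "3 * s - 1"] s by (simp add: crossing_def)
    have "norm (c s) \<le> norm x\<^sub>0 + norm (s *\<^sub>R d) + norm (crossing s *\<^sub>R (W - d))"
      unfolding c_def by (intro norm_triangle_mono norm_triangle_ineq order_refl)
    also have "\<dots> \<le> R"
      using s cr cr1 mult_left_le_one_le[of "norm d" s] mult_left_le_one_le[of "norm (W - d)" "crossing s"]
      by (simp add: R_def)
    finally have "X (c s) = X\<^sub>2 (c s)" by (rule X_in)
    also have "\<dots> = X\<^sub>1 (c s) + \<Theta> (c s) *\<^sub>R (Z (c s) - X\<^sub>1 (c s))"
      unfolding X\<^sub>2_def
    proof (rule arg_cong2[where f = "(+)", OF refl symmetrize_eq])
      show "K \<noteq> {}" using subgroup.one_closed[OF subgroup_K] by auto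
    next
      fix h assume h: "h \<in> K"
      then have "act (inv\<^bsub>G\<^esub> h) (c s) = c s"
        using c_fix subgroup.m_inv_closed[OF subgroup_K] by simp
      moreover have "act h (Z (c s)) = Z (c s)" using h W_fix d_fix
        by (simp add: Z_def c'_def act_scaleR act_add act_diff)
      moreover have "act h (X\<^sub>1 (c s)) = X\<^sub>1 (c s)" using h c_fix by (simp add: act_X1)
      ultimately show "act h (Z\<^sub>2 (act (inv\<^bsub>G\<^esub> h) (c s))) = \<Theta> (c s) *\<^sub>R (Z (c s) - X\<^sub>1 (c s))"
        by (simp add: Z\<^sub>2_def act_scaleR act_diff)
    next
      fix h assume "h \<notin> K"
      then have h: "inv\<^bsub>G\<^esub> h \<notin> K" using subgroup.m_inv_closed[OF subgroup_K] by force
      \<comment> \<open>The cosine of the angle between the translate of \<open>W\<close> and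
        \<open>W\<close>. At the translated point \<open>\<zeta>\<close> is
        \<open>crossing s * q - C * (crossing s)\<^sup>2 * (1 - q\<^sup>2)\<close>: nonpositive for
        \<open>q \<le> 0\<close>, and otherwise at most \<open>l\<close> by
        \<open>1 - q\<^sup>2 \<ge> \<theta>\<close> and the choice of \<open>C\<close>.\<close>
      define q where "q = (act (inv\<^bsub>G\<^esub> h) W \<bullet> W) / (W \<bullet> W)"
      have q: "q \<le> 1 - \<theta>" using \<theta>(2)[OF h] WW by (simp add: q_def pos_divide_le_eq)
      have "norm (act (inv\<^bsub>G\<^esub> h) W) * norm W = W \<bullet> W"
        by (simp add: power2_eq_square flip: power2_norm_eq_inner)
      then have q1: "- 1 \<le> q"
        using Cauchy_Schwarz_ineq2[of "act (inv\<^bsub>G\<^esub> h) W" W] WW by (simp add: q_def pos_le_divide_eq)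
      have lam: "lam (act (inv\<^bsub>G\<^esub> h) (c s)) = crossing s * q" by (simp add: lam_c q_def)
      have "\<zeta> (act (inv\<^bsub>G\<^esub> h) (c s)) \<le> l"
      proof (cases "q \<le> 0")
        case True
        have pq: "0 \<le> (1 - q) * (1 + q)" using True q1 by (intro mult_nonneg_nonneg) auto
        have "0 \<le> C * (crossing s * crossing s * ((1 - q) * (1 + q)))"
          using mult_nonneg_nonneg[OF mult_nonneg_nonneg[OF less_imp_le[OF cr] less_imp_le[OF cr]] pq] C
          by (simp only: mult_nonneg_nonneg less_imp_le)
        moreover have "crossing s * q \<le> 0" using cr True by (simp add: mult_nonneg_nonpos)
        ultimately show ?thesis using l by (simp add: \<zeta>_c lam algebra_simps)
      next
        case False
        have "\<theta> \<le> (1 - q) * (1 + q)"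
          using False q \<theta>(1) mult_mono[of \<theta> "1 - q" 1 "1 + q"] by simp
        then have "C * (crossing s * crossing s * \<theta>) \<le> C * (crossing s * crossing s * ((1 - q) * (1 + q)))"
          using C cr by (intro mult_left_mono) auto
        moreover have "crossing s * q \<le> crossing s" using cr q \<theta>(1) by (simp add: mult_left_le)
        moreover have "crossing s \<le> C * (crossing s * crossing s * \<theta>) + l"
        proof -
          have "0 \<le> (crossing s - 2 * l)\<^sup>2" by simp
          then have "crossing s * (4 * l) \<le> crossing s * crossing s + l * (4 * l)"
            by (simp add: power2_eq_square algebra_simps)
          then have "crossing s \<le> (crossing s * crossing s + l * (4 * l)) / (4 * l)"
            using l by (simp add: pos_le_divide_eq)
          then show ?thesis using l \<theta> by (simp add: C_def add_divide_distrib)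
        qed
        ultimately show ?thesis by (simp add: \<zeta>_c lam algebra_simps)
      qed
      then have "\<zeta> (act (inv\<^bsub>G\<^esub> h) (c s)) / l - 1 \<le> 0" using l by (simp add: pos_divide_le_eq)
      then show "Z\<^sub>2 (act (inv\<^bsub>G\<^esub> h) (c s)) = 0" by (simp add: Z\<^sub>2_def \<Theta>_def smooth_step_le_0)
    qed
    also have "\<dots> = Z (c s)"
    proof (cases "2 * l \<le> crossing s")
      case True
      have "\<zeta> (c s) = crossing s"
        using \<zeta>_c[of "\<one>\<^bsub>G\<^esub>" s] lam_c[of "\<one>\<^bsub>G\<^esub>" s] WW by simp
      then have "\<Theta> (c s) = 1" using True l by (simp add: \<Theta>_def smooth_step_ge_1 pos_le_divide_eq)
      then show ?thesis by simp
    next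
      case False
      have "X\<^sub>1 (c s) = Z (c s)"
      proof (cases "s < 1 / 3")
        case True
        have "(crossing has_real_derivative 1) (at s)"
          by (rule has_field_derivative_transform_within_open[OF DERIV_ident, of "{..<1/3}"])
             (use True crossing_start in auto)
        then have "cr' s = 1" by (rule DERIV_unique[OF cr'(1)])
        then have Z: "Z (c s) = s *\<^sub>R W" using True by (simp add: Z_def \<tau>_c c'_def crossing_start)
        have c: "c s - x\<^sub>0 = s *\<^sub>R W" using True by (simp add: c_def crossing_start algebra_simps)
        have "s * norm W \<le> 2 * l * norm W" using False True by (intro mult_right_mono) (auto simp: crossing_start)
        then have "norm (c s - x\<^sub>0) \<le> 1 / 4" using lN(1) s by (simp add: c)
        then have "X\<^sub>1 (c s) = A (s *\<^sub>R W)" using X1_near_x0 c by metis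
        also have "\<dots> = s *\<^sub>R W"
          by (simp only: A_def linear_scale[OF linear_P] P_W) (simp only: scaleR_2 add_diff_cancel_right')
        finally show ?thesis using Z by simp
      next
        case not_start: False
        have "2 / 3 < s"
          using crossing_ge[of "1 / 3" s] not_start False l by linarith
        then have cr_end: "crossing s = 1 - s" by (simp add: crossing_end)
        have "(crossing has_real_derivative 0 - 1) (at s)"
          by (rule has_field_derivative_transform_within_open[OF DERIV_diff[OF DERIV_const[of 1] DERIV_ident],
                of "{2/3<..}"])
             (use \<open>2 / 3 < s\<close> crossing_end in auto)
        then have "cr' s = - 1" using DERIV_unique[OF cr'(1)[of s]] by simp
        then have Z: "Z (c s) = (1 - s) *\<^sub>R (2 *\<^sub>R d - W)"
          by (simp only: Z_def \<tau>_c c'_def cr_end) (rule euclidean_eqI,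
            simp only: inner_add_left inner_diff_left inner_scaleR_left, simp add: \<open>cr' s = - 1\<close> algebra_simps)
        have c: "c s - act g x\<^sub>0 = (1 - s) *\<^sub>R (W - 2 *\<^sub>R d)"
          unfolding c_def cr_end
          by (rule euclidean_eqI) (simp only: d_def inner_diff_left inner_add_left inner_scaleR_left, simp add: algebra_simps)
        have "(1 - s) * norm (W - 2 *\<^sub>R d) \<le> 2 * l * norm (W - 2 *\<^sub>R d)"
          using False cr_end by (intro mult_right_mono) auto
        then have "norm (c s - act g x\<^sub>0) \<le> 1 / 4" using lN(2) s unfolding c norm_scaleR by simp
        then have "X\<^sub>1 (c s) = act g x\<^sub>0 - c s"
          using c_fix by (intro sink_near_gx0[where r = "1 / 4"] act_X1 X1_near_x0)
        also have "\<dots> = - ((1 - s) *\<^sub>R (W - 2 *\<^sub>R d))" unfolding c[symmetric] by simp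
        also have "\<dots> = Z (c s)" unfolding Z by (simp flip: scaleR_minus_right)
        finally show ?thesis .
      qed
      then show ?thesis by simp
    qed
    also have "\<dots> = crossing s *\<^sub>R c' s" by (simp add: Z_def \<tau>_c)
    finally show ?thesis .
  qed

  \<comment> \<open>\<open>crossing\<close> vanishes at 0 and 1, so the full passage takes infinite
    time. Only the segment from \<open>a\<close> to \<open>b\<close> is used, with ends within
    \<open>\<rho> / 4\<close> of the equilibria.\<close>
  define a where "a = min (1 / 4) (\<rho> / (4 * (norm W + 1)))"
  have NW: "0 < norm W + 1" "0 < norm (W - 2 *\<^sub>R d) + 1" by (simp_all add: add_nonneg_pos)
  have cancel: "\<rho> / (4 * n) * n = \<rho> / 4" if "0 < n" for n using that by simp
  have a: "0 < a" "a \<le> 1 / 4" "a * norm W \<le> \<rho> / 4"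
  proof -
    have "a * norm W \<le> \<rho> / (4 * (norm W + 1)) * (norm W + 1)"
      using \<rho> NW by (intro mult_mono) (auto simp: a_def)
    then show "a * norm W \<le> \<rho> / 4" by (simp only: cancel[OF NW(1)])
    show "0 < a" using \<rho> NW(1) unfolding a_def by (simp only: min_less_iff_conj) simp
    show "a \<le> 1 / 4" unfolding a_def by (rule min.cobounded1)
  qed
  define b where "b = 1 - min (1 / 4) (\<rho> / (4 * (norm (W - 2 *\<^sub>R d) + 1)))"
  have b: "3 / 4 \<le> b" "b < 1" "(1 - b) * norm (W - 2 *\<^sub>R d) \<le> \<rho> / 4"
  proof -
    have "(1 - b) * norm (W - 2 *\<^sub>R d) \<le> \<rho> / (4 * (norm (W - 2 *\<^sub>R d) + 1)) * (norm (W - 2 *\<^sub>R d) + 1)"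
      using \<rho> NW by (intro mult_mono) (auto simp: b_def)
    then show "(1 - b) * norm (W - 2 *\<^sub>R d) \<le> \<rho> / 4" by (simp only: cancel[OF NW(2)])
    have "0 < min (1 / 4) (\<rho> / (4 * (norm (W - 2 *\<^sub>R d) + 1)))"
      using \<rho> NW(2) by (simp only: min_less_iff_conj) simp
    moreover have "min (1 / 4) (\<rho> / (4 * (norm (W - 2 *\<^sub>R d) + 1))) \<le> 1 / 4" by (rule min.cobounded1)
    ultimately show "3 / 4 \<le> b" "b < 1" unfolding b_def by linarith+
  qed
  obtain S s where S: "0 \<le> S" and s: "s 0 = a" "s S = b"
    "\<And>t. 0 \<le> t \<Longrightarrow> t \<le> S \<Longrightarrow> a \<le> s t \<and> s t \<le> b \<and> (s has_real_derivative crossing (s t)) (at t)"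
  proof (rule autonomous_connection[of "a / 2" a b "(1 + b) / 2" crossing])
    show "continuous_on {a / 2..(1 + b) / 2} crossing" by (rule smooth_continuous_on[OF smooth_crossing])
    fix x assume x: "a / 2 \<le> x" "x \<le> (1 + b) / 2"
    then have "0 < min x (1 - x)" using a b by auto
    also have "\<dots> \<le> crossing x" by (rule crossing_ge) auto
    finally show "0 < crossing x" .
  qed (use a b in auto)
  show thesis
  proof (rule that[OF act_X vsmooth_X L \<rho> near a(1,3) S, of "\<lambda>t. c (s t)"])
    show "c (s 0) = x\<^sub>0 + a *\<^sub>R W"
      using a by (simp add: s c_def crossing_start algebra_simps)
    have "c b - act g x\<^sub>0 = (1 - b) *\<^sub>R (W - 2 *\<^sub>R d)"
    proof -
      have cr_b: "crossing b = 1 - b" using b by (intro crossing_end) auto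
      show ?thesis unfolding c_def cr_b
        by (rule euclidean_eqI) (simp only: d_def inner_diff_left inner_add_left inner_scaleR_left, simp add: algebra_simps)
    qed
    then show "norm (c (s S) - act g x\<^sub>0) \<le> \<rho> / 4" using b unfolding s by simp
  next
    fix t assume t: "0 \<le> t" "t \<le> S"
    have "(c has_vector_derivative 0 + (s t *\<^sub>R 0 + 1 *\<^sub>R d)
        + (crossing (s t) *\<^sub>R 0 + cr' (s t) *\<^sub>R (W - d))) (at (s t))"
      unfolding c_def[abs_def]
      by (intro has_vector_derivative_add has_vector_derivative_const has_vector_derivative_scaleR
          cr'(1) DERIV_ident)
    then have "(c has_vector_derivative c' (s t)) (at (s t))" by (simp add: c'_def)
    moreover have "(s has_vector_derivative crossing (s t)) (at t)"
      using s(3)[OF t] by (simp add: has_real_derivative_iff_has_vector_derivative)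
    ultimately have "(c \<circ> s has_vector_derivative crossing (s t) *\<^sub>R c' (s t)) (at t)"
      by (rule vector_diff_chain_at[rotated])
    moreover have "0 < s t" "s t < 1" using s(3)[OF t] a b by auto
    ultimately show "((\<lambda>t. c (s t)) has_vector_derivative X (c (s t))) (at t)"
      by (simp add: X_c o_def)
  qed
qed

end

section \<open>Persistence of the connection\<close>

text \<open>If \<open>L\<close> had an eigenvector \<open>u + iv\<close> with eigenvalue on the imaginary axis, then
  \<open>B u \<bullet> L u + B v \<bullet> L v\<close> would vanish, although \<open>B v \<bullet> L v\<close> is comparable to the square of
  the norm of \<open>v\<close>.\<close>

lemma spectrum_off_imaginary_axis:
  fixes B L :: "'a::euclidean_space \<Rightarrow> 'a"
  assumes sym: "\<And>u v. B u \<bullet> v = u \<bullet> B v" and iso: "\<And>v. norm (B v) = norm v"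
    and near: "\<And>v. norm (L v - B v) \<le> 1 / 2 * norm v" and ev: "complexified_eigenvalue L z"
  shows "Re z \<noteq> 0"
proof
  assume "Re z = 0"
  then obtain u v where uv: "u \<noteq> 0 \<or> v \<noteq> 0" "L u = - Im z *\<^sub>R v" "L v = Im z *\<^sub>R u"
    using ev by (auto simp: complexified_eigenvalue_def)
  have pos: "1 / 2 * (w \<bullet> w) \<le> B w \<bullet> L w" for w
  proof -
    have "- (B w \<bullet> (L w - B w)) \<le> norm w * norm (L w - B w)"
      using Cauchy_Schwarz_ineq2[of "B w" "L w - B w"] by (simp add: iso)
    also have "\<dots> \<le> norm w * (1 / 2 * norm w)" by (intro mult_left_mono near) simp
    also have "\<dots> = 1 / 2 * (w \<bullet> w)" by (simp add: power2_eq_square flip: power2_norm_eq_inner)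
    finally have "- (B w \<bullet> L w) + B w \<bullet> B w \<le> 1 / 2 * (w \<bullet> w)" by (simp add: inner_diff_right)
    moreover have "B w \<bullet> B w = w \<bullet> w" using iso[of w] by (simp add: norm_eq)
    ultimately show ?thesis by linarith
  qed
  have "B u \<bullet> L u + B v \<bullet> L v = Im z * (B v \<bullet> u - B u \<bullet> v)" by (simp add: uv algebra_simps)
  also have "B v \<bullet> u = B u \<bullet> v" by (metis sym inner_commute)
  finally have "B u \<bullet> L u + B v \<bullet> L v = 0" by simp
  then have "u \<bullet> u + v \<bullet> v \<le> 0" using pos[of u] pos[of v] by linarith
  then show False using uv(1) by (metis add_nonneg_eq_0_iff inner_eq_zero_iff inner_ge_zero
      order_antisym_conv add_nonneg_nonneg)
qed

section \<open>Closeness of first derivatives\<close>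

lemma Cr_fields_differentiable:
  fixes X :: "'a::euclidean_space \<Rightarrow> 'a"
  assumes "X \<in> Cr_fields r" "1 \<le> r" shows "X differentiable (at x)"
proof -
  have "enat (length ([] :: 'a list)) < r"
    using less_le_trans[OF zero_less_one assms(2)] by (simp add: zero_enat_def)
  then have "iter_deriv X [] differentiable (at x)" using assms(1) unfolding Cr_fields_def by blast
  then show ?thesis by simp
qed

lemma Ck_near_triangle:
  fixes X Y Z :: "'a::euclidean_space \<Rightarrow> 'a"
  assumes "Y \<in> Ck_near k (\<lambda>_. \<epsilon>) X" "Z \<in> Ck_near k (\<lambda>_. \<delta>) Y"
  shows "Z \<in> Ck_near k (\<lambda>_. \<epsilon> + \<delta>) X"
  unfolding Ck_near_def
proof (intro CollectI allI impI)
  fix vs :: "'a list" and x assume vs: "length vs \<le> k" "\<forall>v\<in>set vs. norm v \<le> 1"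
  have "norm (iter_deriv Y vs x - iter_deriv X vs x) < \<epsilon>" "norm (iter_deriv Z vs x - iter_deriv Y vs x) < \<delta>"
    using assms vs unfolding Ck_near_def by blast+
  then show "norm (iter_deriv Z vs x - iter_deriv X vs x) < \<epsilon> + \<delta>"
    using norm_triangle_ineq[of "iter_deriv Z vs x - iter_deriv Y vs x" "iter_deriv Y vs x - iter_deriv X vs x"]
    by simp
qed

lemma Ck_near_1D:
  fixes X Y :: "'a::euclidean_space \<Rightarrow> 'a"
  assumes near: "Y \<in> Ck_near 1 (\<lambda>_. \<epsilon>) X"
    and diff: "\<And>x. X differentiable (at x)" "\<And>x. Y differentiable (at x)"
  shows "norm (Y x - X x) \<le> \<epsilon>"
    and "norm (frechet_derivative Y (at x) v - frechet_derivative X (at x) v) \<le> \<epsilon> * norm v"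
proof -
  have *: "norm (iter_deriv Y vs x - iter_deriv X vs x) < \<epsilon>" if "length vs \<le> 1" "\<forall>v\<in>set vs. norm v \<le> 1" for vs
    using near that unfolding Ck_near_def by blast
  show "norm (Y x - X x) \<le> \<epsilon>" using *[of "[]"] by simp
  let ?D = "\<lambda>v. frechet_derivative Y (at x) v - frechet_derivative X (at x) v"
  have lin: "linear ?D"
    using diff by (intro linear_compose_sub linear_frechet_derivative)
  show "norm (?D v) \<le> \<epsilon> * norm v"
  proof (cases "v = 0")
    case True
    then show ?thesis using linear_0[OF lin] by simp
  next
    case False
    have "norm (?D ((1 / norm v) *\<^sub>R v)) \<le> \<epsilon>" using *[of "[(1 / norm v) *\<^sub>R v]"] False by simp
    moreover have "?D ((1 / norm v) *\<^sub>R v) = (1 / norm v) *\<^sub>R ?D v" by (rule linear_scale[OF lin])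
    ultimately have "norm ((1 / norm v) *\<^sub>R ?D v) \<le> \<epsilon>" by (simp only:)
    then have "norm (?D v) / norm v \<le> \<epsilon>" by (simp only: norm_scaleR) simp
    then show ?thesis using False by (simp add: pos_divide_le_eq)
  qed
qed

section \<open>The perturbed connection and its isotropy\<close>

context homoclinic
begin

lemma trajectory_act:
  assumes "\<And>h v. act h (Y v) = Y (act h v)" "trajectory Y \<gamma>"
  shows "trajectory Y (\<lambda>t. act h (\<gamma> t))"
  using assms bounded_linear.has_vector_derivative[OF bounded_linear_act[of h]]
  unfolding trajectory_def by metis

lemma norm_avg_le: "norm (avg G K v) \<le> norm v"
proof -
  have "norm (\<Sum>n\<in>K. act n v) \<le> real (card K) * norm v"
    by (rule sum_norm_bound) simp
  moreover have "0 < real (card K)" using subgroup.one_closed[OF subgroup_K] by (auto simp: card_gt_0_iff)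
  ultimately show ?thesis by (simp add: avg_def field_simps)
qed

lemma fix_space_K_iff: "avg G K v = v \<longleftrightarrow> v \<in> fix_space K"
  using avg_in_fix_space[OF subgroup_K, of v] avg_fixed[OF subgroup_K, of v] by auto

text \<open>Everything rests on \<open>N = Y - X\<close> being bounded by \<open>\<epsilon>\<close>
  and \<open>\<epsilon>\<close>-Lipschitz. The tolerance can be fixed in advance because Gronwall's
  factor is needed only for the fixed time \<open>S\<close>.\<close>

lemma persistent_connection:
  assumes act_X: "\<And>h v. act h (X v) = X (act h v)" and X_diff: "\<And>v. X differentiable (at v)"
    and L: "0 \<le> L" "\<And>u v. norm (X u - X v) \<le> L * norm (u - v)"
    and \<rho>: "0 < \<rho>" and lin: "\<And>v. norm (v - x\<^sub>0) \<le> \<rho> \<Longrightarrow> X v = A (v - x\<^sub>0)"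
    and a: "0 < a" "a * norm W \<le> \<rho> / 4"
    and S: "0 \<le> S" and \<kappa>: "\<kappa> 0 = x\<^sub>0 + a *\<^sub>R W" "norm (\<kappa> S - act g x\<^sub>0) \<le> \<rho> / 4"
      "\<And>t. 0 \<le> t \<Longrightarrow> t \<le> S \<Longrightarrow> (\<kappa> has_vector_derivative X (\<kappa> t)) (at t)"
  obtains \<epsilon> where "0 < \<epsilon>"
    "\<And>Y. (\<And>v. Y differentiable (at v)) \<Longrightarrow> (\<And>h v. act h (Y v) = Y (act h v)) \<Longrightarrow>
      (\<And>v. norm (Y v - X v) \<le> \<epsilon>) \<Longrightarrow>
      (\<And>v w. norm (frechet_derivative Y (at v) w - frechet_derivative X (at v) w) \<le> \<epsilon> * norm w) \<Longrightarrow>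
      \<exists>X\<^sub>0 \<gamma>. normally_hyperbolic_rel_equilibrium G Y X\<^sub>0 \<and> relative_homoclinic_trajectory Y X\<^sub>0 \<gamma> \<and>
        has_isotropy G K \<gamma> \<and> has_twist G g \<gamma>"
proof -
  define \<eta> where "\<eta> = a *\<^sub>R W"
  have P\<eta>: "P \<eta> = \<eta>" by (simp add: \<eta>_def linear_scale[OF linear_P] P_W)
  have avg\<eta>: "avg G K \<eta> = \<eta>" using avg_P(1)[of \<eta>] by (simp add: P\<eta>)
  have \<eta>: "0 < norm \<eta>" "norm \<eta> \<le> \<rho> / 4" using a W_nonzero by (auto simp: \<eta>_def)
  define p where "p = x\<^sub>0 + \<eta>"
  have p_isotropy: "h \<in> K" if "act h p = p" for h
  proof -
    have "imag p = \<eta>"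
      by (simp add: p_def \<eta>_def linear_add[OF linear_imag] linear_scale[OF linear_imag] imag_x0 imag_W)
    then have "act h \<eta> = \<eta>" using imag_act[of h p] that by simp
    then have "act h W = W" using a by (simp add: \<eta>_def act_scaleR)
    then show ?thesis by (rule W_isotropy)
  qed
  \<comment> \<open>Elements outside \<open>K\<close> move \<open>p\<close> by at least
    \<open>\<delta>\<close>; a point closer to \<open>p\<close> than \<open>\<delta> / 2\<close>
    therefore has no isotropy outside \<open>K\<close>.\<close>
  define \<delta> where "\<delta> = Min (insert 1 ((\<lambda>h. norm (act h p - p)) ` (- K)))"
  have \<delta>: "0 < \<delta>" using p_isotropy by (auto simp: \<delta>_def)
  have \<delta>_le: "\<delta> \<le> norm (act h p - p)" if "h \<notin> K" for h
    unfolding \<delta>_def by (rule Min_le) (use that in auto)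
  \<comment> \<open>The orbit passes within \<open>\<epsilon> * M\<close> of \<open>p\<close> at
    time 0: \<open>\<epsilon>\<close> for the shift of the equilibrium,
    \<open>2 * \<epsilon> * norm \<eta>\<close> for the stable part of the orbit.\<close>
  define M where "M = 1 + 2 * norm \<eta>"
  define E where "E = (M\<^sup>2 + 1) * exp ((2 * L + 1) * S)"
  have M: "1 \<le> M" by (simp add: M_def)
  have E: "1 \<le> E"
    unfolding E_def using mult_mono[of 1 "M\<^sup>2 + 1" 1 "exp ((2 * L + 1) * S)"] L S by simp
  \<comment> \<open>In order: the bound of \<open>unstable_orbit\<close>; nearness of the new
    equilibria to the old; a deviation of at most \<open>\<rho> / 8\<close> at time
    \<open>S\<close>, together with the second bound; and twice the deviation from \<open>p\<close>
    below \<open>\<delta>\<close>.\<close>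
  define \<epsilon> where "\<epsilon> = Min {1 / 12, \<rho> / 16, \<rho> / (8 * E), \<delta> / (4 * M)}"
  have \<epsilon>: "0 < \<epsilon>" "\<epsilon> \<le> 1 / 12" "\<epsilon> \<le> \<rho> / 16" "\<epsilon> \<le> \<rho> / (8 * E)" "\<epsilon> \<le> \<delta> / (4 * M)"
    using \<rho> \<delta> M E by (simp_all add: \<epsilon>_def)
  show thesis
  proof (rule that[OF \<epsilon>(1)])
    fix Y assume Y_diff: "\<And>v. Y differentiable (at v)" and act_Y: "\<And>h v. act h (Y v) = Y (act h v)"
      and near0: "\<And>v. norm (Y v - X v) \<le> \<epsilon>"
      and near1: "\<And>v w. norm (frechet_derivative Y (at v) w - frechet_derivative X (at v) w) \<le> \<epsilon> * norm w"
    define N where "N v = Y v - X v" for v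
    have act_N: "act h (N v) = N (act h v)" for h v by (simp add: N_def act_diff act_X act_Y)
    have N_le: "norm (N v) \<le> \<epsilon>" for v using near0 by (simp add: N_def)
    have N_Lip: "norm (N u - N v) \<le> \<epsilon> * norm (u - v)" for u v
    proof (rule differentiable_bound[of UNIV N "\<lambda>x w. frechet_derivative Y (at x) w - frechet_derivative X (at x) w"])
      show "(N has_derivative (\<lambda>w. frechet_derivative Y (at x) w - frechet_derivative X (at x) w)) (at x within UNIV)" for x
        unfolding N_def using X_diff Y_diff by (intro has_derivative_diff) (simp_all add: frechet_derivative_works)
      show "onorm (\<lambda>w. frechet_derivative Y (at x) w - frechet_derivative X (at x) w) \<le> \<epsilon>" for x
        by (rule onorm_le) (rule near1)
    qed auto
    have Y_eq: "Y v = X v + N v" for v by (simp add: N_def)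
    have Y_Lip: "norm (Y u - Y v) \<le> (L + \<epsilon>) * norm (u - v)" for u v
    proof -
      have "norm (Y u - Y v) \<le> norm (X u - X v) + norm (N u - N v)"
        using norm_triangle_ineq[of "X u - X v" "N u - N v"] by (simp add: Y_eq algebra_simps)
      then show ?thesis using L(2)[of u v] N_Lip[of u v] by (simp add: algebra_simps)
    qed
    have L\<epsilon>: "0 \<le> L + \<epsilon>" using L \<epsilon> by simp
    note unique = trajectory_unique[OF Y_Lip L\<epsilon>]

    \<comment> \<open>As \<open>A\<close> is its own inverse,
      \<open>A (y - x\<^sub>0) + N y = 0\<close> is this fixed point equation. Its solution is
      unique, hence fixed by \<open>H\<close> like the equation itself.\<close>
    have ex1: "\<exists>!y. x\<^sub>0 - A (N y) = y"
    proof (rule banach_fix_type[of \<epsilon>]; (intro allI)?)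
      show "dist (x\<^sub>0 - A (N u)) (x\<^sub>0 - A (N v)) \<le> \<epsilon> * dist u v" for u v
        using N_Lip[of v u] by (simp add: dist_norm norm_A norm_minus_commute flip: linear_diff[OF linear_A])
    qed (use \<epsilon> in auto)
    then obtain y where y: "x\<^sub>0 - A (N y) = y" by blast
    have y_x0: "norm (y - x\<^sub>0) \<le> \<epsilon>"
    proof -
      have "y - x\<^sub>0 = - A (N y)" using y by (simp add: algebra_simps)
      then show ?thesis using N_le[of y] by (simp add: norm_A)
    qed
    have A_y: "A (y - x\<^sub>0) = - N y"
    proof -
      have "y - x\<^sub>0 = - A (N y)" using y by (simp add: algebra_simps)
      then show ?thesis by (simp add: linear_neg[OF linear_A] A_A)
    qed
    have "norm (y - x\<^sub>0) \<le> \<rho>" using y_x0 \<epsilon> \<rho> by linarith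
    then have Y_y: "Y y = 0" by (simp add: Y_eq lin A_y)
    have act_y: "act h y = y" if h: "h \<in> H" for h
    proof -
      have "act h (x\<^sub>0 - A (N y)) = act h y" using y by simp
      then have "x\<^sub>0 - A (N (act h y)) = act h y"
        using h by (simp add: act_diff act_x0 act_A act_N)
      then show ?thesis using ex1 y by blast
    qed
    have y_fix: "y \<in> fix_space K" using act_y K_subset_H by auto
    have gy_fix: "act g y \<in> fix_space K"
      using act_y K'_subset_H by (subst fix_K_translate[symmetric]) auto
    have Y_gy: "Y (act h y) = 0" for h using act_Y[of h y] by (simp add: Y_y act_0)
    have gy_gx0: "norm (act h y - act h x\<^sub>0) \<le> \<epsilon>" for h
      using y_x0 by (simp flip: act_diff)

    \<comment> \<open>Averaging inside \<open>N\<close> makes \<open>F\<close> take values in the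
      fixed space of \<open>K\<close> for every argument, as the invariance hypothesis on
      \<open>Q\<close> demands. On the orbit obtained, \<open>Q (D t) = 0\<close> makes the
      averaging invisible.\<close>
    define F where "F D = N (y + avg G K D) - N y" for D
    define Q where "Q v = v - avg G K v" for v
    have "bounded_linear P" using linear_P linear_conv_bounded_linear by blast
    moreover have "bounded_linear Q"
      unfolding Q_def[abs_def] using linear_avg[of K] linear_conv_bounded_linear
      by (intro bounded_linear_sub bounded_linear_ident) blast
    moreover have "Q (P x) = P (Q x)" for x
      by (simp add: Q_def linear_diff[OF linear_P] avg_P)
    moreover have "Q (F x) = 0" for x
    proof -
      have "y + avg G K x \<in> fix_space K"
        using y_fix avg_in_fix_space[OF subgroup_K] by (simp add: act_add)
      then have "F x \<in> fix_space K" using y_fix by (simp add: F_def act_diff act_N)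
      then show ?thesis using avg_fixed[OF subgroup_K, of "F x"] by (simp add: Q_def)
    qed
    moreover have "Q \<eta> = 0" by (simp add: Q_def avg\<eta>)
    moreover have "norm (F u - F v) \<le> \<epsilon> * norm (u - v)" for u v
    proof -
      have "norm (F u - F v) \<le> \<epsilon> * norm (avg G K (u - v))"
        using N_Lip[of "y + avg G K u" "y + avg G K v"] by (simp add: F_def linear_diff[OF linear_avg])
      also have "\<dots> \<le> \<epsilon> * norm (u - v)" using \<epsilon> by (intro mult_left_mono norm_avg_le) auto
      finally show ?thesis .
    qed
    moreover have "F 0 = 0" by (simp add: F_def linear_0[OF linear_avg])
    ultimately obtain D where D:
      "\<And>t. t \<le> 0 \<Longrightarrow> (D has_vector_derivative 2 *\<^sub>R P (D t) - D t + F (D t)) (at t)"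
      "\<And>t. t \<le> 0 \<Longrightarrow> norm (D t) \<le> 2 * norm \<eta> * exp (t / 2)"
      "norm (D 0 - \<eta>) \<le> 2 * \<epsilon> * norm \<eta>" "\<And>t. t \<le> 0 \<Longrightarrow> Q (D t) = 0"
      using unstable_orbit[of P F \<epsilon> \<eta> Q thesis] P_P norm_P_le P\<eta> \<epsilon> by (metis less_imp_le)
    have u_deriv: "((\<lambda>t. y + D t) has_vector_derivative Y (y + D t)) (at t)" if t: "t \<le> 0" for t
    proof -
      have "norm (D t) \<le> 2 * norm \<eta> * 1"
        by (rule order_trans[OF D(2)[OF t] mult_left_mono]) (use t in auto)
      then have "norm (y + D t - x\<^sub>0) \<le> \<rho>"
        using norm_triangle_ineq[of "y - x\<^sub>0" "D t"] y_x0 \<epsilon> \<eta> \<rho> by (simp add: algebra_simps)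
      then have "X (y + D t) = A (D t + (y - x\<^sub>0))" by (simp add: lin algebra_simps)
      also have "\<dots> = A (D t) - N y" by (simp only: linear_add[OF linear_A] A_y) simp
      finally have "Y (y + D t) = 2 *\<^sub>R P (D t) - D t + F (D t)"
        using D(4)[OF t] by (simp add: Y_eq A_def F_def Q_def)
      then show ?thesis using D(1)[OF t] has_vector_derivative_add[OF has_vector_derivative_const D(1)[OF t]]
        by simp
    qed
    obtain v where v: "v 0 = y + D 0" "\<And>t. 0 \<le> t \<Longrightarrow> (v has_vector_derivative Y (v t)) (at t)"
      using forward_solution[OF Y_Lip L\<epsilon>] by blast
    define \<gamma> where "\<gamma> t = (if t \<le> 0 then y + D t else v t)" for t
    have \<gamma>: "trajectory Y \<gamma>"
      unfolding \<gamma>_def[abs_def] by (rule trajectory_glue) (use u_deriv v in auto)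
    have \<gamma>0: "norm (\<gamma> 0 - p) \<le> \<epsilon> * M"
    proof -
      have "norm (\<gamma> 0 - p) \<le> norm (y - x\<^sub>0) + norm (D 0 - \<eta>)"
        using norm_triangle_ineq[of "y - x\<^sub>0" "D 0 - \<eta>"] by (simp add: \<gamma>_def p_def algebra_simps)
      then show ?thesis using y_x0 D(3) by (simp add: M_def algebra_simps)
    qed
    have lim_bot: "(\<gamma> \<longlongrightarrow> y) at_bot"
    proof (rule Lim_transform_eventually)
      have "((\<lambda>t. 2 * norm \<eta> * exp (t / 2)) \<longlongrightarrow> 0) at_bot" by real_asymp
      then have "(D \<longlongrightarrow> 0) at_bot"
        by (rule Lim_null_comparison[rotated]) (use D(2) in \<open>auto intro: eventually_at_bot_linorderI[of 0]\<close>)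
      then show "((\<lambda>t. y + D t) \<longlongrightarrow> y) at_bot" using tendsto_add[OF tendsto_const, of D 0 at_bot y] by simp
      show "\<forall>\<^sub>F t in at_bot. y + D t = \<gamma> t"
        by (rule eventually_at_bot_linorderI[of 0]) (simp add: \<gamma>_def)
    qed
    have \<gamma>_fix: "\<gamma> t \<in> fix_space K" for t
    proof safe
      fix k assume k: "k \<in> K"
      have "D 0 \<in> fix_space K" using D(4)[of 0] fix_space_K_iff[of "D 0"] by (simp add: Q_def)
      then have "act k (\<gamma> 0) = \<gamma> 0" using k y_fix by (simp add: \<gamma>_def act_add)
      then show "act k (\<gamma> t) = \<gamma> t" by (rule unique[OF trajectory_act[OF act_Y \<gamma>] \<gamma>])
    qed
    \<comment> \<open>By uniqueness a symmetry of one point of \<open>\<gamma>\<close> is a symmetry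
      of all, so it can be tested at time 0, near \<open>p\<close>.\<close>
    have isotropy: "h \<in> K" if "act h (\<gamma> t) = \<gamma> t" for h t
    proof (rule ccontr)
      assume "h \<notin> K"
      have "act h (\<gamma> 0) = \<gamma> 0" by (rule unique[OF trajectory_act[OF act_Y \<gamma>] \<gamma> that])
      then have "act h p - p = act h (p - \<gamma> 0) - (p - \<gamma> 0)" by (simp add: act_diff)
      then have "norm (act h p - p) \<le> norm (p - \<gamma> 0) + norm (p - \<gamma> 0)"
        by (metis norm_act norm_triangle_ineq4)
      also have "\<dots> \<le> 2 * (\<epsilon> * M)" using \<gamma>0 by (simp add: norm_minus_commute)
      also have "\<dots> < \<delta>" using \<epsilon>(5) M \<delta> by (simp add: pos_le_divide_eq)
      finally show False using \<delta>_le[OF \<open>h \<notin> K\<close>] by simp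
    qed

    have \<gamma>S: "norm (\<gamma> S - act g x\<^sub>0) \<le> 3 / 8 * \<rho>"
    proof -
      have "(norm (\<gamma> S - \<kappa> S))\<^sup>2 \<le> ((norm (\<gamma> 0 - \<kappa> 0))\<^sup>2 + \<epsilon>\<^sup>2) * exp ((2 * L + 1) * S)"
      proof (rule gronwall[OF S L(1) _ \<kappa>(3)])
        show "(\<gamma> has_vector_derivative Y (\<gamma> t)) (at t)" for t using \<gamma> by (simp add: trajectory_def)
        show "norm (Y (\<gamma> t) - X (\<kappa> t)) \<le> L * norm (\<gamma> t - \<kappa> t) + \<epsilon>" for t
          using norm_triangle_ineq[of "X (\<gamma> t) - X (\<kappa> t)" "N (\<gamma> t)"] L(2)[of "\<gamma> t" "\<kappa> t"] N_le[of "\<gamma> t"]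
          by (simp add: Y_eq algebra_simps)
      qed
      also have "\<dots> \<le> ((\<epsilon> * M)\<^sup>2 + \<epsilon>\<^sup>2) * exp ((2 * L + 1) * S)"
        using \<gamma>0 by (intro mult_right_mono add_right_mono power_mono) (auto simp: \<kappa>(1) p_def \<eta>_def)
      also have "\<dots> = \<epsilon> * (\<epsilon> * E)"
      proof -
        have "((\<epsilon> * M)\<^sup>2 + \<epsilon>\<^sup>2) * e = \<epsilon> * (\<epsilon> * ((M\<^sup>2 + 1) * e))" for e
          by (simp add: power2_eq_square algebra_simps)
        then show ?thesis unfolding E_def .
      qed
      also have "\<dots> \<le> \<rho> / 8 * (\<rho> / 8)"
      proof (rule mult_mono)
        show "\<epsilon> * E \<le> \<rho> / 8" using \<epsilon>(4) E by (simp add: pos_le_divide_eq mult.assoc)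
        show "\<epsilon> \<le> \<rho> / 8" using \<epsilon>(3) \<rho> by simp
      qed (use \<epsilon> E \<rho> in auto)
      finally have "(norm (\<gamma> S - \<kappa> S))\<^sup>2 \<le> (\<rho> / 8)\<^sup>2" by (simp add: power2_eq_square)
      then have "norm (\<gamma> S - \<kappa> S) \<le> \<rho> / 8" by (rule power2_le_imp_le) (use \<rho> in simp)
      then show ?thesis
        using norm_triangle_ineq[of "\<gamma> S - \<kappa> S" "\<kappa> S - act g x\<^sub>0"] \<kappa>(2) by simp
    qed
    define f where "f t = (\<gamma> (S + t) - act g y) \<bullet> (\<gamma> (S + t) - act g y)" for t
    have f_deriv: "(f has_real_derivative 2 * ((\<gamma> (S + t) - act g y) \<bullet> Y (\<gamma> (S + t)))) (at t)" for t
    proof -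
      have "(\<gamma> \<circ> (\<lambda>t. S + t) has_vector_derivative 1 *\<^sub>R Y (\<gamma> (S + t))) (at t)"
        using \<gamma> by (intro vector_diff_chain_at) (auto simp: trajectory_def intro!: derivative_eq_intros)
      then have "((\<lambda>t. \<gamma> (S + t) - act g y) has_vector_derivative Y (\<gamma> (S + t)) - 0) (at t)"
        by (intro has_vector_derivative_diff has_vector_derivative_const) (simp add: o_def)
      then have d: "((\<lambda>t. \<gamma> (S + t) - act g y) has_derivative (\<lambda>s. s *\<^sub>R Y (\<gamma> (S + t)))) (at t)"
        by (simp add: has_vector_derivative_def)
      show ?thesis
        unfolding f_def has_field_derivative_def
        by (rule has_derivative_eq_rhs[OF has_derivative_inner[OF d d]])
           (auto simp: inner_commute algebra_simps)
    qed
    \<comment> \<open>As long as \<open>\<gamma>\<close> is within \<open>\<rho> / 2\<close> of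
      \<open>act g y\<close>, it is in the ball where \<open>X\<close> is the linear sink on the
      fixed space of \<open>K\<close>. The sink contributes \<open>- 2 * f\<close>, and the
      difference of \<open>N\<close> at most \<open>2 * \<epsilon> * f \<le> f\<close>.\<close>
    have f_le: "f t \<le> f 0 * exp (- 1 * t)" if "0 \<le> t" for t
    proof (rule exponential_trap[OF f_deriv, where R = "(\<rho> / 2)\<^sup>2"])
      have "norm (\<gamma> S - act g y) \<le> 7 / 16 * \<rho>"
        using norm_triangle_ineq4[of "\<gamma> S - act g x\<^sub>0" "act g y - act g x\<^sub>0"] \<gamma>S gy_gx0[of g] \<epsilon>(3) by simp
      then have "norm (\<gamma> S - act g y) < \<rho> / 2" using \<rho> by linarith
      then have "(norm (\<gamma> S - act g y))\<^sup>2 < (\<rho> / 2)\<^sup>2" by (intro power_strict_mono) auto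
      then show "f 0 < (\<rho> / 2)\<^sup>2" by (simp add: f_def power2_norm_eq_inner)
    next
      fix t assume "f t < (\<rho> / 2)\<^sup>2"
      then have "(norm (\<gamma> (S + t) - act g y))\<^sup>2 < (\<rho> / 2)\<^sup>2" by (simp add: f_def power2_norm_eq_inner)
      then have "norm (\<gamma> (S + t) - act g y) < \<rho> / 2" by (rule power_less_imp_less_base) (use \<rho> in simp)
      then have le: "norm (\<gamma> (S + t) - act g x\<^sub>0) \<le> \<rho>"
        using norm_triangle_ineq[of "\<gamma> (S + t) - act g y" "act g y - act g x\<^sub>0"] gy_gx0[of g] \<epsilon>(3) \<rho> by simp
      let ?d = "\<gamma> (S + t) - act g y"
      have "norm (act g y - act g x\<^sub>0) \<le> \<rho>" using gy_gx0[of g] \<epsilon>(3) \<rho> by linarith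
      then have "X (act g y) = act g x\<^sub>0 - act g y" using gy_fix by (intro sink_near_gx0[OF act_X lin])
      moreover have "X (\<gamma> (S + t)) = act g x\<^sub>0 - \<gamma> (S + t)"
        using le \<gamma>_fix by (intro sink_near_gx0[OF act_X lin])
      ultimately have "Y (\<gamma> (S + t)) - Y (act g y) = (N (\<gamma> (S + t)) - N (act g y)) - ?d"
        by (simp add: Y_eq)
      then have "Y (\<gamma> (S + t)) = (N (\<gamma> (S + t)) - N (act g y)) - ?d"
        by (simp add: Y_gy)
      then have "?d \<bullet> Y (\<gamma> (S + t)) = ?d \<bullet> (N (\<gamma> (S + t)) - N (act g y)) - f t"
        by (simp add: f_def inner_diff_right)
      also have "?d \<bullet> (N (\<gamma> (S + t)) - N (act g y)) \<le> norm ?d * norm (N (\<gamma> (S + t)) - N (act g y))"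
        by (rule norm_cauchy_schwarz)
      also have "\<dots> \<le> norm ?d * (\<epsilon> * norm ?d)" by (intro mult_left_mono N_Lip) simp
      also have "\<dots> = \<epsilon> * f t" by (simp add: f_def power2_eq_square flip: power2_norm_eq_inner)
      also have "\<dots> \<le> 1 / 2 * f t" using \<epsilon>(2) by (intro mult_right_mono) (auto simp: f_def)
      finally show "2 * (?d \<bullet> Y (\<gamma> (S + t))) \<le> - 1 * f t" by simp
    qed (use that in \<open>auto simp: f_def\<close>)
    have lim_top: "(\<gamma> \<longlongrightarrow> act g y) at_top"
    proof -
      have "((\<lambda>t. sqrt (f 0 * exp (- 1 * t))) \<longlongrightarrow> sqrt 0) at_top"
        by (intro tendsto_real_sqrt) real_asymp
      then have sqrt0: "((\<lambda>t. sqrt (f 0 * exp (- 1 * t))) \<longlongrightarrow> 0) at_top" by simp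
      have "((\<lambda>t. \<gamma> (S + t) - act g y) \<longlongrightarrow> 0) at_top"
      proof (rule Lim_null_comparison[OF _ sqrt0])
        show "\<forall>\<^sub>F t in at_top. norm (\<gamma> (S + t) - act g y) \<le> sqrt (f 0 * exp (- 1 * t))"
        proof (rule eventually_at_top_linorderI[of 0])
          fix t :: real assume "0 \<le> t"
          then have "sqrt (f t) \<le> sqrt (f 0 * exp (- 1 * t))" using f_le by (intro real_sqrt_le_mono) auto
          then show "norm (\<gamma> (S + t) - act g y) \<le> sqrt (f 0 * exp (- 1 * t))"
            by (simp add: f_def norm_eq_sqrt_inner)
        qed
      qed
      then have "((\<lambda>t. \<gamma> (S + t)) \<longlongrightarrow> act g y) at_top" by (simp add: LIM_zero_iff)
      then have "((\<lambda>t. \<gamma> (S + (t - S))) \<longlongrightarrow> act g y) at_top"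
        by (rule filterlim_compose) real_asymp
      then show ?thesis by simp
    qed

    let ?X\<^sub>0 = "orbit G act y"
    have orbit: "?X\<^sub>0 = {act h y | h. True}" by (simp add: orbit_def)
    have hyperbolic: "hyperbolic_equilibrium Y (act h y)" for h
      unfolding hyperbolic_equilibrium_def
    proof (intro conjI allI impI)
      show "Y (act h y) = 0" by (rule Y_gy)
      fix z assume z: "complexified_eigenvalue (frechet_derivative Y (at (act h y))) z"
      \<comment> \<open>The derivative of \<open>X\<close> at this translate: a conjugate of
        \<open>A\<close>, hence again symmetric and isometric.\<close>
      define B where "B w = act h (A (act (inv\<^bsub>G\<^esub> h) w))" for w
      have "bounded_linear B"
        unfolding B_def[abs_def]
        using linear_compose[OF linear_compose[OF linear_act[of "inv\<^bsub>G\<^esub> h"] linear_A] linear_act[of h]]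
        by (simp add: o_def linear_conv_bounded_linear)
      then have "((\<lambda>v. B (v - act h x\<^sub>0)) has_derivative B) (at (act h y))"
        by (auto intro!: derivative_eq_intros bounded_linear.has_derivative[of B])
      then have "(X has_derivative B) (at (act h y))"
      proof (rule has_derivative_transform_within_open[where s = "ball (act h x\<^sub>0) \<rho>"])
        show "act h y \<in> ball (act h x\<^sub>0) \<rho>"
          using gy_gx0[of h] \<epsilon>(3) \<rho> by (simp add: dist_norm norm_minus_commute)
        fix v assume "v \<in> ball (act h x\<^sub>0) \<rho>"
        then show "B (v - act h x\<^sub>0) = X v"
          using translate_linear_part[OF act_X lin, of \<rho> v h]
          by (simp add: B_def dist_norm norm_minus_commute)
      qed simp
      then have B: "frechet_derivative X (at (act h y)) = B" by (rule frechet_derivative_at[symmetric])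
      show "Re z \<noteq> 0"
      proof (rule spectrum_off_imaginary_axis[OF _ _ _ z])
        show "B u \<bullet> v = u \<bullet> B v" for u v
          using inner_act_left[of h _ v] inner_act_left[of "inv\<^bsub>G\<^esub> h" u] by (simp add: B_def inner_A)
        show "norm (B v) = norm v" for v by (simp add: B_def norm_A)
        show "norm (frechet_derivative Y (at (act h y)) v - B v) \<le> 1 / 2 * norm v" for v
          using near1[of "act h y" v] mult_right_mono[of \<epsilon> "1 / 2" "norm v"] \<epsilon>(2) by (simp add: B)
      qed
    qed
    have "normally_hyperbolic_rel_equilibrium G Y ?X\<^sub>0"
      unfolding normally_hyperbolic_rel_equilibrium_def
    proof
      show "\<forall>x\<in>?X\<^sub>0. hyperbolic_equilibrium Y x" using hyperbolic by (auto simp: orbit)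
    qed blast
    \<comment> \<open>An orbit meeting an equilibrium is constant; its limit in the past would make
      it equal to \<open>y\<close>, so \<open>D 0 = 0\<close>, against
      \<open>norm (D 0 - \<eta>) \<le> 2 * \<epsilon> * norm \<eta>\<close>.\<close>
    moreover have "\<gamma> t \<notin> ?X\<^sub>0" for t
    proof
      assume "\<gamma> t \<in> ?X\<^sub>0"
      then obtain h where h: "\<gamma> t = act h y" by (auto simp: orbit)
      have "trajectory Y (\<lambda>_. act h y)" by (simp add: trajectory_def Y_gy)
      then have const: "\<gamma> s = act h y" for s by (rule unique[OF \<gamma> _ h])
      then have "\<gamma> = (\<lambda>_. act h y)" by (rule ext)
      then have "((\<lambda>_. act h y) \<longlongrightarrow> y) (at_bot :: real filter)" using lim_bot by metis
      then have "act h y = y" by (simp add: tendsto_const_iff)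
      then have "D 0 = 0" using const[of 0] by (simp add: \<gamma>_def)
      then have "norm \<eta> \<le> 2 * \<epsilon> * norm \<eta>" using D(3) by simp
      then show False using \<epsilon>(2) \<eta>(1) by simp
    qed
    moreover have "((\<lambda>t. infdist (\<gamma> t) ?X\<^sub>0) \<longlongrightarrow> 0) F" if "(\<gamma> \<longlongrightarrow> act h y) F" for F h
    proof (rule Lim_null_comparison)
      show "\<forall>\<^sub>F t in F. norm (infdist (\<gamma> t) ?X\<^sub>0) \<le> dist (\<gamma> t) (act h y)"
        by (intro always_eventually allI) (auto simp: infdist_nonneg orbit intro!: infdist_le)
      show "((\<lambda>t. dist (\<gamma> t) (act h y)) \<longlongrightarrow> 0) F" using that tendsto_dist_iff by blast
    qed
    note this[of "\<one>\<^bsub>G\<^esub>" at_bot] this[of g at_top]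
    ultimately have "normally_hyperbolic_rel_equilibrium G Y ?X\<^sub>0"
      "relative_homoclinic_trajectory Y ?X\<^sub>0 \<gamma>"
      using \<gamma> lim_bot lim_top by (simp_all add: relative_homoclinic_trajectory_def)
    moreover have "has_isotropy G K \<gamma>"
      unfolding has_isotropy_def stabilizer_def using isotropy \<gamma>_fix by auto
    moreover have "has_twist G g \<gamma>"
      unfolding has_twist_def using lim_bot lim_top by auto
    ultimately show "\<exists>X\<^sub>0 \<gamma>. normally_hyperbolic_rel_equilibrium G Y X\<^sub>0 \<and>
        relative_homoclinic_trajectory Y X\<^sub>0 \<gamma> \<and> has_isotropy G K \<gamma> \<and> has_twist G g \<gamma>"
      by blast
  qed
qed

end

theorem theorem4p6:
  fixes G :: "('g::finite) monoid" and K H :: "'g set" and g :: 'g and r :: enat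
  assumes "group G" and "carrier G = UNIV"
    and "homoclinic_triple G K g H"
    and "H \<subseteq> normalizer G K \<inter> normalizer G (conj_subgroup G K (inv\<^bsub>G\<^esub> g))"
    and "1 \<le> r"
  shows "\<exists>U. openin (equivariant_fields_topology G r) U \<and> U \<noteq> {} \<and>
    (\<forall>X\<in>U. \<exists>X\<^sub>0 \<gamma>.
       normally_hyperbolic_rel_equilibrium G X X\<^sub>0 \<and>
       relative_homoclinic_trajectory X X\<^sub>0 \<gamma> \<and>
       has_isotropy G K \<gamma> \<and> has_twist G g \<gamma>)"
proof -
  interpret homoclinic G K H g
    using assms(1-4) by (intro homoclinic.intro regular_rep.intro regular_rep_axioms.intro homoclinic_axioms.intro)
  obtain X L \<rho> a S \<kappa> where X: "\<And>h v. act h (X v) = X (act h v)" "vsmooth X" "0 \<le> L"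
    "\<And>u v. norm (X u - X v) \<le> L * norm (u - v)" "0 < \<rho>" "\<And>v. norm (v - x\<^sub>0) \<le> \<rho> \<Longrightarrow> X v = A (v - x\<^sub>0)"
    "0 < a" "a * norm W \<le> \<rho> / 4" "0 \<le> S" "\<kappa> 0 = x\<^sub>0 + a *\<^sub>R W" "norm (\<kappa> S - act g x\<^sub>0) \<le> \<rho> / 4"
    "\<And>t. 0 \<le> t \<Longrightarrow> t \<le> S \<Longrightarrow> (\<kappa> has_vector_derivative X (\<kappa> t)) (at t)"
    by (rule base_field) blast
  have X_Cr: "X \<in> Cr_fields r" by (rule vsmooth_in_Cr_fields[OF X(2)])
  note diff = Cr_fields_differentiable[OF _ \<open>1 \<le> r\<close>]
  obtain \<epsilon> where \<epsilon>: "0 < \<epsilon>"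
    "\<And>Y. (\<And>v. Y differentiable (at v)) \<Longrightarrow> (\<And>h v. act h (Y v) = Y (act h v)) \<Longrightarrow>
      (\<And>v. norm (Y v - X v) \<le> \<epsilon>) \<Longrightarrow>
      (\<And>v w. norm (frechet_derivative Y (at v) w - frechet_derivative X (at v) w) \<le> \<epsilon> * norm w) \<Longrightarrow>
      \<exists>X\<^sub>0 \<gamma>. normally_hyperbolic_rel_equilibrium G Y X\<^sub>0 \<and> relative_homoclinic_trajectory Y X\<^sub>0 \<gamma> \<and>
        has_isotropy G K \<gamma> \<and> has_twist G g \<gamma>"
    by (rule persistent_connection[OF X(1) diff[OF X_Cr] X(3-12)]) blast+
  \<comment> \<open>\<open>Ck_near\<close> bounds each point strictly but leaves no uniform gap.
    Asking for a smaller \<open>\<eta>\<close> provides one, and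
    \<open>(\<epsilon> - \<eta>) / 2\<close> serves as a constant gauge for openness.\<close>
  define T where "T = {Y \<in> Cr_fields r. \<exists>\<eta><\<epsilon>. Y \<in> Ck_near 1 (\<lambda>_. \<eta>) X}"
  have "whitney_open r T"
    unfolding whitney_open_def
  proof (intro conjI ballI)
    fix Y assume "Y \<in> T"
    then obtain \<eta> where \<eta>: "\<eta> < \<epsilon>" "Y \<in> Ck_near 1 (\<lambda>_. \<eta>) X" by (auto simp: T_def)
    have "Ck_near 1 (\<lambda>_. (\<epsilon> - \<eta>) / 2) Y \<inter> Cr_fields r \<subseteq> T"
    proof
      fix Z assume Z: "Z \<in> Ck_near 1 (\<lambda>_. (\<epsilon> - \<eta>) / 2) Y \<inter> Cr_fields r"
      then have "Z \<in> Ck_near 1 (\<lambda>_. \<eta> + (\<epsilon> - \<eta>) / 2) X" using Ck_near_triangle[OF \<eta>(2)] by blast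
      moreover have "\<eta> + (\<epsilon> - \<eta>) / 2 < \<epsilon>" using \<eta>(1) by (simp add: field_simps)
      ultimately show "Z \<in> T" using Z by (auto simp: T_def)
    qed
    then show "\<exists>k \<delta>. enat k \<le> r \<and> continuous_on UNIV \<delta> \<and> (\<forall>x. 0 < \<delta> x) \<and> Ck_near k \<delta> Y \<inter> Cr_fields r \<subseteq> T"
      using \<eta>(1) \<open>1 \<le> r\<close>
      by (intro exI[of _ 1] exI[of _ "\<lambda>_. (\<epsilon> - \<eta>) / 2"]) (auto simp: one_enat_def)
  qed (auto simp: T_def)
  then have "openin (equivariant_fields_topology G r) (T \<inter> {Y. equivariant G Y})"
    unfolding equivariant_fields_topology_def openin_subtopology openin_whitney by blast
  moreover have "X \<in> T \<inter> {Y. equivariant G Y}"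
  proof -
    have "X \<in> Ck_near 1 (\<lambda>_. \<epsilon> / 2) X" using \<epsilon>(1) by (simp add: Ck_near_def)
    moreover have "\<epsilon> / 2 < \<epsilon>" using \<epsilon>(1) by simp
    ultimately have "\<exists>\<eta><\<epsilon>. X \<in> Ck_near 1 (\<lambda>_. \<eta>) X" by blast
    then show ?thesis using X_Cr X(1) by (simp add: T_def equivariant_def)
  qed
  moreover have "\<exists>X\<^sub>0 \<gamma>. normally_hyperbolic_rel_equilibrium G Y X\<^sub>0 \<and>
      relative_homoclinic_trajectory Y X\<^sub>0 \<gamma> \<and> has_isotropy G K \<gamma> \<and> has_twist G g \<gamma>"
    if Y: "Y \<in> T \<inter> {Y. equivariant G Y}" for Y
  proof -
    obtain \<eta> where \<eta>: "\<eta> < \<epsilon>" "Y \<in> Ck_near 1 (\<lambda>_. \<eta>) X" and Y_Cr: "Y \<in> Cr_fields r"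
      using Y by (auto simp: T_def)
    show ?thesis
    proof (rule \<epsilon>(2))
      show "Y differentiable (at v)" for v by (rule diff[OF Y_Cr])
      show "act h (Y v) = Y (act h v)" for h v using Y by (simp add: equivariant_def)
      note near = Ck_near_1D[OF \<eta>(2) diff[OF X_Cr] diff[OF Y_Cr]]
      show "norm (Y v - X v) \<le> \<epsilon>" for v using near(1)[of v] \<eta>(1) by simp
      show "norm (frechet_derivative Y (at v) w - frechet_derivative X (at v) w) \<le> \<epsilon> * norm w" for v w
        using near(2)[of v w] mult_right_mono[of \<eta> \<epsilon> "norm w"] \<eta>(1) by simp
    qed
  qed
  ultimately show ?thesis by blast
qed

end
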